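(* Let $n\geqslant 6$ and let $H$ be a graph on $n$ vertices with at most $n-2$ edges. Then $H$ packs with $P_n^2$ if and only if $H$ is $\mathcal{H}^*_n$-free, i.e. $H$ contains no graph of $\mathcal{H}^*_n$ as a subgraph.
   Context: All graphs are finite and simple. $P_n$, $K_n$, $S_n$ denote the path, the complete graph and the star on $n$ vertices, respectively (so $S_k$ has one center of degree $k-1$). $K_4^-$ is $K_4$ with one edge deleted. $G\cup H$ is the disjoint union. The 2-power $G^2$ of a graph $G$ has vertex set $V(G)$, two vertices being adjacent iff their distance in $G$ is at most two; so $P_n^2$ is the square of the $n$-vertex path. Two graphs $G,H$ on $n$ vertices pack (or $G$ packs with $H$) if $K_n$ contains edge-disjoint copies of $G$ and $H$. Graphs with fewer than $n$ vertices are regarded as $n$-vertex graphs by adding isolated vertices. The family $\mathcal{H}_n$ is defined by: $\mathcal{H}_6=\{K_3\}$; $\mathcal{H}_7=\{K_4^-, S_5\cup K_2, S_6\}$; $\mathcal{H}_8=\{K_4, S_6\cup K_2, S_7\}$; $\mathcal{H}_9=\{K_4\}$; $\mathcal{H}_{10}=\{S_8\cup K_2,S_9\}$; $\mathcal{H}_{11}=\{S_9\cup K_2,S_{10}\}$; $\mathcal{H}_{12}=\{K_5,S_{10}\cup K_2,S_{11}\}$; $\mathcal{H}_{13}=\{S_{11}\cup K_2,S_{12}\}$; and $\mathcal{H}_n=\{S_{n-2}\cup K_2, S_{n-1}\}$ for $n\geqslant 14$. Then $\mathcal{H}^*_n=\mathcal{H}_n\cup\{S_{n-2}\cup K_2,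 S_{n-1}\}$ for $n\in\{6,9\}$ and $\mathcal{H}^*_n=\mathcal{H}_n$ otherwise. *)

theory Defs
  imports Main "HOL-Library.Extended_Nat" "HOL-Library.Nat_Bijection"
begin

record 'a sgraph =
  verts :: "'a set"
  edges :: "'a set set"

definition simple_graph :: "'a sgraph \<Rightarrow> bool" where
  "simple_graph G \<longleftrightarrow> finite (verts G) \<and> (\<forall>e\<in>edges G. e \<subseteq> verts G \<and> card e = 2)"

definition subgraph :: "'a sgraph \<Rightarrow> 'a sgraph \<Rightarrow> bool" where
  "subgraph G' G \<longleftrightarrow> simple_graph G' \<and> verts G' \<subseteq> verts G \<and> edges G' \<subseteq> edges G"

definition isomorphic :: "'a sgraph \<Rightarrow> 'b sgraph \<Rightarrow> bool" where
  "isomorphic G H \<longleftrightarrow> (\<exists>f. bij_betw f (verts G) (verts H) \<and>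
     (\<forall>u\<in>verts G. \<forall>v\<in>verts G. {u, v} \<in> edges G \<longleftrightarrow> {f u, f v} \<in> edges H))"

definition copy_in :: "'a sgraph \<Rightarrow> 'b sgraph \<Rightarrow> 'b sgraph \<Rightarrow> bool" where
  "copy_in F F' G \<longleftrightarrow> subgraph F' G \<and> isomorphic F F'"

text \<open>Subgraphs need not be induced.\<close>

definition contains :: "'a sgraph \<Rightarrow> 'b sgraph \<Rightarrow> bool" where
  "contains G F \<longleftrightarrow> (\<exists>F'. copy_in F F' G)"

definition free_of :: "'b sgraph set \<Rightarrow> 'a sgraph \<Rightarrow> bool" where
  "free_of \<F> G \<longleftrightarrow> (\<forall>F\<in>\<F>. \<not> contains G F)"

definition complete_graph :: "nat \<Rightarrow> nat sgraph" where
  "complete_graph n = \<lparr>verts = {..<n}, edges = {{i, j} | i j. i < n \<and> j < n \<and> i \<noteq> j}\<rparr>"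

definition path_graph :: "nat \<Rightarrow> nat sgraph" where
  "path_graph n = \<lparr>verts = {..<n}, edges = {{i, Suc i} | i. Suc i < n}\<rparr>"

text \<open>The index counts vertices, not leaves: for \<open>n \<ge> 1\<close> the centre \<open>0\<close> has degree \<open>n - 1\<close>.\<close>

definition star_graph :: "nat \<Rightarrow> nat sgraph" where
  "star_graph n = \<lparr>verts = {..<n}, edges = {{0, i} | i. 0 < i \<and> i < n}\<rparr>"

definition K4_minus :: "nat sgraph" where
  "K4_minus = (complete_graph 4)\<lparr>edges := edges (complete_graph 4) - {{0, 1}}\<rparr>"

text \<open>The two vertex sets are made disjoint by tagging with \<open>Inl\<close> and \<open>Inr\<close>; the
  bijection \<^const>\<open>sum_encode\<close> brings the result back to \<^typ>\<open>nat\<close>, so that all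
  graphs of a family have the same type.\<close>

definition disjoint_union :: "nat sgraph \<Rightarrow> nat sgraph \<Rightarrow> nat sgraph" where
  "disjoint_union G H =
     \<lparr>verts = (\<lambda>v. sum_encode (Inl v)) ` verts G \<union> (\<lambda>v. sum_encode (Inr v)) ` verts H,
      edges = (\<lambda>e. (\<lambda>v. sum_encode (Inl v)) ` e) ` edges G \<union>
              (\<lambda>e. (\<lambda>v. sum_encode (Inr v)) ` e) ` edges H\<rparr>"

definition is_walk :: "'a sgraph \<Rightarrow> 'a \<Rightarrow> 'a list \<Rightarrow> 'a \<Rightarrow> bool" where
  "is_walk G u p v \<longleftrightarrow> p \<noteq> [] \<and> set p \<subseteq> verts G \<and> hd p = u \<and> last p = v \<and>
     successively (\<lambda>x y. {x, y} \<in> edges G) p"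

text \<open>Walks are vertex lists, hence the length \<open>length p - 1\<close>. The distance is \<open>\<infinity>\<close> if
  there is no walk.\<close>

definition graph_dist :: "'a sgraph \<Rightarrow> 'a \<Rightarrow> 'a \<Rightarrow> enat" where
  "graph_dist G u v = (INF p\<in>{p. is_walk G u p v}. enat (length p - 1))"

definition graph_power :: "nat \<Rightarrow> 'a sgraph \<Rightarrow> 'a sgraph" where
  "graph_power k G = \<lparr>verts = verts G,
     edges = {{u, v} | u v. u \<in> verts G \<and> v \<in> verts G \<and> u \<noteq> v \<and> graph_dist G u v \<le> enat k}\<rparr>"

definition packs :: "nat \<Rightarrow> 'a sgraph \<Rightarrow> 'b sgraph \<Rightarrow> bool" where
  "packs n G H \<longleftrightarrow> (\<exists>G' H'. copy_in G G' (complete_graph n) \<and> copy_in H H' (complete_graph n) \<and>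
     edges G' \<inter> edges H' = {})"

abbreviation star_K2 :: "nat \<Rightarrow> nat sgraph" where
  "star_K2 k \<equiv> disjoint_union (star_graph k) (complete_graph 2)"

text \<open>The family is only defined for \<open>n \<ge> 6\<close>; the value \<open>{}\<close> below that is a dummy.\<close>

definition family_H :: "nat \<Rightarrow> nat sgraph set" where
  "family_H n =
    (if n = 6 then {complete_graph 3}
     else if n = 7 then {K4_minus, star_K2 5, star_graph 6}
     else if n = 8 then {complete_graph 4, star_K2 6, star_graph 7}
     else if n = 9 then {complete_graph 4}
     else if n = 10 then {star_K2 8, star_graph 9}
     else if n = 11 then {star_K2 9, star_graph 10}
     else if n = 12 then {complete_graph 5, star_K2 10, star_graph 11}
     else if n = 13 then {star_K2 11, star_graph 12}
     else if n \<ge> 14 then {star_K2 (n - 2), star_graph (n - 1)}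
     else {})"

definition family_H_star :: "nat \<Rightarrow> nat sgraph set" where
  "family_H_star n =
    (if n \<in> {6, 9} then family_H n \<union> {star_K2 (n - 2), star_graph (n - 1)} else family_H n)"

end

(*  A packing of H with the square of the path is an ordering of the vertices of H in which no edge
    of H joins vertices at distance at most two ("spread" order). Each vertex then lies in a window
    of three consecutive, pairwise nonadjacent vertices, and a clique of size r needs at least
    3 r - 2 positions; this shows that the forbidden graphs cannot occur. Conversely, given at most
    n - 2 edges, the absence of the two stars says exactly that every vertex lies in an independent
    triple.

    The existence of a spread order is proved by induction on n. A leaf can be inserted at one of the
    two ends of an order of the remaining vertices. Without leaves there are at least two isolated
    vertices x, x'; a vertex y of maximum degree at least 3 is put in front as y, x, x', and if all
    degrees are at most 2, a vertex y of degree 2 is inserted as a pair y, x. If the smaller graph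
    violates the induction hypothesis, H either has a vertex c of degree at least n - 4, and then
    starts with c and two nonadjacent non-neighbours of c, or belongs to a few small cases. These
    are settled by a verified search over all ways to add the remaining edges. *)

theory Submission
  imports Defs "HOL-Library.Multiset"
begin

subsection \<open>Spread orders\<close>

text \<open>The exceptional sizes come from two competing bounds. With at most n - 2 edges, a clique
  on r vertices requires r (r - 1) / 2 \<le> n - 2, while an order with such a clique requires 3 r -
  2 \<le> n. From n = 6 on, these clash only for r = 3 at n = 6, for r = 4 at n = 8, 9 and for r = 5
  at n = 12. K4 minus an edge has five edges and so first fits at n = 7, where a triangle can only
  take the positions 0, 3, 6 and the two nonadjacent vertices would have to share one.

  The obstacle is that the hypothesis is not hereditary: a deletion may arrive at an exceptional
  size with a graph that was harmless before. Each deletion removes at least as many edges as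
  vertices (a leaf and its edge; \<open>y, x, x'\<close> and at least three edges;
  \<open>y, x\<close> and two edges), which preserves the edge bound. An obstruction that shows up
  afterwards leaves very few edges outside itself, and counting these settles the sizes just above
  the exceptional ones.\<close>

definition fgraph :: "'a set \<Rightarrow> 'a set set \<Rightarrow> bool" where
  "fgraph V E \<longleftrightarrow> finite V \<and> (\<forall>e\<in>E. e \<subseteq> V \<and> card e = 2)"

definition nbrs :: "'a set set \<Rightarrow> 'a \<Rightarrow> 'a set" where
  "nbrs E v = {u. {v, u} \<in> E}"

definition del_vertex :: "'a \<Rightarrow> 'a set set \<Rightarrow> 'a set set" where
  "del_vertex v E = {e \<in> E. v \<notin> e}"

primrec spread :: "'a set set \<Rightarrow> 'a list \<Rightarrow> bool" where
  "spread E [] = True"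
| "spread E (x # xs) \<longleftrightarrow> (\<forall>y\<in>set (take 2 xs). {x, y} \<notin> E) \<and> spread E xs"

definition spread_order :: "'a set \<Rightarrow> 'a set set \<Rightarrow> 'a list \<Rightarrow> bool" where
  "spread_order V E xs \<longleftrightarrow> distinct xs \<and> set xs = V \<and> spread E xs"

lemma fgraph_edge:
  assumes "fgraph V E" "{u, v} \<in> E"
  shows "u \<in> V" "v \<in> V" "u \<noteq> v"
proof -
  have "{u, v} \<subseteq> V \<and> card {u, v} = 2" using assms unfolding fgraph_def by blast
  then show "u \<in> V" "v \<in> V" "u \<noteq> v" by auto
qed

lemma fgraph_edge_cases:
  assumes "fgraph V E" "e \<in> E"
  obtains u v where "e = {u, v}" "u \<noteq> v" "u \<in> V" "v \<in> V"
proof -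
  have "e \<subseteq> V" "card e = 2" using assms unfolding fgraph_def by auto
  then show ?thesis using that by (auto simp: card_2_iff)
qed

lemma finite_edges: "fgraph V E \<Longrightarrow> finite E"
  unfolding fgraph_def by (meson PowI finite_Pow_iff finite_subset subsetI)

lemma nbrs_subset: "fgraph V E \<Longrightarrow> nbrs E v \<subseteq> V - {v}"
  unfolding nbrs_def using fgraph_edge by fast

lemma finite_nbrs: "fgraph V E \<Longrightarrow> finite (nbrs E v)"
  using nbrs_subset[of V E v] by (meson fgraph_def finite_Diff finite_subset)

lemma nbrs_sym: "u \<in> nbrs E v \<longleftrightarrow> v \<in> nbrs E u"
  by (simp add: nbrs_def insert_commute)

lemma card_incident:
  assumes "fgraph V E"
  shows "card {e \<in> E. v \<in> e} = card (nbrs E v)"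
proof -
  have "bij_betw (\<lambda>u. {v, u}) (nbrs E v) {e \<in> E. v \<in> e}"
  proof (rule bij_betwI')
    fix e assume "e \<in> {e \<in> E. v \<in> e}"
    then obtain a b where "e = {a, b}" "e \<in> E" "v \<in> {a, b}"
      using fgraph_edge_cases[OF assms] by (metis (no_types, lifting) mem_Collect_eq)
    then show "\<exists>u\<in>nbrs E v. e = {v, u}"
      unfolding nbrs_def by (auto simp: insert_commute)
  qed (auto simp: nbrs_def doubleton_eq_iff)
  then show ?thesis by (simp add: bij_betw_same_card)
qed

lemma card_del_vertex:
  assumes "fgraph V E"
  shows "card E = card (del_vertex v E) + card (nbrs E v)"
proof -
  have "E = del_vertex v E \<union> {e \<in> E. v \<in> e}" by (auto simp: del_vertex_def)
  moreover have "del_vertex v E \<inter> {e \<in> E. v \<in> e} = {}" by (auto simp: del_vertex_def)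
  moreover have "finite E" using finite_edges[OF assms] .
  ultimately have "card E = card (del_vertex v E) + card {e \<in> E. v \<in> e}"
    by (metis card_Un_disjoint finite_Un)
  then show ?thesis using card_incident[OF assms] by simp
qed

lemma sum_degrees:
  assumes "fgraph V E"
  shows "(\<Sum>v\<in>V. card (nbrs E v)) = 2 * card E"
proof -
  have fin: "finite V" "finite E" using assms finite_edges by (auto simp: fgraph_def)
  have "(\<Sum>v\<in>V. card (nbrs E v)) = (\<Sum>v\<in>V. card {e \<in> E. v \<in> e})"
    by (simp add: card_incident[OF assms])
  also have "\<dots> = 2 * card E"
  proof (rule sum_multicount[OF fin], rule ballI)
    fix e assume "e \<in> E"
    then have "{v \<in> V. v \<in> e} = e" "card e = 2" using assms by (auto simp: fgraph_def)
    then show "card {v \<in> V. v \<in> e} = 2" by simp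
  qed
  finally show ?thesis .
qed

section \<open>Deletion of a vertex and reversal of an order\<close>

lemma fgraph_del_vertex: "fgraph V E \<Longrightarrow> fgraph (V - {v}) (del_vertex v E)"
  by (auto simp: fgraph_def del_vertex_def)

lemma del_vertex_isolated:
  assumes "fgraph V E" "nbrs E x = {}"
  shows "del_vertex x E = E"
proof -
  have False if "e \<in> E" "x \<in> e" for e
  proof -
    obtain u v where "e = {u, v}" using fgraph_edge_cases[OF assms(1) \<open>e \<in> E\<close>] .
    then have "{x, u} \<in> E \<or> {x, v} \<in> E" using that by (auto simp: insert_commute)
    then show False using assms(2) by (auto simp: nbrs_def)
  qed
  then show ?thesis by (auto simp: del_vertex_def)
qed

lemma nbrs_del_vertex: "nbrs (del_vertex x E) v = (if v = x then {} else nbrs E v - {x})"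
  by (auto simp: del_vertex_def nbrs_def)

lemma doubleton_in_del_vertex: "{u, v} \<in> del_vertex x E \<longleftrightarrow> {u, v} \<in> E \<and> u \<noteq> x \<and> v \<noteq> x"
  by (auto simp: del_vertex_def)

lemma spread_cong:
  "(\<And>u v. u \<in> set xs \<Longrightarrow> v \<in> set xs \<Longrightarrow> {u, v} \<in> E \<longleftrightarrow> {u, v} \<in> E') \<Longrightarrow> spread E xs = spread E' xs"
proof (induction xs)
  case (Cons x xs)
  have "spread E xs = spread E' xs" using Cons by simp
  moreover have "\<forall>y\<in>set (take 2 xs). {x, y} \<in> E \<longleftrightarrow> {x, y} \<in> E'"
    using Cons.prems by (metis in_set_takeD list.set_intros)
  ultimately show ?case by auto
qed simp

lemma spread_del_vertex: "x \<notin> set xs \<Longrightarrow> spread (del_vertex x E) xs = spread E xs"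
  by (rule spread_cong) (auto simp: doubleton_in_del_vertex)

text \<open>The mirror image of the recursion for \<open>spread\<close>. It makes reversal a
  symmetry of spread orders, so a construction may choose the end at which it extends an
  order.\<close>

lemma spread_snoc:
  "spread E (xs @ [z]) \<longleftrightarrow> spread E xs \<and> (\<forall>y\<in>set (take 2 (rev xs)). {z, y} \<notin> E)"
proof (induction xs)
  case (Cons x xs)
  consider "xs = []" | b where "xs = [b]" | b c ys where "xs = b # c # ys"
    by (metis list.exhaust)
  then show ?case
  proof cases
    case 3
    then have "2 \<le> length xs" by simp
    then have "take 2 (rev (x # xs)) = take 2 (rev xs)" "take 2 (xs @ [z]) = take 2 xs"
      by simp_all
    then show ?thesis using Cons.IH by (auto simp del: rev.simps)
  qed (auto simp: insert_commute)
qed simp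

lemma spread_rev: "spread E (rev xs) = spread E xs"
proof (induction xs)
  case (Cons x xs)
  then show ?case by (simp add: spread_snoc conj_commute)
qed simp

lemma spread_order_rev: "spread_order V E (rev xs) = spread_order V E xs"
  by (simp add: spread_order_def spread_rev)

lemma spread_no_edges: "spread {} xs"
  by (induction xs) auto

subsection \<open>A verified search for spread orders\<close>

text \<open>The conditional replaces a disjunction so that an evaluation by rewriting looks at the
  rest of the list only after a failed test.\<close>

primrec any :: "('b \<Rightarrow> bool) \<Rightarrow> 'b list \<Rightarrow> bool" where
  "any P [] = False"
| "any P (x # xs) = (if P x then True else any P xs)"

lemma if_False_conv:
  "(if P then False else Q) \<longleftrightarrow> \<not> P \<and> Q" "(if P then Q else False) \<longleftrightarrow> P \<and> Q"
  by auto

lemma any_iff [simp]: "any P xs \<longleftrightarrow> (\<exists>x\<in>set xs. P x)"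
  by (induction xs) auto

primrec adj :: "('b \<times> 'b) list \<Rightarrow> 'b \<Rightarrow> 'b \<Rightarrow> bool" where
  "adj [] u v = False"
| "adj (p # G) u v = (if p = (u, v) then True else if p = (v, u) then True else adj G u v)"

lemma adj_iff: "adj G u v \<longleftrightarrow> (u, v) \<in> set G \<or> (v, u) \<in> set G"
  by (induction G) auto

text \<open>Backtracking search. The first list is fuel of which only the length counts, which
  allows primitive recursion. The order grows at its front, so the vertices that the next one must
  avoid are the first two of \<open>acc\<close>.\<close>

primrec extendible :: "('b \<Rightarrow> 'b \<Rightarrow> bool) \<Rightarrow> 'b list \<Rightarrow> 'b list \<Rightarrow> 'b list \<Rightarrow> bool" where
  "extendible R [] acc rs = (rs = [])"
| "extendible R (_ # fuel) acc rs = (if rs = [] then True else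
     any (\<lambda>v. if any (R v) (take 2 acc) then False
              else extendible R fuel (v # acc) (remove1 v rs)) rs)"

text \<open>Running out of fuel can make the search fail, but never succeed wrongly. The map
  \<open>f\<close> carries the labels of the search to the vertices of the graph.\<close>

lemma extendible_sound:
  assumes "extendible R fuel acc rs"
    and "\<And>u v. u \<in> set acc \<union> set rs \<Longrightarrow> v \<in> set acc \<union> set rs \<Longrightarrow> R u v \<longleftrightarrow> {f u, f v} \<in> E"
    and "spread E (map f acc)"
  shows "\<exists>ws. mset ws = mset rs \<and> spread E (map f (ws @ acc))"
  using assms
proof (induction fuel arbitrary: acc rs)
  case (Cons z fuel)
  show ?case
  proof (cases "rs = []")
    case False
    then obtain v where v: "v \<in> set rs" "\<forall>u\<in>set (take 2 acc). \<not> R v u"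
      "extendible R fuel (v # acc) (remove1 v rs)"
      using Cons.prems(1) by (auto split: if_splits)
    have sub: "set (v # acc) \<union> set (remove1 v rs) \<subseteq> set acc \<union> set rs"
      using v(1) set_remove1_subset[of v rs] by auto
    have "\<forall>u\<in>set (take 2 acc). {f v, f u} \<notin> E"
      using v(1,2) Cons.prems(2) by (metis UnCI in_set_takeD)
    then have "spread E (map f (v # acc))"
      using Cons.prems(3) by (auto simp: take_map)
    then obtain ws where "mset ws = mset (remove1 v rs)" "spread E (map f (ws @ v # acc))"
      using Cons.IH[OF v(3)] Cons.prems(2) sub by (metis subsetD)
    then show ?thesis using v(1)
      by (intro exI[of _ "ws @ [v]"]) simp
  qed (use Cons.prems(3) in auto)
qed auto

text \<open>A name for the abstraction in \<open>extendible\<close>, which yields code equations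
  without a bound variable to rewrite under.\<close>

definition extend_step :: "('b \<Rightarrow> 'b \<Rightarrow> bool) \<Rightarrow> 'b list \<Rightarrow> 'b list \<Rightarrow> 'b list \<Rightarrow> 'b \<Rightarrow> bool" where
  "extend_step R fuel acc rs v = (if any (R v) (take 2 acc) then False
     else extendible R fuel (v # acc) (remove1 v rs))"

lemma extendible_code [code]:
  "extendible R (z # fuel) acc rs = (if rs = [] then True else any (extend_step R fuel acc rs) rs)"
  "extendible R [] acc rs = (rs = [])"
  by (simp_all add: extend_step_def)

text \<open>A quantifier over all sublists of at most \<open>k\<close> entries: each entry is left
  out or moved to \<open>acc\<close>, and \<open>Q\<close> is tested on every outcome.\<close>

primrec all_subs :: "('b list \<Rightarrow> bool) \<Rightarrow> nat \<Rightarrow> 'b list \<Rightarrow> 'b list \<Rightarrow> bool" where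
  "all_subs Q k [] acc = Q acc"
| "all_subs Q k (x # xs) acc = (if all_subs Q k xs acc then
     (case k of 0 \<Rightarrow> True | Suc k' \<Rightarrow> all_subs Q k' xs (x # acc)) else False)"

text \<open>A sublist is given by the predicate that selects its entries; in the search for orders
  this predicate is membership in the actual edge set.\<close>

lemma all_subs_sound:
  "all_subs Q k xs acc \<Longrightarrow> length (filter P xs) \<le> k \<Longrightarrow> Q (rev (filter P xs) @ acc)"
proof (induction xs arbitrary: k acc)
  case (Cons x xs)
  show ?case
  proof (cases "P x")
    case True
    then obtain k' where "k = Suc k'" "length (filter P xs) \<le> k'"
      using Cons.prems(2) by (cases k) auto
    then show ?thesis using Cons True by (simp split: if_splits)
  next
    case False
    then show ?thesis using Cons by (simp split: if_splits)
  qed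
qed simp

primrec pairs :: "'b list \<Rightarrow> ('b \<times> 'b) list" where
  "pairs [] = []"
| "pairs (x # xs) = map (Pair x) xs @ pairs xs"

lemma pairs_mem: "p \<in> set (pairs xs) \<Longrightarrow> fst p \<in> set xs \<and> snd p \<in> set xs"
  by (induction xs) auto

lemma pairs_cover:
  "u \<in> set xs \<Longrightarrow> v \<in> set xs \<Longrightarrow> u \<noteq> v \<Longrightarrow> (u, v) \<in> set (pairs xs) \<or> (v, u) \<in> set (pairs xs)"
  by (induction xs) auto

lemma pairs_asym:
  "distinct xs \<Longrightarrow> (u, v) \<in> set (pairs xs) \<Longrightarrow> (v, u) \<notin> set (pairs xs)"
proof (induction xs)
  case (Cons x xs)
  then show ?case using pairs_mem[of "(u, v)" xs] pairs_mem[of "(v, u)" xs] by auto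
qed simp

primrec degree :: "('b \<times> 'b) list \<Rightarrow> 'b \<Rightarrow> nat" where
  "degree [] v = 0"
| "degree (p # G) v = (case p of (i, j) \<Rightarrow>
     if i = v then Suc (degree G v) else if j = v then Suc (degree G v) else degree G v)"

text \<open>Trying vertices of high degree first makes the search almost free of backtracking.\<close>

definition high_degree_first :: "('b \<times> 'b) list \<Rightarrow> 'b list \<Rightarrow> 'b list" where
  "high_degree_first G vl = sort_key (\<lambda>v. 9 - degree G v) vl"

lemma mset_high_degree_first: "mset (high_degree_first G vl) = mset vl"
  by (simp add: high_degree_first_def)

definition packable_or ::
  "(('b \<times> 'b) list \<Rightarrow> bool) \<Rightarrow> 'b list \<Rightarrow> 'b list \<Rightarrow> 'b list \<Rightarrow> ('b \<times> 'b) list \<Rightarrow> bool" where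
  "packable_or bad vl acc rs G = (if bad G then True else
     extendible (adj G) vl acc (high_degree_first G rs))"

text \<open>\<open>F\<close> holds the forced edges, \<open>P\<close> the pairs that may be edges as
  well, \<open>k\<close> bounds the number of further edges, and \<open>acc\<close> is a prescribed
  end of the order. The check says that every such graph satisfies \<open>bad\<close> or has a
  spread order ending in \<open>acc\<close>.\<close>

definition check_extensions ::
  "'b list \<Rightarrow> ('b \<times> 'b) list \<Rightarrow> ('b \<times> 'b) list \<Rightarrow> nat \<Rightarrow> 'b list \<Rightarrow> (('b \<times> 'b) list \<Rightarrow> bool) \<Rightarrow> bool" where
  "check_extensions vl F P k acc bad =
     all_subs (packable_or bad vl acc (filter (\<lambda>v. v \<notin> set acc) vl)) k (filter (\<lambda>p. p \<notin> set F) P) F"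

text \<open>Read through the labelling \<open>f\<close>, the actual graph is one of those tested: it
  consists of \<open>F\<close> and the pairs of \<open>P\<close> that \<open>f\<close> maps to
  edges, and the bound on \<open>card E\<close> limits the number of the latter.\<close>

lemma check_extensions_sound:
  assumes chk: "check_extensions vl F P k acc bad"
    and graph: "fgraph V E"
    and f: "inj_on f (set vl)" "f ` set vl = V" "distinct vl"
    and FP: "set F \<subseteq> set (pairs vl)" "set P \<subseteq> set (pairs vl)" "distinct P" "distinct F"
    and F: "\<And>i j. (i, j) \<in> set F \<Longrightarrow> {f i, f j} \<in> E"
    and cand: "\<And>i j. (i, j) \<in> set (pairs vl) \<Longrightarrow> {f i, f j} \<in> E \<Longrightarrow> (i, j) \<in> set F \<union> set P"
    and card: "card E \<le> length F + k"
    and acc: "set acc \<subseteq> set vl" "distinct acc" "spread E (map f acc)"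
  obtains ws where "spread_order V E (ws @ map f acc)"
  | G where "bad G" "\<And>i j. i \<in> set vl \<Longrightarrow> j \<in> set vl \<Longrightarrow> adj G i j \<longleftrightarrow> {f i, f j} \<in> E"
      "set G \<subseteq> set (pairs vl)"
proof -
  define Q where "Q = (\<lambda>(i, j). {f i, f j} \<in> E)"
  define P' where "P' = filter (\<lambda>p. p \<notin> set F) P"
  define S where "S = filter Q P'"
  define G where "G = rev S @ F"
  have finE: "finite E" using finite_edges[OF graph] .
  have GP: "set G \<subseteq> set (pairs vl)" using FP by (auto simp: G_def S_def P'_def)
  have dG: "distinct G" using FP by (auto simp: G_def S_def P'_def)
  \<comment> \<open>\<open>pairs vl\<close> contains each unordered pair in one orientation only,
    hence distinct entries name distinct edges.\<close>
  have inj: "inj_on (\<lambda>(i, j). {f i, f j}) (set (pairs vl))"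
  proof (rule inj_onI, clarify)
    fix a b c d assume *: "(a, b) \<in> set (pairs vl)" "(c, d) \<in> set (pairs vl)" "{f a, f b} = {f c, f d}"
    then have mem: "a \<in> set vl" "b \<in> set vl" "c \<in> set vl" "d \<in> set vl"
      using pairs_mem by fastforce+
    from *(3) consider "f a = f c \<and> f b = f d" | "f a = f d \<and> f b = f c"
      by (auto simp: doubleton_eq_iff)
    then show "a = c \<and> b = d"
    proof cases
      case 1 then show ?thesis using f(1) mem by (auto dest: inj_onD)
    next
      case 2
      then have "a = d" "b = c" using f(1) mem by (auto dest: inj_onD)
      then show ?thesis using pairs_asym[OF f(3)] * by blast
    qed
  qed
  \<comment> \<open>Counting the distinct edges listed in \<open>G\<close> against
    \<open>card E\<close> leaves at most \<open>k\<close> beyond the forced ones.\<close>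
  have "card ((\<lambda>(i, j). {f i, f j}) ` set G) = length G"
    using card_image[OF inj_on_subset[OF inj GP]] distinct_card[OF dG] by simp
  moreover have "(\<lambda>(i, j). {f i, f j}) ` set G \<subseteq> E"
    using F by (auto simp: G_def S_def Q_def)
  ultimately have "length G \<le> card E" using card_mono[OF finE] by metis
  then have "length S \<le> k" using card by (simp add: G_def)
  then have "packable_or bad vl acc (filter (\<lambda>v. v \<notin> set acc) vl) G"
    using all_subs_sound chk unfolding check_extensions_def P'_def[symmetric] S_def G_def by blast
  then have res: "bad G \<or> extendible (adj G) vl acc
         (high_degree_first G (filter (\<lambda>v. v \<notin> set acc) vl))"
    by (simp add: packable_or_def split: if_splits)
  have adjG: "adj G i j \<longleftrightarrow> {f i, f j} \<in> E" if ij: "i \<in> set vl" "j \<in> set vl" for i j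
  proof
    assume "adj G i j"
    then have "{f i, f j} \<in> E \<or> {f j, f i} \<in> E"
      using F by (auto simp: adj_iff G_def S_def Q_def)
    then show "{f i, f j} \<in> E" by (simp add: insert_commute)
  next
    assume e: "{f i, f j} \<in> E"
    then have "i \<noteq> j" using fgraph_edge(3)[OF graph] by blast
    then have "(i, j) \<in> set (pairs vl) \<or> (j, i) \<in> set (pairs vl)"
      using pairs_cover ij by metis
    then have "(i, j) \<in> set F \<union> set P \<or> (j, i) \<in> set F \<union> set P"
      using cand e by (metis insert_commute)
    moreover have "{f j, f i} \<in> E" using e by (simp add: insert_commute)
    ultimately show "adj G i j"
      using e by (auto simp: adj_iff G_def S_def Q_def P'_def)
  qed
  show ?thesis
  proof (cases "bad G")
    case True
    then show ?thesis using that(2) adjG GP by blast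
  next
    case False
    define rs where "rs = high_degree_first G (filter (\<lambda>v. v \<notin> set acc) vl)"
    have rs: "mset rs = mset (filter (\<lambda>v. v \<notin> set acc) vl)"
      by (simp only: rs_def mset_high_degree_first)
    have srs: "set rs = set vl - set acc" "distinct rs"
      using mset_eq_setD[OF rs] mset_eq_imp_distinct_iff[OF rs] f(3) by auto
    obtain ws where ws: "mset ws = mset rs" "spread E (map f (ws @ acc))"
      using extendible_sound[of "adj G" vl acc rs f E] res False adjG acc srs
      unfolding rs_def[symmetric] by (metis Diff_subset Un_subset_iff subsetD)
    have "set ws = set rs" "distinct ws"
      using ws(1) srs(2) by (metis mset_eq_setD, metis mset_eq_imp_distinct_iff)
    then have "distinct (ws @ acc)" "set (ws @ acc) = set vl" using srs acc by auto
    then have "distinct (map f (ws @ acc))" "set (map f (ws @ acc)) = V"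
      using f by (metis distinct_map, metis set_map)
    then have "spread_order V E (map f ws @ map f acc)"
      using ws(2) by (simp add: spread_order_def)
    then show ?thesis using that(1) by blast
  qed
qed

text \<open>The list of vertices seen so far only avoids comparing repeated endpoints again.\<close>

primrec some_once :: "'b list \<Rightarrow> 'b list \<Rightarrow> bool" where
  "some_once [] seen = False"
| "some_once (x # xs) seen = (if x \<in> set seen then some_once xs seen
     else if x \<in> set xs then some_once xs (x # seen) else True)"

lemma some_onceD: "some_once xs seen \<Longrightarrow> \<exists>v. v \<notin> set seen \<and> count_list xs v = 1"
proof (induction xs arbitrary: seen)
  case (Cons x xs)
  consider "x \<in> set seen" | "x \<notin> set seen" "x \<in> set xs" | "x \<notin> set seen" "x \<notin> set xs" by blast
  then show ?case
  proof cases
    case 1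
    then have "some_once xs seen" using Cons.prems by simp
    from Cons.IH[OF this] 1 show ?thesis by auto
  next
    case 2
    then have "some_once xs (x # seen)" using Cons.prems by simp
    from Cons.IH[OF this] show ?thesis by auto
  next
    case 3
    then have "count_list (x # xs) x = 1" by (simp add: count_list_0_iff)
    then show ?thesis using 3 by blast
  qed
qed simp

primrec endpoints :: "('b \<times> 'b) list \<Rightarrow> 'b list" where
  "endpoints [] = []"
| "endpoints (p # G) = (case p of (u, v) \<Rightarrow> u # v # endpoints G)"

lemma adj_endpoints: "adj G v u \<Longrightarrow> v \<in> set (endpoints G)"
proof (induction G)
  case (Cons p G)
  then show ?case by (cases p) (simp split: if_splits)
qed simp

text \<open>Each entry of \<open>G\<close> at \<open>v\<close> contributes an occurrence of
  \<open>v\<close>, so a single occurrence leaves a single neighbour.\<close>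

lemma endpoints_once: "count_list (endpoints G) v = 1 \<Longrightarrow> \<exists>u. \<forall>w. adj G v w \<longleftrightarrow> w = u"
proof (induction G)
  case (Cons p G)
  obtain a b where p: "p = (a, b)" by force
  show ?case
  proof (cases "v = a \<or> v = b")
    case True
    then have "v \<notin> set (endpoints G)" "a \<noteq> b" using Cons.prems p
      by (auto simp: count_list_0_iff split: if_splits)
    then have "\<not> adj G v w" for w using adj_endpoints by metis
    then have "adj (p # G) v w \<longleftrightarrow> w = (if v = a then b else a)" for w
      using True \<open>a \<noteq> b\<close> by (auto simp: p)
    then show ?thesis by blast
  next
    case False
    then have "count_list (endpoints G) v = 1" using Cons.prems p by (auto split: if_splits)
    then obtain u where u: "\<And>w. adj G v w \<longleftrightarrow> w = u" using Cons.IH by blast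
    have "p \<noteq> (v, w)" "p \<noteq> (w, v)" for w using False p by blast+
    then have "adj (p # G) v w \<longleftrightarrow> w = u" for w using u[of w] by (simp only: adj.simps if_False)
    then show ?thesis by blast
  qed
qed simp

text \<open>Lets the searches on leafless graphs skip every extension with a vertex of degree
  1.\<close>

definition leafy :: "('b \<times> 'b) list \<Rightarrow> bool" where
  "leafy G = some_once (endpoints G) []"

text \<open>The tests are split into named functions because rewriting under abstractions would
  make their evaluation by the simplifier very slow. The degree bound in \<open>star_obstruction\<close> only
  saves time: with few edges, a vertex outside all independent triples has high degree.\<close>

definition independent3 :: "('b \<times> 'b) list \<Rightarrow> 'b \<Rightarrow> 'b \<Rightarrow> 'b \<Rightarrow> bool" where
  "independent3 G c a b = (if adj G b c then False else if b = c then False else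
     if b = a then False else \<not> adj G a b)"

definition in_independent3 :: "'b list \<Rightarrow> ('b \<times> 'b) list \<Rightarrow> 'b \<Rightarrow> 'b \<Rightarrow> bool" where
  "in_independent3 vl G c a = (if a = c then False else if adj G a c then False else
     any (independent3 G c a) vl)"

definition star_obstruction :: "'b list \<Rightarrow> nat \<Rightarrow> ('b \<times> 'b) list \<Rightarrow> 'b \<Rightarrow> bool" where
  "star_obstruction vl d G c = (if d \<le> degree G c then \<not> any (in_independent3 vl G c) vl else False)"

definition star_obstructed :: "'b list \<Rightarrow> nat \<Rightarrow> ('b \<times> 'b) list \<Rightarrow> bool" where
  "star_obstructed vl d G = any (star_obstruction vl d G) vl"

definition triangle3 :: "('b \<times> 'b) list \<Rightarrow> 'b \<Rightarrow> 'b \<Rightarrow> 'b \<Rightarrow> bool" where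
  "triangle3 G a b c = (if adj G a c then adj G b c else False)"

definition triangle_at :: "'b list \<Rightarrow> ('b \<times> 'b) list \<Rightarrow> 'b \<times> 'b \<Rightarrow> bool" where
  "triangle_at vl G p = (case p of (a, b) \<Rightarrow> any (triangle3 G a b) vl)"

definition has_triangle :: "'b list \<Rightarrow> ('b \<times> 'b) list \<Rightarrow> bool" where
  "has_triangle vl G = any (triangle_at vl G) G"

definition diamond4 :: "('b \<times> 'b) list \<Rightarrow> 'b \<Rightarrow> 'b \<Rightarrow> 'b \<Rightarrow> 'b \<Rightarrow> bool" where
  "diamond4 G a b c d = (if c = d then False else triangle3 G a b d)"

definition diamond3 :: "'b list \<Rightarrow> ('b \<times> 'b) list \<Rightarrow> 'b \<Rightarrow> 'b \<Rightarrow> 'b \<Rightarrow> bool" where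
  "diamond3 vl G a b c = (if triangle3 G a b c then any (diamond4 G a b c) vl else False)"

definition diamond_at :: "'b list \<Rightarrow> ('b \<times> 'b) list \<Rightarrow> 'b \<times> 'b \<Rightarrow> bool" where
  "diamond_at vl G p = (case p of (a, b) \<Rightarrow> any (diamond3 vl G a b) vl)"

definition has_diamond :: "'b list \<Rightarrow> ('b \<times> 'b) list \<Rightarrow> bool" where
  "has_diamond vl G = any (diamond_at vl G) G"

definition clique4 :: "('b \<times> 'b) list \<Rightarrow> 'b \<Rightarrow> 'b \<Rightarrow> 'b \<Rightarrow> 'b \<Rightarrow> bool" where
  "clique4 G a b c d = (if adj G c d then triangle3 G a b d else False)"

definition clique3 :: "'b list \<Rightarrow> ('b \<times> 'b) list \<Rightarrow> 'b \<Rightarrow> 'b \<Rightarrow> 'b \<Rightarrow> bool" where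
  "clique3 vl G a b c = (if triangle3 G a b c then any (clique4 G a b c) vl else False)"

definition clique_at :: "'b list \<Rightarrow> ('b \<times> 'b) list \<Rightarrow> 'b \<times> 'b \<Rightarrow> bool" where
  "clique_at vl G p = (case p of (a, b) \<Rightarrow> any (clique3 vl G a b) vl)"

definition has_K4 :: "'b list \<Rightarrow> ('b \<times> 'b) list \<Rightarrow> bool" where
  "has_K4 vl G = any (clique_at vl G) G"

section \<open>Soundness of the tests on edge lists\<close>

lemma leafy_sound:
  assumes "leafy G" "fgraph V E" "inj_on f (set vl)" "f ` set vl = V" "set G \<subseteq> set (pairs vl)"
    "\<And>i j. i \<in> set vl \<Longrightarrow> j \<in> set vl \<Longrightarrow> adj G i j \<longleftrightarrow> {f i, f j} \<in> E"
  shows "\<exists>v\<in>V. card (nbrs E v) = 1"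
proof -
  obtain v where "count_list (endpoints G) v = 1"
    using some_onceD[OF assms(1)[unfolded leafy_def]] by auto
  then obtain u where vu: "\<And>w. adj G v w \<longleftrightarrow> w = u"
    using endpoints_once[of G v] by auto
  then have "(v, u) \<in> set (pairs vl) \<or> (u, v) \<in> set (pairs vl)"
    using assms(5) adj_iff[of G v u] by auto
  then have mem: "v \<in> set vl" "u \<in> set vl"
    using pairs_mem[of "(v, u)" vl] pairs_mem[of "(u, v)" vl] by auto
  have "nbrs E (f v) = {f u}"
  proof
    show "nbrs E (f v) \<subseteq> {f u}"
    proof
      fix x assume x: "x \<in> nbrs E (f v)"
      then have "x \<in> f ` set vl" using nbrs_subset[OF assms(2), of "f v"] assms(4) by auto
      then obtain w where w: "w \<in> set vl" "x = f w" by (elim imageE)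
      then have "adj G v w" using x mem assms(6)[of v w] by (simp add: nbrs_def)
      then show "x \<in> {f u}" using vu w by simp
    qed
    show "{f u} \<subseteq> nbrs E (f v)" using vu[of u] mem assms(6)[of v u] by (simp add: nbrs_def)
  qed
  then show ?thesis using mem assms(4) by (intro bexI[of _ "f v"]) auto
qed

lemma star_obstructed_sound:
  assumes "star_obstructed vl d G" "inj_on f (set vl)" "f ` set vl = V"
    "\<And>i j. i \<in> set vl \<Longrightarrow> j \<in> set vl \<Longrightarrow> adj G i j \<longleftrightarrow> {f i, f j} \<in> E"
  shows "\<exists>c\<in>V. \<forall>a\<in>V. \<forall>b\<in>V. a \<noteq> c \<longrightarrow> b \<noteq> c \<longrightarrow> a \<noteq> b \<longrightarrow> {a, c} \<in> E \<or> {b, c} \<in> E \<or> {a, b} \<in> E"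
proof -
  obtain c where c: "c \<in> set vl" and
    no: "\<not> (\<exists>a\<in>set vl. a \<noteq> c \<and> \<not> adj G a c \<and>
      (\<exists>b\<in>set vl. \<not> adj G b c \<and> b \<noteq> c \<and> b \<noteq> a \<and> \<not> adj G a b))"
    using assms(1) unfolding star_obstructed_def star_obstruction_def in_independent3_def independent3_def any_iff if_False_conv by (elim bexE conjE)
  show ?thesis
  proof (intro bexI[of _ "f c"] ballI impI)
    fix a b assume ab: "a \<in> V" "b \<in> V" "a \<noteq> f c" "b \<noteq> f c" "a \<noteq> b"
    then obtain i j where ij: "i \<in> set vl" "a = f i" "j \<in> set vl" "b = f j"
      using assms(3) by (metis imageE)
    moreover have "i \<noteq> c" "j \<noteq> c" "j \<noteq> i" using ab ij by auto
    ultimately have "adj G i c \<or> adj G j c \<or> adj G i j" using no by meson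
    then show "{a, f c} \<in> E \<or> {b, f c} \<in> E \<or> {a, b} \<in> E"
      using assms(4)[OF ij(1) c] assms(4)[OF ij(3) c] assms(4)[OF ij(1,3)] ij(2,4) by simp
  qed (use c assms(3) in auto)
qed

lemma adj_edge:
  assumes "set G \<subseteq> set (pairs vl)" "adj G i j"
    "\<And>i j. i \<in> set vl \<Longrightarrow> j \<in> set vl \<Longrightarrow> adj G i j \<longleftrightarrow> {f i, f j} \<in> E"
  shows "i \<in> set vl" "j \<in> set vl" "{f i, f j} \<in> E"
proof -
  have "(i, j) \<in> set (pairs vl) \<or> (j, i) \<in> set (pairs vl)"
    using assms(1,2) adj_iff[of G i j] by auto
  then show mem: "i \<in> set vl" "j \<in> set vl"
    using pairs_mem[of "(i, j)" vl] pairs_mem[of "(j, i)" vl] by auto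
  show "{f i, f j} \<in> E" using assms(3)[OF mem] assms(2) by simp
qed

lemma has_triangle_sound:
  assumes "has_triangle vl G" "set G \<subseteq> set (pairs vl)"
    "\<And>i j. i \<in> set vl \<Longrightarrow> j \<in> set vl \<Longrightarrow> adj G i j \<longleftrightarrow> {f i, f j} \<in> E"
  shows "\<exists>a b c. {a, b} \<in> E \<and> {a, c} \<in> E \<and> {b, c} \<in> E"
proof -
  obtain a b c where "(a, b) \<in> set G" "c \<in> set vl" "adj G a c" "adj G b c"
    using assms(1) unfolding has_triangle_def triangle_at_def triangle3_def any_iff if_False_conv split_beta
    by (metis prod.collapse)
  moreover from this have "adj G a b" by (simp add: adj_iff)
  moreover note adj_edge(3)[OF assms(2) _ assms(3)]
  ultimately show ?thesis by meson
qed

lemma has_diamond_sound: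
  assumes "has_diamond vl G" "set G \<subseteq> set (pairs vl)" "inj_on f (set vl)"
    "\<And>i j. i \<in> set vl \<Longrightarrow> j \<in> set vl \<Longrightarrow> adj G i j \<longleftrightarrow> {f i, f j} \<in> E"
  shows "\<exists>a b c d. c \<noteq> d \<and> {a, b} \<in> E \<and> {a, c} \<in> E \<and> {b, c} \<in> E \<and> {a, d} \<in> E \<and> {b, d} \<in> E"
proof -
  obtain a b c d where *: "(a, b) \<in> set G" "c \<in> set vl" "adj G a c" "adj G b c"
     "d \<in> set vl" "adj G a d" "adj G b d" "c \<noteq> d"
    using assms(1) unfolding has_diamond_def diamond_at_def diamond3_def diamond4_def triangle3_def any_iff if_False_conv split_beta
    by (metis prod.collapse)
  moreover from this have "adj G a b" by (simp add: adj_iff)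
  moreover have "f c \<noteq> f d" using * assms(3) by (metis inj_onD)
  moreover note adj_edge(3)[OF assms(2) _ assms(4)]
  ultimately show ?thesis by meson
qed

lemma has_K4_sound:
  assumes "has_K4 vl G" "set G \<subseteq> set (pairs vl)"
    "\<And>i j. i \<in> set vl \<Longrightarrow> j \<in> set vl \<Longrightarrow> adj G i j \<longleftrightarrow> {f i, f j} \<in> E"
  shows "\<exists>a b c d. {a, b} \<in> E \<and> {a, c} \<in> E \<and> {b, c} \<in> E \<and> {a, d} \<in> E \<and> {b, d} \<in> E \<and> {c, d} \<in> E"
proof -
  obtain a b c d where *: "(a, b) \<in> set G" "c \<in> set vl" "adj G a c" "adj G b c"
     "d \<in> set vl" "adj G a d" "adj G b d" "adj G c d"
    using assms(1) unfolding has_K4_def clique_at_def clique3_def clique4_def triangle3_def any_iff if_False_conv split_beta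
    by (metis prod.collapse)
  moreover from this have "adj G a b" by (simp add: adj_iff)
  moreover note adj_edge(3)[OF assms(2) _ assms(3)]
  ultimately show ?thesis by meson
qed

section \<open>Finite checks on six to nine vertices\<close>

text \<open>Constructors instead of numbers, so that equality of labels is decided without
  arithmetic on numerals.\<close>

datatype label = V0 | V1 | V2 | V3 | V4 | V5 | V6 | V7 | V8

text \<open>The thresholds 3 here and 4 in \<open>excluded7\<close> are \<open>n - 3\<close>: by
  \<open>blocked_vertex\<close>, a vertex outside all independent triples has degree
  \<open>n - 3\<close> or \<open>n - 2\<close>.\<close>

definition "excluded6 G = (if has_triangle [V0, V1, V2, V3, V4, V5] G then True
  else star_obstructed [V0, V1, V2, V3, V4, V5] 3 G)"

definition "excluded7 G = (if has_diamond [V0, V1, V2, V3, V4, V5, V6] G then True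
  else star_obstructed [V0, V1, V2, V3, V4, V5, V6] 4 G)"

text \<open>The leaf test also covers vertices outside all independent triples: among at most
  \<open>n - 2\<close> edges, a vertex of degree at least \<open>n - 3\<close> leaves at most one
  other edge, so some neighbour has degree 1.\<close>

definition "excluded8 G = (if leafy G then True else has_K4 [V0, V1, V2, V3, V4, V5, V6, V7] G)"

definition "excluded9 G = (if leafy G then True else has_K4 [V0, V1, V2, V3, V4, V5, V6, V7, V8] G)"

definition never :: "'b \<Rightarrow> bool" where
  "never G = False"

text \<open>Forced edges break the symmetry: once a known subgraph is labelled, few further edges
  remain to be enumerated. In all checks but \<open>check_two_edges7\<close>, their number is
  bounded by \<open>n - 2\<close> minus the number of forced edges.\<close>

lemma check_cherry6: "check_extensions [V0, V1, V2, V3, V4, V5] [(V0, V1), (V0, V2)]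
    (pairs [V0, V1, V2, V3, V4, V5]) 2 [] excluded6"
  by code_simp

lemma check_matching6: "check_extensions [V0, V1, V2, V3, V4, V5] [(V0, V1)]
    (pairs [V2, V3, V4, V5]) 3 [] excluded6"
  by code_simp

lemma check_star7: "check_extensions [V0, V1, V2, V3, V4, V5, V6] [(V0, V1), (V0, V2), (V0, V3)]
    (pairs [V0, V1, V2, V3, V4, V5, V6]) 2 [] excluded7"
  by code_simp

lemma check_triangle7: "check_extensions [V0, V1, V2, V3, V4, V5, V6] [(V0, V1), (V0, V2), (V1, V2)]
    (pairs [V0, V1, V2, V3, V4, V5, V6]) 2 [] excluded7"
  by code_simp

lemma check_path7: "check_extensions [V0, V1, V2, V3, V4, V5, V6] [(V0, V1), (V1, V2), (V2, V3)]
    (pairs [V0, V1, V2, V3, V4, V5, V6]) 2 [] excluded7"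
  by code_simp

text \<open>The prescribed end \<open>V1, V0\<close> later receives a vertex of large degree that is
  adjacent to neither; at most two edges avoid such a vertex.\<close>

lemma check_two_edges7: "check_extensions [V0, V1, V2, V3, V4, V5, V6] []
    (filter (\<lambda>p. p \<noteq> (V0, V1)) (pairs [V0, V1, V2, V3, V4, V5, V6])) 2 [V1, V0] never"
  by code_simp

lemma check_diamond8: "check_extensions [V0, V1, V2, V3, V4, V5, V6, V7]
    [(V0, V1), (V0, V2), (V1, V2), (V0, V3), (V1, V3)]
    (pairs [V0, V1, V2, V3, V4, V5, V6, V7]) 1 [] (has_K4 [V0, V1, V2, V3, V4, V5, V6, V7])"
  by code_simp

text \<open>\<open>V6\<close> and \<open>V7\<close> stand for two isolated vertices, so only pairs
  of the first six labels can be edges.\<close>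

lemma check_leafless8: "check_extensions [V0, V1, V2, V3, V4, V5, V6, V7] [(V0, V1), (V0, V2)]
    (pairs [V0, V1, V2, V3, V4, V5]) 4 [] excluded8"
  by code_simp

lemma check_leafless9: "check_extensions [V0, V1, V2, V3, V4, V5, V6, V7, V8]
    [(V0, V1), (V0, V2), (V0, V3)] (pairs [V0, V1, V2, V3, V4, V5, V6]) 4 [] excluded9"
  by code_simp

subsection \<open>Small graphs\<close>

definition unblocked :: "'a set \<Rightarrow> 'a set set \<Rightarrow> bool" where
  "unblocked V E \<longleftrightarrow> (\<forall>c\<in>V. \<exists>a\<in>V. \<exists>b\<in>V. a \<noteq> c \<and> b \<noteq> c \<and> a \<noteq> b \<and>
     {a, c} \<notin> E \<and> {b, c} \<notin> E \<and> {a, b} \<notin> E)"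

definition triangle_in :: "'a set set \<Rightarrow> bool" where
  "triangle_in E \<longleftrightarrow> (\<exists>a b c. {a, b} \<in> E \<and> {a, c} \<in> E \<and> {b, c} \<in> E)"

text \<open>Only \<open>c\<close> and \<open>d\<close> need an explicit inequality; all other pairs
  are edges, whose ends differ in an \<open>fgraph\<close>. The pair \<open>c, d\<close> may be an
  edge too, since subgraphs need not be induced.\<close>

definition diamond_in :: "'a set set \<Rightarrow> bool" where
  "diamond_in E \<longleftrightarrow> (\<exists>a b c d. c \<noteq> d \<and> {a, b} \<in> E \<and> {a, c} \<in> E \<and> {b, c} \<in> E \<and> {a, d} \<in> E \<and> {b, d} \<in> E)"

definition K4_in :: "'a set set \<Rightarrow> bool" where
  "K4_in E \<longleftrightarrow> (\<exists>a b c d. {a, b} \<in> E \<and> {a, c} \<in> E \<and> {b, c} \<in> E \<and> {a, d} \<in> E \<and> {b, d} \<in> E \<and> {c, d} \<in> E)"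

section \<open>Labelling a graph for the search\<close>

lemma relabelling:
  assumes "distinct vl" "distinct ws" "length vl = length ws"
  obtains f where "map f vl = ws" "inj_on f (set vl)" "f ` set vl = set ws"
proof -
  define f where "f = (\<lambda>v. the (map_of (zip vl ws) v))"
  have "map f vl = ws"
    using assms by (auto simp: f_def map_of_zip_nth intro!: nth_equalityI)
  moreover from this have "inj_on f (set vl)" using assms(2) by (metis distinct_map)
  ultimately show ?thesis using that by (metis list.set_map)
qed

lemma enumerate_from:
  assumes "finite V" "distinct xs" "set xs \<subseteq> V" "card V = n"
  obtains ys where "distinct (xs @ ys)" "set (xs @ ys) = V" "length (xs @ ys) = n"
proof -
  obtain ys where ys: "set ys = V - set xs" "distinct ys"
    using finite_distinct_list assms(1) by (metis finite_Diff)
  then have "distinct (xs @ ys)" "set (xs @ ys) = V" using assms by auto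
  then show ?thesis using that assms(4) by (metis distinct_card)
qed

lemma label_from:
  assumes "fgraph V E" "distinct vl" "distinct xs" "set xs \<subseteq> V" "card V = length vl"
  obtains f ys where "map f vl = xs @ ys" "inj_on f (set vl)" "f ` set vl = V"
proof -
  have "finite V" using assms(1) by (simp add: fgraph_def)
  then obtain ys where ys: "distinct (xs @ ys)" "set (xs @ ys) = V" "length (xs @ ys) = length vl"
    using enumerate_from assms by metis
  then obtain f where "map f vl = xs @ ys" "inj_on f (set vl)" "f ` set vl = set (xs @ ys)"
    using relabelling[OF assms(2) ys(1)] by auto
  then show ?thesis using that ys by metis
qed

lemma pairs_append_cases:
  "(i, j) \<in> set (pairs (xs @ ys)) \<Longrightarrow> (i, j) \<in> set (pairs xs) \<or> j \<in> set ys"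
proof (induction xs)
  case Nil
  then show ?case using pairs_mem by fastforce
qed auto

lemma pairs_Cons2_cases:
  "(i, j) \<in> set (pairs (x # y # zs)) \<Longrightarrow> i = x \<or> i = y \<and> j \<in> set zs \<or> (i, j) \<in> set (pairs zs)"
  by auto

lemma not_obstructed:
  assumes "star_obstructed vl d G" "f ` set vl = V" "inj_on f (set vl)"
    "\<And>i j. i \<in> set vl \<Longrightarrow> j \<in> set vl \<Longrightarrow> adj G i j \<longleftrightarrow> {f i, f j} \<in> E"
  shows "\<not> unblocked V E"
proof
  assume "unblocked V E"
  moreover obtain c where "c \<in> V"
    "\<forall>a\<in>V. \<forall>b\<in>V. a \<noteq> c \<longrightarrow> b \<noteq> c \<longrightarrow> a \<noteq> b \<longrightarrow> {a, c} \<in> E \<or> {b, c} \<in> E \<or> {a, b} \<in> E"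
    using star_obstructed_sound[OF assms(1,3,2,4)] by auto
  ultimately show False unfolding unblocked_def by metis
qed

section \<open>Orders from the finite checks\<close>

lemma cherry6:
  assumes g: "fgraph V E" and "card V = 6" "card E \<le> 4" and "unblocked V E" "\<not> triangle_in E"
    and e: "{a, b} \<in> E" "{a, c} \<in> E" "b \<noteq> c"
  shows "\<exists>ws. spread_order V E ws"
proof -
  let ?vl = "[V0, V1, V2, V3, V4, V5]"
  obtain f ys where f: "map f ?vl = [a, b, c] @ ys" "inj_on f (set ?vl)" "f ` set ?vl = V"
    by (rule label_from[OF g, of ?vl "[a, b, c]"]) (use assms fgraph_edge[OF g] in auto)
  show ?thesis
  proof (rule check_extensions_sound[OF check_cherry6 g f(2,3)])
    fix G assume G: "excluded6 G"
      "\<And>i j. i \<in> set ?vl \<Longrightarrow> j \<in> set ?vl \<Longrightarrow> adj G i j \<longleftrightarrow> {f i, f j} \<in> E"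
      "set G \<subseteq> set (pairs ?vl)"
    have "\<not> has_triangle ?vl G"
      using has_triangle_sound[OF _ G(3,2)] assms(5) unfolding triangle_in_def by blast
    then have "star_obstructed ?vl 3 G" using G(1) by (simp add: excluded6_def)
    then show ?thesis using not_obstructed[OF _ f(3,2) G(2)] assms(4) by blast
  qed (use f e assms(3) in auto)
qed

lemma matching6:
  assumes g: "fgraph V E" and "card V = 6" "card E \<le> 4" and "unblocked V E" "\<not> triangle_in E"
    and e: "{a, b} \<in> E" and m: "\<And>a b c. {a, b} \<in> E \<Longrightarrow> {a, c} \<in> E \<Longrightarrow> b = c"
  shows "\<exists>ws. spread_order V E ws"
proof -
  let ?vl = "[V0, V1, V2, V3, V4, V5]"
  obtain f ys where f: "map f ?vl = [a, b] @ ys" "inj_on f (set ?vl)" "f ` set ?vl = V"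
    by (rule label_from[OF g, of ?vl "[a, b]"]) (use assms fgraph_edge[OF g] in auto)
  have m': "{a, f i} \<in> E \<longleftrightarrow> f i = b" "{b, f i} \<in> E \<longleftrightarrow> f i = a" for i
    using m e by (metis insert_commute)+
  have ff: "f V0 = a" "f V1 = b" using f(1) by auto
  show ?thesis
  proof (rule check_extensions_sound[OF check_matching6 g f(2,3)])
    fix G assume G: "excluded6 G"
      "\<And>i j. i \<in> set ?vl \<Longrightarrow> j \<in> set ?vl \<Longrightarrow> adj G i j \<longleftrightarrow> {f i, f j} \<in> E"
      "set G \<subseteq> set (pairs ?vl)"
    have "\<not> has_triangle ?vl G"
      using has_triangle_sound[OF _ G(3,2)] assms(5) unfolding triangle_in_def by blast
    then have "star_obstructed ?vl 3 G" using G(1) by (simp add: excluded6_def)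
    then show ?thesis using not_obstructed[OF _ f(3,2) G(2)] assms(4) by blast
  next
    \<comment> \<open>In a matching, \<open>ab\<close> is the only edge at \<open>a\<close> or
      \<open>b\<close>; all other edges lie among the last four labels.\<close>
    fix i j assume ij: "(i, j) \<in> set (pairs ?vl)" "{f i, f j} \<in> E"
    have mem: "j \<in> set ?vl" using pairs_mem[OF ij(1)] by simp
    consider "i = V0" | "i = V1" "j \<in> set [V2, V3, V4, V5]" | "(i, j) \<in> set (pairs [V2, V3, V4, V5])"
      using pairs_Cons2_cases[OF ij(1)] by blast
    then show "(i, j) \<in> set [(V0, V1)] \<union> set (pairs [V2, V3, V4, V5])"
    proof cases
      case 1
      then have "f j = f V1" using ij(2) m' ff by simp
      then have "j = V1" using inj_onD[OF f(2)] mem by simp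
      then show ?thesis using 1 by simp
    next
      case 2
      then have "f j = f V0" using ij(2) m' ff by simp
      then have "j = V0" using inj_onD[OF f(2)] mem by simp
      then show ?thesis using 2 by simp
    qed blast
  qed (use f e assms(3) in auto)
qed

lemma star7:
  assumes g: "fgraph V E" and "card V = 7" "card E \<le> 5" and "unblocked V E" "\<not> diamond_in E"
    and e: "{a, b} \<in> E" "{a, c} \<in> E" "{a, d} \<in> E" and dis: "distinct [a, b, c, d]"
  shows "\<exists>ws. spread_order V E ws"
proof -
  let ?vl = "[V0, V1, V2, V3, V4, V5, V6]"
  obtain f ys where f: "map f ?vl = [a, b, c, d] @ ys" "inj_on f (set ?vl)" "f ` set ?vl = V"
    by (rule label_from[OF g, of ?vl "[a, b, c, d]"]) (use assms fgraph_edge[OF g] in auto)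
  show ?thesis
  proof (rule check_extensions_sound[OF check_star7 g f(2,3)])
    fix G assume G: "excluded7 G"
      "\<And>i j. i \<in> set ?vl \<Longrightarrow> j \<in> set ?vl \<Longrightarrow> adj G i j \<longleftrightarrow> {f i, f j} \<in> E"
      "set G \<subseteq> set (pairs ?vl)"
    have "\<not> has_diamond ?vl G"
      using has_diamond_sound[OF _ G(3) f(2) G(2)] assms(5) unfolding diamond_in_def by blast
    then have "star_obstructed ?vl 4 G" using G(1) by (simp add: excluded7_def)
    then show ?thesis using not_obstructed[OF _ f(3,2) G(2)] assms(4) by blast
  qed (use f e assms(3) in auto)
qed

lemma triangle7:
  assumes g: "fgraph V E" and "card V = 7" "card E \<le> 5" and "unblocked V E" "\<not> diamond_in E"
    and e: "{a, b} \<in> E" "{a, c} \<in> E" "{b, c} \<in> E" and dis: "distinct [a, b, c]"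
  shows "\<exists>ws. spread_order V E ws"
proof -
  let ?vl = "[V0, V1, V2, V3, V4, V5, V6]"
  obtain f ys where f: "map f ?vl = [a, b, c] @ ys" "inj_on f (set ?vl)" "f ` set ?vl = V"
    by (rule label_from[OF g, of ?vl "[a, b, c]"]) (use assms fgraph_edge[OF g] in auto)
  show ?thesis
  proof (rule check_extensions_sound[OF check_triangle7 g f(2,3)])
    fix G assume G: "excluded7 G"
      "\<And>i j. i \<in> set ?vl \<Longrightarrow> j \<in> set ?vl \<Longrightarrow> adj G i j \<longleftrightarrow> {f i, f j} \<in> E"
      "set G \<subseteq> set (pairs ?vl)"
    have "\<not> has_diamond ?vl G"
      using has_diamond_sound[OF _ G(3) f(2) G(2)] assms(5) unfolding diamond_in_def by blast
    then have "star_obstructed ?vl 4 G" using G(1) by (simp add: excluded7_def)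
    then show ?thesis using not_obstructed[OF _ f(3,2) G(2)] assms(4) by blast
  qed (use f e assms(3) in auto)
qed

lemma path7:
  assumes g: "fgraph V E" and "card V = 7" "card E \<le> 5" and "unblocked V E" "\<not> diamond_in E"
    and e: "{a, b} \<in> E" "{b, c} \<in> E" "{c, d} \<in> E" and dis: "distinct [a, b, c, d]"
  shows "\<exists>ws. spread_order V E ws"
proof -
  let ?vl = "[V0, V1, V2, V3, V4, V5, V6]"
  obtain f ys where f: "map f ?vl = [a, b, c, d] @ ys" "inj_on f (set ?vl)" "f ` set ?vl = V"
    by (rule label_from[OF g, of ?vl "[a, b, c, d]"]) (use assms fgraph_edge[OF g] in auto)
  show ?thesis
  proof (rule check_extensions_sound[OF check_path7 g f(2,3)])
    fix G assume G: "excluded7 G"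
      "\<And>i j. i \<in> set ?vl \<Longrightarrow> j \<in> set ?vl \<Longrightarrow> adj G i j \<longleftrightarrow> {f i, f j} \<in> E"
      "set G \<subseteq> set (pairs ?vl)"
    have "\<not> has_diamond ?vl G"
      using has_diamond_sound[OF _ G(3) f(2) G(2)] assms(5) unfolding diamond_in_def by blast
    then have "star_obstructed ?vl 4 G" using G(1) by (simp add: excluded7_def)
    then show ?thesis using not_obstructed[OF _ f(3,2) G(2)] assms(4) by blast
  qed (use f e assms(3) in auto)
qed

lemma two_edges7:
  assumes g: "fgraph V E" and "card V = 7" "card E \<le> 2"
    and ab: "a \<in> V" "b \<in> V" "a \<noteq> b" "{a, b} \<notin> E"
  shows "\<exists>ws. spread_order V E (ws @ [b, a])"
proof -
  let ?vl = "[V0, V1, V2, V3, V4, V5, V6]"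
  obtain f ys where f: "map f ?vl = [a, b] @ ys" "inj_on f (set ?vl)" "f ` set ?vl = V"
    by (rule label_from[OF g, of ?vl "[a, b]"]) (use assms in auto)
  have ff: "f V0 = a" "f V1 = b" using f(1) by auto
  show ?thesis
  proof (rule check_extensions_sound[OF check_two_edges7 g f(2,3)])
    fix ws assume "spread_order V E (ws @ map f [V1, V0])"
    then show ?thesis using ff by auto
  next
    fix G assume "never G"
    then show ?thesis by (simp add: never_def)
  qed (use ff ab assms(3) in \<open>auto simp: insert_commute\<close>)
qed

lemma diamond8:
  assumes g: "fgraph V E" and "card V = 8" "card E \<le> 6" and "diamond_in E" "\<not> K4_in E"
  shows "\<exists>ws. spread_order V E ws"
proof -
  let ?vl = "[V0, V1, V2, V3, V4, V5, V6, V7]"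
  obtain a b c d where e: "c \<noteq> d" "{a, b} \<in> E" "{a, c} \<in> E" "{b, c} \<in> E" "{a, d} \<in> E" "{b, d} \<in> E"
    using assms(4) unfolding diamond_in_def by blast
  obtain f ys where f: "map f ?vl = [a, b, c, d] @ ys" "inj_on f (set ?vl)" "f ` set ?vl = V"
    by (rule label_from[OF g, of ?vl "[a, b, c, d]"]) (use assms(2) e fgraph_edge[OF g] in auto)
  show ?thesis
  proof (rule check_extensions_sound[OF check_diamond8 g f(2,3)])
    fix G assume G: "has_K4 ?vl G"
      "\<And>i j. i \<in> set ?vl \<Longrightarrow> j \<in> set ?vl \<Longrightarrow> adj G i j \<longleftrightarrow> {f i, f j} \<in> E"
      "set G \<subseteq> set (pairs ?vl)"
    then show ?thesis
      using has_K4_sound[OF _ G(3,2)] assms(5) unfolding K4_in_def by blast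
  qed (use f e assms(3) in auto)
qed

lemma leafless8:
  assumes g: "fgraph V E" and "card V = 8" "card E \<le> 6"
    and "\<forall>v\<in>V. card (nbrs E v) \<noteq> 1" "\<not> K4_in E"
    and e: "{a, b} \<in> E" "{a, c} \<in> E" "b \<noteq> c"
    and xy: "x \<in> V" "y \<in> V" "x \<noteq> y" "nbrs E x = {}" "nbrs E y = {}"
  shows "\<exists>ws. spread_order V E ws"
proof -
  \<comment> \<open>\<open>label_from\<close> labels the given vertices first. The rotated list
    \<open>?wl\<close> makes the isolated \<open>x\<close>, \<open>y\<close> come first and still
    receive the last two labels.\<close>
  let ?vl = "[V0, V1, V2, V3, V4, V5, V6, V7]" and ?wl = "[V6, V7, V0, V1, V2, V3, V4, V5]"
  have ni: "{x, u} \<notin> E" "{u, x} \<notin> E" "{y, u} \<notin> E" "{u, y} \<notin> E" for u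
    using xy by (auto simp: nbrs_def insert_commute)
  obtain f ys where f: "map f ?wl = [x, y, a, b, c] @ ys" "inj_on f (set ?wl)" "f ` set ?wl = V"
    by (rule label_from[OF g, of ?wl "[x, y, a, b, c]"])
      (use assms(2) xy e ni fgraph_edge[OF g] in auto)
  have ff: "f V6 = x" "f V7 = y" "f V0 = a" "f V1 = b" "f V2 = c" using f(1) by auto
  have sets: "set ?wl = set ?vl" by auto
  note f = f(2,3)[unfolded sets]
  show ?thesis
  proof (rule check_extensions_sound[OF check_leafless8 g f])
    fix G assume G: "excluded8 G"
      "\<And>i j. i \<in> set ?vl \<Longrightarrow> j \<in> set ?vl \<Longrightarrow> adj G i j \<longleftrightarrow> {f i, f j} \<in> E"
      "set G \<subseteq> set (pairs ?vl)"
    have "\<not> has_K4 ?vl G"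
      using has_K4_sound[OF _ G(3,2)] assms(5) unfolding K4_in_def by blast
    moreover have "\<not> leafy G"
      using leafy_sound[OF _ g f G(3,2)] assms(4) by blast
    ultimately show ?thesis using G(1) by (simp add: excluded8_def)
  next
    fix i j assume ij: "(i, j) \<in> set (pairs ?vl)" "{f i, f j} \<in> E"
    have "j \<notin> set [V6, V7]" using ij(2) ff ni by auto
    then have "(i, j) \<in> set (pairs [V0, V1, V2, V3, V4, V5])"
      using ij(1) pairs_append_cases[of i j "[V0, V1, V2, V3, V4, V5]" "[V6, V7]", unfolded append.simps]
      by blast
    then show "(i, j) \<in> set [(V0, V1), (V0, V2)] \<union> set (pairs [V0, V1, V2, V3, V4, V5])" by blast
  qed (use ff e assms(3) in auto)
qed

lemma leafless9:
  assumes g: "fgraph V E" and "card V = 9" "card E \<le> 7"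
    and "\<forall>v\<in>V. card (nbrs E v) \<noteq> 1" "\<not> K4_in E"
    and e: "{a, b} \<in> E" "{a, c} \<in> E" "{a, d} \<in> E" "distinct [b, c, d]"
    and xy: "x \<in> V" "y \<in> V" "x \<noteq> y" "nbrs E x = {}" "nbrs E y = {}"
  shows "\<exists>ws. spread_order V E ws"
proof -
  let ?vl = "[V0, V1, V2, V3, V4, V5, V6, V7, V8]" and ?wl = "[V7, V8, V0, V1, V2, V3, V4, V5, V6]"
  have ni: "{x, u} \<notin> E" "{u, x} \<notin> E" "{y, u} \<notin> E" "{u, y} \<notin> E" for u
    using xy by (auto simp: nbrs_def insert_commute)
  obtain f ys where f: "map f ?wl = [x, y, a, b, c, d] @ ys" "inj_on f (set ?wl)" "f ` set ?wl = V"
    by (rule label_from[OF g, of ?wl "[x, y, a, b, c, d]"])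
      (use assms(2) xy e ni fgraph_edge[OF g] in auto)
  have ff: "f V7 = x" "f V8 = y" "f V0 = a" "f V1 = b" "f V2 = c" "f V3 = d" using f(1) by auto
  have sets: "set ?wl = set ?vl" by auto
  note f = f(2,3)[unfolded sets]
  show ?thesis
  proof (rule check_extensions_sound[OF check_leafless9 g f])
    fix G assume G: "excluded9 G"
      "\<And>i j. i \<in> set ?vl \<Longrightarrow> j \<in> set ?vl \<Longrightarrow> adj G i j \<longleftrightarrow> {f i, f j} \<in> E"
      "set G \<subseteq> set (pairs ?vl)"
    have "\<not> has_K4 ?vl G"
      using has_K4_sound[OF _ G(3,2)] assms(5) unfolding K4_in_def by blast
    moreover have "\<not> leafy G"
      using leafy_sound[OF _ g f G(3,2)] assms(4) by blast
    ultimately show ?thesis using G(1) by (simp add: excluded9_def)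
  next
    fix i j assume ij: "(i, j) \<in> set (pairs ?vl)" "{f i, f j} \<in> E"
    have "j \<notin> set [V7, V8]" using ij(2) ff ni by auto
    then have "(i, j) \<in> set (pairs [V0, V1, V2, V3, V4, V5, V6])"
      using ij(1) pairs_append_cases[of i j "[V0, V1, V2, V3, V4, V5, V6]" "[V7, V8]", unfolded append.simps]
      by blast
    then show "(i, j) \<in> set [(V0, V1), (V0, V2), (V0, V3)] \<union> set (pairs [V0, V1, V2, V3, V4, V5, V6])" by blast
  qed (use ff e assms(3) in auto)
qed

subsection \<open>Extending spread orders\<close>

definition clique_in :: "nat \<Rightarrow> 'a set set \<Rightarrow> bool" where
  "clique_in r E \<longleftrightarrow> (\<exists>K. finite K \<and> card K = r \<and> (\<forall>u\<in>K. \<forall>v\<in>K. u \<noteq> v \<longrightarrow> {u, v} \<in> E))"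

text \<open>The form of the hypothesis that the induction carries: \<open>unblocked\<close> stands
  for the absence of both stars, and everything is expressed by vertices and edges, without
  embeddings.\<close>

definition admissible :: "'a set \<Rightarrow> 'a set set \<Rightarrow> bool" where
  "admissible V E \<longleftrightarrow> card E + 2 \<le> card V \<and> unblocked V E \<and>
     (card V = 6 \<longrightarrow> \<not> triangle_in E) \<and> (card V = 7 \<longrightarrow> \<not> diamond_in E) \<and>
     (card V \<in> {8, 9} \<longrightarrow> \<not> K4_in E) \<and> (card V = 12 \<longrightarrow> \<not> clique_in 5 E)"

section \<open>Vertices in no independent triple\<close>

lemma pairs_in_clique:
  assumes "\<forall>u\<in>K. \<forall>v\<in>K. u \<noteq> v \<longrightarrow> {u, v} \<in> E"
  shows "{e. e \<subseteq> K \<and> card e = 2} \<subseteq> E"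
  using assms by (auto simp: card_2_iff)

text \<open>The set \<open>N\<close> of non-neighbours of \<open>c\<close> is a clique whose edges
  avoid \<open>c\<close>. Comparing \<open>card E\<close> with
  \<open>card V = card N + card (nbrs E c) + 1\<close> gives
  \<open>(card N choose 2) + 1 \<le> card N\<close>, so \<open>N\<close> has one or two elements,
  and both cases make the edge bound tight.\<close>

lemma blocked_vertex:
  assumes g: "fgraph V E" and e: "card E + 2 \<le> card V" and c: "c \<in> V"
    and no: "\<And>a b. a \<in> V \<Longrightarrow> b \<in> V \<Longrightarrow> a \<noteq> c \<Longrightarrow> b \<noteq> c \<Longrightarrow> a \<noteq> b \<Longrightarrow>
      {a, c} \<in> E \<or> {b, c} \<in> E \<or> {a, b} \<in> E"
  shows "card E + 2 = card V"
    and "card (nbrs E c) + 2 = card V \<or>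
      card (nbrs E c) + 3 = card V \<and> (\<exists>a b. a \<noteq> b \<and> V - {c} - nbrs E c = {a, b} \<and> {a, b} \<in> E)"
proof -
  define N where "N = V - {c} - nbrs E c"
  have fin: "finite V" "finite N" "finite E" using g finite_edges[OF g] by (auto simp: fgraph_def N_def)
  have cl: "\<forall>u\<in>N. \<forall>v\<in>N. u \<noteq> v \<longrightarrow> {u, v} \<in> E"
    using no by (auto simp: N_def nbrs_def insert_commute)
  have cardN: "card N + card (nbrs E c) + 1 = card V"
  proof -
    have "card N = card (V - {c}) - card (nbrs E c)"
      unfolding N_def using nbrs_subset[OF g] finite_nbrs[OF g] by (simp add: card_Diff_subset)
    moreover have "card (nbrs E c) \<le> card (V - {c})"
      using nbrs_subset[OF g] fin by (intro card_mono) auto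
    moreover have "card (V - {c}) + 1 = card V" using c fin by (metis Suc_eq_plus1 card_Suc_Diff1)
    ultimately show ?thesis by linarith
  qed
  have "{e. e \<subseteq> N \<and> card e = 2} \<subseteq> del_vertex c E"
    using pairs_in_clique[OF cl] by (auto simp: del_vertex_def N_def)
  then have "card N choose 2 \<le> card (del_vertex c E)"
    using card_mono[of "del_vertex c E" "{e. e \<subseteq> N \<and> card e = 2}"] fin n_subsets[of N 2]
    by (simp add: del_vertex_def)
  then have le: "(card N choose 2) + card (nbrs E c) \<le> card E" using card_del_vertex[OF g, of c] by simp
  then have le': "(card N choose 2) + 1 \<le> card N" using e cardN by linarith
  have "card N \<le> 2"
  proof (rule ccontr)
    assume "\<not> card N \<le> 2"
    then obtain k where k: "card N = k + 3" using le_Suc_ex[of 3 "card N"] by auto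
    have "(k + 3) * (k + 2) = 2 * (k + 3) + k * (k + 3)" by (simp add: algebra_simps)
    then have "k + 3 \<le> (k + 3) choose 2" unfolding choose_two by simp
    then show False using le' k by simp
  qed
  moreover have "card N \<noteq> 0" using le' by auto
  ultimately have r: "card N = 1 \<or> card N = 2" by linarith
  then have r2: "card N = 2 \<Longrightarrow> card N choose 2 = 1" by simp
  show "card E + 2 = card V" using r r2 le e cardN by (elim disjE) auto
  show "card (nbrs E c) + 2 = card V \<or>
      card (nbrs E c) + 3 = card V \<and> (\<exists>a b. a \<noteq> b \<and> V - {c} - nbrs E c = {a, b} \<and> {a, b} \<in> E)"
  proof (cases "card N = 1")
    case False
    then have "card N = 2" using r by simp
    then obtain a b where "N = {a, b}" "a \<noteq> b" by (auto simp: card_2_iff)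
    moreover from this have "{a, b} \<in> E" using cl by simp
    ultimately show ?thesis using cardN \<open>card N = 2\<close> unfolding N_def by auto
  qed (use cardN in simp)
qed

text \<open>Contrapositive of \<open>blocked_vertex\<close>. Since blocking forces equality in the
  edge bound, degrees are to be estimated only for tight graphs.\<close>

lemma unblocked_if:
  assumes g: "fgraph V E" and e: "card E + 2 \<le> card V"
    and deg: "\<And>c. c \<in> V \<Longrightarrow> card E + 2 = card V \<Longrightarrow> card (nbrs E c) + 3 < card V"
  shows "unblocked V E"
proof (rule ccontr)
  assume "\<not> unblocked V E"
  then obtain c where c: "c \<in> V" "\<And>a b. a \<in> V \<Longrightarrow> b \<in> V \<Longrightarrow> a \<noteq> c \<Longrightarrow> b \<noteq> c \<Longrightarrow> a \<noteq> b \<Longrightarrow>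
      {a, c} \<in> E \<or> {b, c} \<in> E \<or> {a, b} \<in> E"
    unfolding unblocked_def by auto
  from blocked_vertex[OF g e c] deg[OF c(1)] show False by linarith
qed

section \<open>Insertion of vertices into an order\<close>

lemma order_front:
  assumes "spread_order (V - {x}) (del_vertex x E) ws" "x \<in> V" "nbrs E x \<inter> set (take 2 ws) = {}"
  shows "spread_order V E (x # ws)"
  using assms spread_del_vertex[of x ws E]
  by (auto simp: spread_order_def nbrs_def)

text \<open>At least four other vertices are ordered, so \<open>z\<close> cannot be among the first
  two and among the last two at once; \<open>x\<close> goes to an end where \<open>z\<close> is far
  away.\<close>

lemma order_leaf:
  assumes "spread_order (V - {x}) (del_vertex x E) ws" "x \<in> V" "nbrs E x = {z}" "5 \<le> card V"
  shows "\<exists>ws. spread_order V E ws"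
proof (cases "z \<in> set (take 2 ws)")
  case False
  then show ?thesis using order_front[OF assms(1,2)] assms(3) by auto
next
  case True
  have d: "distinct ws" "set ws = V - {x}" using assms(1) by (auto simp: spread_order_def)
  then have "length ws = card V - 1" using assms(2) by (metis card_Diff_singleton distinct_card)
  then have l: "4 \<le> length ws" using assms(4) by simp
  have "z \<notin> set (take 2 (rev ws))"
  proof
    assume "z \<in> set (take 2 (rev ws))"
    then have "z \<in> set (drop (length ws - 2) ws)" by (simp add: take_rev)
    then have "z \<in> set (drop 2 ws)"
      using l set_drop_subset_set_drop[of 2 "length ws - 2" ws] by fastforce
    then show False using True d(1) by (metis disjoint_iff set_take_disj_set_drop_if_distinct order_refl)
  qed
  then have "spread_order V E (x # rev ws)"
    using order_front[of V x E "rev ws"] assms by (simp add: spread_order_rev)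
  then show ?thesis by blast
qed

lemma order_isolated:
  assumes g: "fgraph V E" and "spread_order (V - {x}) E ws" "x \<in> V" "nbrs E x = {}"
  shows "spread_order V E (x # ws)"
  using order_front[of V x E ws] assms del_vertex_isolated[OF g] by simp

text \<open>The isolated \<open>x\<close> and \<open>x'\<close> occupy both places next to
  \<open>y\<close>, so \<open>y\<close> may be adjacent to anything that follows.\<close>

lemma order_front_isolated2:
  assumes g: "fgraph V E" and ws: "spread_order (V - {y, x, x'}) (del_vertex y E) ws"
    and xs: "y \<in> V" "x \<in> V" "x' \<in> V" "y \<noteq> x" "y \<noteq> x'" "x \<noteq> x'"
    and iso: "nbrs E x = {}" "nbrs E x' = {}"
  shows "spread_order V E (y # x # x' # ws)"
proof -
  have iso': "nbrs (del_vertex y E) x = {}" "nbrs (del_vertex y E) x' = {}"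
    using iso by (auto simp: nbrs_del_vertex)
  have gy: "fgraph (V - {y}) (del_vertex y E)" using g by (rule fgraph_del_vertex)
  then have gx: "fgraph (V - {y} - {x}) (del_vertex y E)"
    using fgraph_del_vertex[OF gy, of x] del_vertex_isolated[OF gy iso'(1)] by simp
  have "V - {y, x, x'} = V - {y} - {x} - {x'}" by auto
  then have "spread_order (V - {y} - {x}) (del_vertex y E) (x' # ws)"
    using order_isolated[OF gx _ _ iso'(2)] ws xs by simp
  then have "spread_order (V - {y}) (del_vertex y E) (x # x' # ws)"
    using order_isolated[OF gy _ _ iso'(1)] xs by simp
  moreover have "nbrs E y \<inter> {x, x'} = {}" using iso nbrs_sym by fastforce
  ultimately show ?thesis using xs by (intro order_front[of V y E "x # x' # ws"]) auto
qed

text \<open>If one end of the order is not adjacent to \<open>y\<close>, then \<open>y, x\<close>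
  goes in front of that end. Otherwise the two ends are the only neighbours of \<open>y\<close>, and
  \<open>y, x\<close> fits in the interior.\<close>

lemma order_degree2:
  assumes g: "fgraph V E" and ws: "spread_order (V - {y, x}) (del_vertex y E) ws"
    and xs: "y \<in> V" "x \<in> V" "y \<noteq> x" "nbrs E x = {}" and deg: "card (nbrs E y) \<le> 2"
    and card: "7 \<le> card V"
  shows "\<exists>ws. spread_order V E ws"
proof -
  have iso': "nbrs (del_vertex y E) x = {}" using xs(4) by (auto simp: nbrs_del_vertex)
  have gy: "fgraph (V - {y}) (del_vertex y E)" using g by (rule fgraph_del_vertex)
  have fin: "finite (nbrs E y)" using finite_nbrs[OF g] .
  have yx: "{y, x} \<notin> E" "{x, u} \<notin> E" "{u, x} \<notin> E" for u
    using xs(4) by (auto simp: nbrs_def insert_commute)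
  have VV: "V - {y, x} = V - {y} - {x}" by auto
  have front: "\<exists>ws. spread_order V E ws"
    if us: "spread_order (V - {y, x}) (del_vertex y E) us" and h: "set (take 1 us) \<inter> nbrs E y = {}" for us
  proof -
    have "spread_order (V - {y}) (del_vertex y E) (x # us)"
      using order_isolated[OF gy _ _ iso'] us xs by (simp add: VV)
    moreover have "nbrs E y \<inter> set (take 2 (x # us)) = {}"
      using h yx by (auto simp: nbrs_def)
    ultimately show ?thesis using order_front[of V y E "x # us"] xs(1) by (intro exI)
  qed
  have d: "distinct ws" "set ws = V - {y, x}" using ws by (auto simp: spread_order_def)
  have "length ws = card V - 2"
    using distinct_card[OF d(1)] d(2) xs by (simp add: card_Diff_subset)
  then have l: "5 \<le> length ws" using card by simp
  \<comment> \<open>Nonempty \<open>rest\<close> ensures that the last vertex of the order is none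
    of \<open>a\<close>, \<open>b\<close>, \<open>c\<close>, \<open>d'\<close>.\<close>
  then obtain a b c d' rest where w: "ws = a # b # c # d' # rest" "rest \<noteq> []"
    by (auto simp: Suc_le_length_iff numeral_eq_Suc)
  show ?thesis
  proof (cases "a \<in> nbrs E y \<and> last ws \<in> nbrs E y")
    case False
    then consider "a \<notin> nbrs E y" | "last ws \<notin> nbrs E y" by blast
    then show ?thesis
    proof cases
      case 1
      then show ?thesis using front[OF ws] w by simp
    next
      case 2
      have "take 1 (rev ws) = [last ws]" using w(1) by (simp add: take_Suc hd_rev del: rev.simps)
      then show ?thesis using front[of "rev ws"] ws 2 by (simp add: spread_order_rev)
    qed
  next
    case True
    have la: "last ws = last rest" "last rest \<in> set rest" using w by auto
    have "a \<noteq> last rest" using la d(1) w by auto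
    then have "nbrs E y = {a, last rest}"
      using True la deg fin by (intro card_seteq[symmetric]) auto
    then have ny: "b \<notin> nbrs E y" "c \<notin> nbrs E y" "d' \<notin> nbrs E y"
      using d(1) w la(2) by auto
    have yw: "y \<notin> set ws" "x \<notin> set ws" using d(2) by auto
    have "spread E ws" using ws spread_del_vertex[OF yw(1)] by (simp add: spread_order_def)
    moreover have "{b, y} \<notin> E" "{c, y} \<notin> E" "{y, d'} \<notin> E"
      using ny by (auto simp: nbrs_def insert_commute)
    \<comment> \<open>The insertion only moves the old vertices further apart, and within distance
      two of \<open>y\<close> there are just \<open>b\<close>, \<open>c\<close>, \<open>x\<close>
      and \<open>d'\<close>.\<close>
    ultimately have "spread E (a # b # c # y # x # d' # rest)"
      using yx unfolding w(1) by simp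
    moreover have "distinct (a # b # c # y # x # d' # rest)" "set (a # b # c # y # x # d' # rest) = V"
      using d w yw xs by auto
    ultimately show ?thesis unfolding spread_order_def by blast
  qed
qed

section \<open>Vertices of very large degree and isolated vertices\<close>

lemma card_Union_edges:
  assumes "fgraph V E"
  shows "card (\<Union>E) \<le> 2 * card E"
proof -
  have "card (\<Union>E) \<le> (\<Sum>e\<in>E. card e)" by (rule card_Union_le_sum_card)
  also have "\<dots> = (\<Sum>e\<in>E. 2)" using assms by (intro sum.cong) (auto simp: fgraph_def)
  finally show ?thesis by simp
qed

lemma isolated_iff: "fgraph V E \<Longrightarrow> nbrs E v = {} \<longleftrightarrow> v \<notin> \<Union>E"
  using del_vertex_isolated[of V E v] by (auto simp: nbrs_def del_vertex_def)

text \<open>Two edges together with \<open>a\<close> and \<open>b\<close> meet at most six vertices.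
  Above seven vertices an isolated one is left over and can be put in front, which keeps the end
  \<open>b, a\<close>.\<close>

lemma two_edges_order:
  assumes "fgraph V E" "7 \<le> card V" "card E \<le> 2" "a \<in> V" "b \<in> V" "a \<noteq> b" "{a, b} \<notin> E"
  shows "\<exists>ws. spread_order V E (ws @ [b, a])"
  using assms
proof (induction "card V - 7" arbitrary: V)
  case 0
  then have "card V = 7" by simp
  then show ?case using two_edges7[OF 0(2)] 0 by blast
next
  case (Suc n)
  have g: "fgraph V E" and fin: "finite V"
    using Suc.prems by (auto simp: fgraph_def)
  then have fin2: "finite (\<Union>E \<union> {a, b})"
    using finite_subset[of "\<Union>E" V] by (auto simp: fgraph_def)
  have "card (\<Union>E \<union> {a, b}) \<le> card (\<Union>E) + card {a, b}" by (rule card_Un_le)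
  also have "\<dots> \<le> 6" using card_Union_edges[OF g] Suc.prems by (simp add: card_insert_if)
  finally have "card (\<Union>E \<union> {a, b}) < card V" using Suc.hyps(2) by simp
  then have "\<not> V \<subseteq> \<Union>E \<union> {a, b}" using card_mono[OF fin2, of V] by linarith
  then obtain v where v: "v \<in> V" "v \<notin> \<Union>E" "v \<noteq> a" "v \<noteq> b" by auto
  have iso: "nbrs E v = {}" using isolated_iff[OF g] v by blast
  have g': "fgraph (V - {v}) E"
    using fgraph_del_vertex[OF g, of v] del_vertex_isolated[OF g iso] by simp
  have "card (V - {v}) = card V - 1" using v fin by simp
  moreover have "7 \<le> card V - 1" "n = card V - 1 - 7" using Suc.hyps(2) by linarith+
  ultimately obtain ws where "spread_order (V - {v}) E (ws @ [b, a])"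
    using Suc.hyps(1)[of "V - {v}"] g' Suc.prems v by auto
  then have "spread_order V E ((v # ws) @ [b, a])" using order_isolated[OF g _ v(1) iso] by simp
  then show ?case by blast
qed

text \<open>At most (n - 2) - (n - 4) = 2 edges avoid \<open>c\<close>, and at least seven vertices
  remain without it, as \<open>two_edges_order\<close> demands.\<close>

lemma order_big_degree:
  assumes g: "fgraph V E" and e: "card E + 2 \<le> card V" "8 \<le> card V" and ub: "unblocked V E"
    and c: "c \<in> V" "card V \<le> card (nbrs E c) + 4"
  shows "\<exists>ws. spread_order V E ws"
proof -
  obtain a b where ab: "a \<in> V" "b \<in> V" "a \<noteq> c" "b \<noteq> c" "a \<noteq> b" "{a, c} \<notin> E" "{b, c} \<notin> E" "{a, b} \<notin> E"
    using ub c(1) unfolding unblocked_def by blast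
  have "card (del_vertex c E) \<le> 2" using card_del_vertex[OF g, of c] e c by linarith
  moreover have "card (V - {c}) \<ge> 7" using c e by (simp add: card_Diff_singleton)
  ultimately obtain ws where "spread_order (V - {c}) (del_vertex c E) (ws @ [b, a])"
    using two_edges_order[OF fgraph_del_vertex[OF g], of c a b] ab by (auto simp: doubleton_in_del_vertex)
  then have "spread_order (V - {c}) (del_vertex c E) (rev (ws @ [b, a]))"
    by (simp only: spread_order_rev)
  then have "spread_order V E (c # rev (ws @ [b, a]))"
    by (rule order_front) (use c ab in \<open>auto simp: nbrs_def insert_commute\<close>)
  then show ?thesis by blast
qed

text \<open>Without leaves every non-isolated vertex has degree at least 2, so by the degree sum
  there are at most \<open>card E\<close> of them.\<close>

lemma two_isolated:
  assumes g: "fgraph V E" and e: "card E + 2 \<le> card V" and nl: "\<forall>v\<in>V. card (nbrs E v) \<noteq> 1"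
  obtains x x' where "x \<in> V" "x' \<in> V" "x \<noteq> x'" "nbrs E x = {}" "nbrs E x' = {}"
proof -
  define I where "I = {v \<in> V. nbrs E v = {}}"
  have fin: "finite V" "finite I" using g by (auto simp: fgraph_def I_def)
  have "2 * card (V - I) = (\<Sum>v\<in>V - I. 2)" by simp
  also have "\<dots> \<le> (\<Sum>v\<in>V - I. card (nbrs E v))"
  proof (rule sum_mono)
    fix v assume "v \<in> V - I"
    then have "card (nbrs E v) \<noteq> 0" "card (nbrs E v) \<noteq> 1"
      using finite_nbrs[OF g] nl by (auto simp: I_def)
    then show "2 \<le> card (nbrs E v)" by linarith
  qed
  also have "\<dots> \<le> (\<Sum>v\<in>V. card (nbrs E v))" using fin by (intro sum_mono2) auto
  also have "\<dots> = 2 * card E" by (rule sum_degrees[OF g])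
  finally have "card (V - I) \<le> card E" by simp
  moreover have "card (V - I) = card V - card I" using fin by (intro card_Diff_subset) (auto simp: I_def)
  ultimately have "2 \<le> card I" using e by linarith
  then obtain J where "J \<subseteq> I" "card J = 2" by (metis obtain_subset_with_card_n)
  then obtain x x' where "x \<in> I" "x' \<in> I" "x \<noteq> x'" by (auto simp: card_2_iff)
  then show ?thesis using that by (auto simp: I_def)
qed

subsection \<open>The induction\<close>

lemma fgraph_remove_isolated:
  assumes g: "fgraph V E" and "nbrs E x = {}" "nbrs E x' = {}"
  shows "fgraph (V - {y, x, x'}) (del_vertex y E)"
  using assms isolated_iff[OF g] by (auto simp: fgraph_def del_vertex_def)

lemma degree_ge_2:
  assumes "fgraph V E" "{v, a} \<in> E" "{v, b} \<in> E" "a \<noteq> b"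
  shows "2 \<le> card (nbrs E v)"
  using card_mono[OF finite_nbrs[OF assms(1)], of "{a, b}" v] assms by (auto simp: nbrs_def)

lemma degree_ge_3:
  assumes "fgraph V E" "{v, a} \<in> E" "{v, b} \<in> E" "{v, c} \<in> E" "distinct [a, b, c]"
  shows "3 \<le> card (nbrs E v)"
  using card_mono[OF finite_nbrs[OF assms(1)], of "{a, b, c}" v] assms by (auto simp: nbrs_def)

lemma degree_ge_4:
  assumes "fgraph V E" "{v, a} \<in> E" "{v, b} \<in> E" "{v, c} \<in> E" "{v, d} \<in> E" "distinct [a, b, c, d]"
  shows "4 \<le> card (nbrs E v)"
  using card_mono[OF finite_nbrs[OF assms(1)], of "{a, b, c, d}" v] assms by (auto simp: nbrs_def)

lemma diamond_degree:
  assumes "fgraph V E" "diamond_in E"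
  shows "\<exists>v\<in>V. 3 \<le> card (nbrs E v)"
proof -
  obtain a b c d where e: "c \<noteq> d" "{a, b} \<in> E" "{a, c} \<in> E" "{b, c} \<in> E" "{a, d} \<in> E" "{b, d} \<in> E"
    using assms(2) unfolding diamond_in_def by blast
  have "distinct [b, c, d]" using fgraph_edge(3)[OF assms(1)] e by auto
  then show ?thesis
    using degree_ge_3[OF assms(1) e(2,3,5)] fgraph_edge(1)[OF assms(1) e(2)] by blast
qed

lemma K4_diamond: "fgraph V E \<Longrightarrow> K4_in E \<Longrightarrow> diamond_in E"
  unfolding K4_in_def diamond_in_def using fgraph_edge(3) by metis

lemma clique_degree:
  assumes g: "fgraph V E" and "finite K" "\<forall>u\<in>K. \<forall>v\<in>K. u \<noteq> v \<longrightarrow> {u, v} \<in> E" "v \<in> K"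
  shows "card K \<le> card (nbrs E v) + 1"
proof -
  have "K - {v} \<subseteq> nbrs E v" using assms by (auto simp: nbrs_def)
  then have "card (K - {v}) \<le> card (nbrs E v)" by (intro card_mono finite_nbrs[OF g])
  then show ?thesis using assms by simp
qed

lemma clique_edges:
  assumes "finite E" "finite K" "\<forall>u\<in>K. \<forall>v\<in>K. u \<noteq> v \<longrightarrow> {u, v} \<in> E"
  shows "card K choose 2 \<le> card E"
  using card_mono[OF assms(1) pairs_in_clique[OF assms(3)]] n_subsets[OF assms(2), of 2] by simp

lemma diamond_edges:
  assumes g: "fgraph V E" and "card E \<le> 5"
    and e: "c \<noteq> d" "{a, b} \<in> E" "{a, c} \<in> E" "{b, c} \<in> E" "{a, d} \<in> E" "{b, d} \<in> E"
  shows "E = {{a, b}, {a, c}, {b, c}, {a, d}, {b, d}}"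
proof -
  have "distinct [a, b, c, d]" using fgraph_edge(3)[OF g] e by auto
  then have "card {{a, b}, {a, c}, {b, c}, {a, d}, {b, d}} = 5"
    by (auto simp: card_insert_if doubleton_eq_iff)
  then show ?thesis using assms(2) e finite_edges[OF g] by (intro card_seteq[symmetric]) auto
qed

lemma diamond_card:
  assumes g: "fgraph V E" and "diamond_in E"
  shows "5 \<le> card E"
proof (rule ccontr)
  assume less: "\<not> 5 \<le> card E"
  obtain a b c d where e: "c \<noteq> d" "{a, b} \<in> E" "{a, c} \<in> E" "{b, c} \<in> E" "{a, d} \<in> E" "{b, d} \<in> E"
    using assms(2) unfolding diamond_in_def by blast
  have "distinct [a, b, c, d]" using fgraph_edge(3)[OF g] e by auto
  then have "card E = 5"
    using diamond_edges[OF g _ e] less by (simp add: card_insert_if doubleton_eq_iff)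
  then show False using less by simp
qed

section \<open>Graphs with a clique of four or five vertices\<close>

text \<open>The at most \<open>r\<close> edges outside the clique meet at most \<open>2 * r\<close>
  vertices, so at most \<open>card K + 2 * r\<close> vertices are not isolated. This takes the place
  of \<open>two_isolated\<close> for graphs that may have leaves.\<close>

lemma two_isolated_off_clique:
  assumes g: "fgraph V E" and K: "finite K" "\<forall>u\<in>K. \<forall>v\<in>K. u \<noteq> v \<longrightarrow> {u, v} \<in> E"
    and e: "card E \<le> (card K choose 2) + r" "card K + 2 * r + 2 \<le> card V"
  obtains x x' where "x \<in> V" "x' \<in> V" "x \<noteq> x'" "nbrs E x = {}" "nbrs E x' = {}"
proof -
  have fin: "finite V" "finite E" using g finite_edges[OF g] by (auto simp: fgraph_def)
  let ?P = "{e. e \<subseteq> K \<and> card e = 2}"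
  have P: "?P \<subseteq> E" "card ?P = card K choose 2"
    using pairs_in_clique[OF K(2)] n_subsets[OF K(1), of 2] by auto
  then have r: "card (E - ?P) \<le> r" using e(1) fin by (simp add: card_Diff_subset finite_subset)
  have g': "fgraph V (E - ?P)" using g by (auto simp: fgraph_def)
  have sub: "\<Union>E \<subseteq> K \<union> \<Union>(E - ?P)" by auto
  have fin': "finite (\<Union>(E - ?P))"
    using fin(1) g finite_subset[of "\<Union>(E - ?P)" V] by (auto simp: fgraph_def)
  have "card (\<Union>E) \<le> card (K \<union> \<Union>(E - ?P))" using K(1) fin' sub by (intro card_mono) auto
  also have "\<dots> \<le> card K + 2 * r"
    using card_Un_le[of K "\<Union>(E - ?P)"] card_Union_edges[OF g'] r by linarith
  finally have "card (\<Union>E) \<le> card K + 2 * r" .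
  moreover have "card (V - \<Union>E) = card V - card (\<Union>E)"
    using g fin by (intro card_Diff_subset) (auto simp: fgraph_def intro: finite_subset)
  ultimately have "2 \<le> card (V - \<Union>E)" using e(2) by linarith
  then obtain J where "J \<subseteq> V - \<Union>E" "card J = 2" by (metis obtain_subset_with_card_n)
  then obtain x x' where "{x, x'} \<subseteq> V - \<Union>E" "x \<noteq> x'" by (auto simp: card_2_iff)
  then show ?thesis using that isolated_iff[OF g] by auto
qed

text \<open>The induction hypothesis is a premise here and in the lemmas below, so that the single
  cases can be proved outside the induction.\<close>

lemma order_clique_vertex_first:
  fixes V :: "'a set"
  assumes g: "fgraph V E" and x: "x \<in> V" "x' \<in> V" "x \<noteq> x'" "nbrs E x = {}" "nbrs E x' = {}"
    and y: "nbrs E y \<noteq> {}" and ad: "admissible (V - {y, x, x'}) (del_vertex y E)"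
    and n: "9 \<le> card V"
    and IH: "\<And>V' (E' :: 'a set set). fgraph V' E' \<Longrightarrow> 6 \<le> card V' \<Longrightarrow> card V' < card V \<Longrightarrow>
      admissible V' E' \<Longrightarrow> \<exists>ws. spread_order V' E' ws"
  shows "\<exists>ws. spread_order V E ws"
proof -
  have y': "y \<in> V" "y \<noteq> x" "y \<noteq> x'"
    using x y fgraph_edge(1)[OF g] by (auto simp: nbrs_def)
  have g': "fgraph (V - {y, x, x'}) (del_vertex y E)" using fgraph_remove_isolated[OF g x(4,5)] .
  have "card (V - {y, x, x'}) + 3 = card V" using x y' n by (simp add: card_Diff_subset)
  then obtain ws where "spread_order (V - {y, x, x'}) (del_vertex y E) ws" using IH[OF g' _ _ ad] n by auto
  from order_front_isolated2[OF g this y'(1) x(1,2) y'(2,3) x(3,4,5)] show ?thesis by (rule exI)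
qed

lemma card_remove3:
  assumes "fgraph V E" "x \<in> V" "x' \<in> V" "x \<noteq> x'" "nbrs E x = {}" "nbrs E x' = {}" "nbrs E y \<noteq> {}"
    "3 \<le> card V"
  shows "card (V - {y, x, x'}) + 3 = card V"
proof -
  have "y \<in> V" "y \<noteq> x" "y \<noteq> x'"
    using assms fgraph_edge(1)[OF assms(1)] by (auto simp: nbrs_def)
  then show ?thesis using assms by (simp add: card_Diff_subset)
qed

text \<open>Deleting a leaf would lead to the exceptional size 12. Taking out a clique vertex, of
  degree at least 4, and two isolated vertices leaves ten vertices with at most seven edges: the
  edge bound is not tight, so nothing is blocked, and no clique is forbidden at size 10.\<close>

lemma order_clique5:
  fixes V :: "'a set"
  assumes g: "fgraph V E" and V: "card V = 13" and e: "card E \<le> 11" and "clique_in 5 E"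
    and IH: "\<And>V' (E' :: 'a set set). fgraph V' E' \<Longrightarrow> 6 \<le> card V' \<Longrightarrow> card V' < card V \<Longrightarrow>
      admissible V' E' \<Longrightarrow> \<exists>ws. spread_order V' E' ws"
  shows "\<exists>ws. spread_order V E ws"
proof -
  obtain K where K: "finite K" "card K = 5" "\<forall>u\<in>K. \<forall>v\<in>K. u \<noteq> v \<longrightarrow> {u, v} \<in> E"
    using assms(4) unfolding clique_in_def by blast
  obtain x x' where x: "x \<in> V" "x' \<in> V" "x \<noteq> x'" "nbrs E x = {}" "nbrs E x' = {}"
    by (rule two_isolated_off_clique[OF g K(1,3), of 1]) (use K(2) V e in \<open>auto simp: choose_two\<close>)
  obtain y where y: "y \<in> K" using K(2) by fastforce
  have d: "4 \<le> card (nbrs E y)" using clique_degree[OF g K(1,3) y] K(2) by simp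
  then have ne: "nbrs E y \<noteq> {}" by auto
  have g': "fgraph (V - {y, x, x'}) (del_vertex y E)" using fgraph_remove_isolated[OF g x(4,5)] .
  have V': "card (V - {y, x, x'}) = 10" using card_remove3[OF g x ne] V by simp
  have e': "card (del_vertex y E) \<le> 7" using card_del_vertex[OF g, of y] d e by linarith
  have "admissible (V - {y, x, x'}) (del_vertex y E)"
    unfolding admissible_def using unblocked_if[OF g'] V' e' by simp
  from order_clique_vertex_first[OF g x ne this _ IH] show ?thesis using V by simp
qed

text \<open>Seven vertices remain, where only five remaining edges could produce a blocked vertex or
  a diamond. In that case \<open>y\<close> has degree 3, by its choice all clique vertices have
  degree at most 3, and they lose the neighbour \<open>y\<close>; any other vertex meets only the at
  most two edges outside the clique. Thus all remaining degrees are at most 2, too small for either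
  obstruction.\<close>

lemma order_K4:
  fixes V :: "'a set"
  assumes g: "fgraph V E" and V: "card V = 10" and e: "card E \<le> 8" and "K4_in E"
    and IH: "\<And>V' (E' :: 'a set set). fgraph V' E' \<Longrightarrow> 6 \<le> card V' \<Longrightarrow> card V' < card V \<Longrightarrow>
      admissible V' E' \<Longrightarrow> \<exists>ws. spread_order V' E' ws"
  shows "\<exists>ws. spread_order V E ws"
proof -
  obtain a b c d where dd: "{a, b} \<in> E" "{a, c} \<in> E" "{b, c} \<in> E" "{a, d} \<in> E" "{b, d} \<in> E" "{c, d} \<in> E"
    using assms(4) unfolding K4_in_def by blast
  define K where "K = {a, b, c, d}"
  have K: "finite K" "card K = 4" "\<forall>u\<in>K. \<forall>v\<in>K. u \<noteq> v \<longrightarrow> {u, v} \<in> E"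
    using dd fgraph_edge(3)[OF g] by (auto simp: K_def card_insert_if insert_commute)
  obtain x x' where x: "x \<in> V" "x' \<in> V" "x \<noteq> x'" "nbrs E x = {}" "nbrs E x' = {}"
    by (rule two_isolated_off_clique[OF g K(1,3), of 2]) (use K(2) V e in \<open>auto simp: choose_two\<close>)
  have deg3: "3 \<le> card (nbrs E v)" if "v \<in> K" for v
    using clique_degree[OF g K(1,3) that] K(2) by simp
  \<comment> \<open>A clique vertex of degree at least 4 if there is one, otherwise any clique
    vertex.\<close>
  obtain y where y: "y \<in> K" "\<And>v. v \<in> K \<Longrightarrow> 4 \<le> card (nbrs E v) \<Longrightarrow> 4 \<le> card (nbrs E y)"
    by (cases "\<exists>y\<in>K. 4 \<le> card (nbrs E y)") (auto simp: K_def)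
  have ne: "nbrs E y \<noteq> {}" using deg3[OF y(1)] by auto
  have g': "fgraph (V - {y, x, x'}) (del_vertex y E)" using fgraph_remove_isolated[OF g x(4,5)] .
  have V': "card (V - {y, x, x'}) = 7" using card_remove3[OF g x ne] V by simp
  have ce: "card E = card (del_vertex y E) + card (nbrs E y)" by (rule card_del_vertex[OF g])
  have e': "card (del_vertex y E) \<le> 5" using ce deg3[OF y(1)] e by linarith
  have small: "card (nbrs (del_vertex y E) v) \<le> 2" if five: "card (del_vertex y E) = 5" for v
  proof (cases "v \<in> K")
    case True
    have "card (nbrs E v) \<le> 3" using y(2)[OF True] ce e five by linarith
    moreover have "y \<in> nbrs E v" if "v \<noteq> y" using that K(3) True y(1) by (simp add: nbrs_def)
    ultimately show ?thesis
      using finite_nbrs[OF g, of v] by (cases "v = y") (auto simp: nbrs_del_vertex)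
  next
    case False
    let ?P = "{e. e \<subseteq> K \<and> card e = 2}"
    have P: "?P \<subseteq> E" "card ?P = 6"
      using pairs_in_clique[OF K(3)] n_subsets[OF K(1), of 2] K(2) by (auto simp: choose_two)
    have fin: "finite E" using finite_edges[OF g] .
    have "card (nbrs (del_vertex y E) v) \<le> card (nbrs E v)"
      using finite_nbrs[OF g] by (intro card_mono) (auto simp: nbrs_del_vertex)
    also have "\<dots> = card {e \<in> E. v \<in> e}" using card_incident[OF g] by simp
    also have "\<dots> \<le> card (E - ?P)" using False fin by (intro card_mono) auto
    also have "\<dots> \<le> 2" using P e fin by (simp add: card_Diff_subset finite_subset)
    finally show ?thesis .
  qed
  have "admissible (V - {y, x, x'}) (del_vertex y E)"
    unfolding admissible_def
  proof (intro conjI impI)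
    show "unblocked (V - {y, x, x'}) (del_vertex y E)"
    proof (rule unblocked_if[OF g'])
      show "card (del_vertex y E) + 2 \<le> card (V - {y, x, x'})" using V' e' by simp
      show "card (nbrs (del_vertex y E) c) + 3 < card (V - {y, x, x'})"
        if "card (del_vertex y E) + 2 = card (V - {y, x, x'})" for c
        using small[of c] V' that by simp
    qed
    show "\<not> diamond_in (del_vertex y E)"
    proof
      assume dia: "diamond_in (del_vertex y E)"
      have "card (del_vertex y E) = 5" using diamond_card[OF g' dia] e' by simp
      moreover obtain v where "3 \<le> card (nbrs (del_vertex y E) v)"
        using diamond_degree[OF g' dia] by blast
      ultimately show False using small[of v] by simp
    qed
  qed (use V' e' in auto)
  from order_clique_vertex_first[OF g x ne this _ IH] show ?thesis using V by simp
qed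

section \<open>Leafless graphs after deletion of a vertex of maximum degree\<close>

text \<open>Otherwise \<open>z\<close> would be a leaf attached to \<open>y\<close>.\<close>

lemma other_edge:
  assumes g: "fgraph V E" and nl: "\<forall>v\<in>V. card (nbrs E v) \<noteq> 1" and z: "z \<in> nbrs E y"
  shows "\<exists>e\<in>del_vertex y E. z \<in> e"
proof (rule ccontr)
  assume no: "\<not> ?thesis"
  have "nbrs E z = {y}"
  proof
    show "{y} \<subseteq> nbrs E z" using z by (auto simp: nbrs_def insert_commute)
    show "nbrs E z \<subseteq> {y}"
    proof
      fix u assume u: "u \<in> nbrs E z"
      have "z \<noteq> y" using nbrs_subset[OF g] z by blast
      then show "u \<in> {y}" using no u by (auto simp: nbrs_def del_vertex_def)
    qed
  qed
  moreover have "z \<in> V" using nbrs_subset[OF g] z by blast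
  ultimately show False using nl by force
qed

text \<open>Counting edges, the diamond is all that remains without \<open>y\<close>, and
  \<open>y\<close> has degree 3. By \<open>other_edge\<close> its neighbours lie in the diamond, but
  \<open>a\<close> and \<open>b\<close> would reach degree 4, above the maximum; \<open>c\<close>
  and \<open>d\<close> are only two.\<close>

lemma leafless_diamond:
  assumes g: "fgraph V E" and nl: "\<forall>v\<in>V. card (nbrs E v) \<noteq> 1" and e: "card E \<le> 8"
    and y: "\<forall>v\<in>V. card (nbrs E v) \<le> card (nbrs E y)" and y3: "3 \<le> card (nbrs E y)"
    and dia: "diamond_in (del_vertex y E)"
  shows False
proof -
  obtain a b c d where dd: "c \<noteq> d" "{a, b} \<in> del_vertex y E" "{a, c} \<in> del_vertex y E"
    "{b, c} \<in> del_vertex y E" "{a, d} \<in> del_vertex y E" "{b, d} \<in> del_vertex y E"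
    using dia unfolding diamond_in_def by blast
  have gy: "fgraph (V - {y}) (del_vertex y E)" using g by (rule fgraph_del_vertex)
  have dis: "distinct [a, b, c, d]" using fgraph_edge(3)[OF gy] dd by auto
  have ed: "{a, b} \<in> E" "{a, c} \<in> E" "{b, c} \<in> E" "{a, d} \<in> E" "{b, d} \<in> E"
    and ny: "a \<noteq> y" "b \<noteq> y" "c \<noteq> y" "d \<noteq> y"
    using dd by (auto simp: doubleton_in_del_vertex)
  have ba: "{b, a} \<in> E" using ed by (simp add: insert_commute)
  have "card (del_vertex y E) \<le> 5" using card_del_vertex[OF g, of y] y3 e by linarith
  from diamond_edges[OF gy this dd] have D: "del_vertex y E = {{a, b}, {a, c}, {b, c}, {a, d}, {b, d}}" .
  then have "card (del_vertex y E) = 5"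
    using dis by (auto simp: card_insert_if doubleton_eq_iff)
  then have y3': "card (nbrs E y) = 3" using card_del_vertex[OF g, of y] y3 e by linarith
  have "nbrs E y \<subseteq> {c, d}"
  proof
    fix z assume z: "z \<in> nbrs E y"
    have zV: "z \<in> V" using nbrs_subset[OF g] z by blast
    have zy: "{z, y} \<in> E" using z by (simp add: nbrs_def insert_commute)
    have "z \<in> {a, b, c, d}" using other_edge[OF g nl z] D by auto
    moreover have "z \<noteq> a"
      using degree_ge_4[OF g ed(1,2,4), of y] zy dis ny y zV y3' by force
    moreover have "z \<noteq> b"
      using degree_ge_4[OF g ba ed(3,5), of y] zy dis ny y zV y3' by force
    ultimately show "z \<in> {c, d}" by blast
  qed
  then have "card (nbrs E y) \<le> card {c, d}" by (intro card_mono) auto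
  then show False using y3' dd(1) by simp
qed

text \<open>The edge bound leaves degree 3 or 4 for \<open>y\<close>. With degree 4 the K4 uses up
  all other edges, so by \<open>other_edge\<close> its vertices are the neighbours of
  \<open>y\<close> and form a K5 with it. With degree 3 no neighbour lies in the K4, since it would
  have degree 4; all three would have to be ends of the single edge that may remain outside the
  K4.\<close>

lemma leafless_K4:
  assumes g: "fgraph V E" and nl: "\<forall>v\<in>V. card (nbrs E v) \<noteq> 1" and e: "card E \<le> 10"
    and y: "\<forall>v\<in>V. card (nbrs E v) \<le> card (nbrs E y)" and y3: "3 \<le> card (nbrs E y)"
    and K4: "K4_in (del_vertex y E)"
  shows "clique_in 5 E"
proof -
  have gy: "fgraph (V - {y}) (del_vertex y E)" using g by (rule fgraph_del_vertex)
  obtain a b c d where dd: "{a, b} \<in> del_vertex y E" "{a, c} \<in> del_vertex y E" "{b, c} \<in> del_vertex y E"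
    "{a, d} \<in> del_vertex y E" "{b, d} \<in> del_vertex y E" "{c, d} \<in> del_vertex y E"
    using K4 unfolding K4_in_def by blast
  define K where "K = {a, b, c, d}"
  have K: "finite K" "card K = 4" "\<forall>u\<in>K. \<forall>v\<in>K. u \<noteq> v \<longrightarrow> {u, v} \<in> del_vertex y E"
    using dd fgraph_edge(3)[OF gy] by (auto simp: K_def card_insert_if insert_commute)
  have KE: "\<forall>u\<in>K. \<forall>v\<in>K. u \<noteq> v \<longrightarrow> {u, v} \<in> E" using K(3) by (auto simp: del_vertex_def)
  have yK: "y \<notin> K" using dd by (auto simp: K_def del_vertex_def)
  let ?P = "{e. e \<subseteq> K \<and> card e = 2}"
  have P: "?P \<subseteq> del_vertex y E" "card ?P = 6"
    using pairs_in_clique[OF K(3)] n_subsets[OF K(1), of 2] K(2) by (auto simp: choose_two)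
  have fin: "finite (del_vertex y E)" using finite_edges[OF gy] .
  have six: "6 \<le> card (del_vertex y E)" using card_mono[OF fin P(1)] P(2) by simp
  have cardR: "card (del_vertex y E - ?P) + 6 = card (del_vertex y E)"
    using card_Diff_subset[OF finite_subset[OF P(1) fin] P(1)] P(2) six by simp
  have ce: "card E = card (del_vertex y E) + card (nbrs E y)" by (rule card_del_vertex[OF g])
  have Ky: "5 \<le> card (nbrs E y)" if z: "z \<in> nbrs E y" "z \<in> K" "card (nbrs E y) \<noteq> 4" for z
  proof -
    have "insert y (K - {z}) \<subseteq> nbrs E z" using z KE by (auto simp: nbrs_def insert_commute)
    then have "card (insert y (K - {z})) \<le> card (nbrs E z)" by (intro card_mono finite_nbrs[OF g])
    then have "4 \<le> card (nbrs E z)" using K z yK by simp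
    moreover have "z \<in> V" using nbrs_subset[OF g] z by blast
    ultimately show ?thesis using y z(3) by force
  qed
  have out: "\<exists>e\<in>del_vertex y E - ?P. z \<in> e" if "z \<in> nbrs E y" "z \<notin> K" for z
    using other_edge[OF g nl that(1)] that(2) by auto
  have le4: "card (nbrs E y) \<le> 4" using ce six e by linarith
  show ?thesis
  proof (cases "card (nbrs E y) = 4")
    case True
    then have "card (del_vertex y E - ?P) = 0" using ce cardR e by linarith
    then have "del_vertex y E - ?P = {}" using fin by simp
    then have "nbrs E y \<subseteq> K" using out by blast
    then have "nbrs E y = K" using True K by (intro card_seteq) auto
    then have "\<forall>u\<in>insert y K. \<forall>v\<in>insert y K. u \<noteq> v \<longrightarrow> {u, v} \<in> E"
      using KE by (auto simp: nbrs_def insert_commute)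
    then show ?thesis unfolding clique_in_def using K yK by (intro exI[of _ "insert y K"]) simp
  next
    case False
    then have y3': "card (nbrs E y) = 3" using y3 le4 by simp
    then have NK: "z \<notin> K" if "z \<in> nbrs E y" for z using Ky that by fastforce
    have "card (del_vertex y E - ?P) \<le> 1" using ce cardR e y3' by linarith
    moreover have "fgraph (V - {y}) (del_vertex y E - ?P)" using gy by (auto simp: fgraph_def)
    ultimately have "card (\<Union>(del_vertex y E - ?P)) \<le> 2" using card_Union_edges by fastforce
    moreover have sub: "nbrs E y \<subseteq> \<Union>(del_vertex y E - ?P)" using out NK by blast
    moreover have "finite (\<Union>(del_vertex y E - ?P))"
      using gy finite_subset[of "\<Union>(del_vertex y E - ?P)" "V - {y}"] by (auto simp: fgraph_def)
    ultimately have "card (nbrs E y) \<le> 2" using card_mono[OF _ sub] by linarith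
    then show ?thesis using y3' by simp
  qed
qed

lemma degree_le_1:
  assumes "fgraph V E" "\<forall>v\<in>V. card (nbrs E v) < 2" "{a, b} \<in> E" "{a, c} \<in> E"
  shows "b = c"
  using degree_ge_2[OF assms(1,3,4)] fgraph_edge(1)[OF assms(1,3)] assms(2) by fastforce

lemma degree_ge_2_edges:
  assumes "2 \<le> card (nbrs E v)"
  obtains a b where "{v, a} \<in> E" "{v, b} \<in> E" "a \<noteq> b"
proof -
  obtain J where "J \<subseteq> nbrs E v" "card J = 2" using assms by (metis obtain_subset_with_card_n)
  then show ?thesis using that by (auto simp: card_2_iff nbrs_def)
qed

lemma degree_ge_3_edges:
  assumes "3 \<le> card (nbrs E v)"
  obtains a b c where "{v, a} \<in> E" "{v, b} \<in> E" "{v, c} \<in> E" "distinct [a, b, c]"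
proof -
  obtain J where "J \<subseteq> nbrs E v" "card J = 3" using assms by (metis obtain_subset_with_card_n)
  then show ?thesis using that by (auto simp: card_3_iff nbrs_def)
qed

lemma order_no_edges:
  assumes "finite V"
  shows "\<exists>ws. spread_order V {} ws"
  using finite_distinct_list[OF assms] spread_no_edges unfolding spread_order_def by blast

lemma nonempty_edge:
  assumes "fgraph V E" "E \<noteq> {}"
  obtains a b where "{a, b} \<in> E"
  using assms by (metis equals0I fgraph_edge_cases)

section \<open>Base cases with six and seven vertices\<close>

lemma order6:
  assumes g: "fgraph V E" and n: "card V = 6" and ad: "admissible V E"
  shows "\<exists>ws. spread_order V E ws"
proof -
  have e: "card E \<le> 4" and ub: "unblocked V E" "\<not> triangle_in E"
    using ad n by (auto simp: admissible_def)
  show ?thesis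
  proof (cases "\<exists>v\<in>V. 2 \<le> card (nbrs E v)")
    case True
    then obtain v a b where "{v, a} \<in> E" "{v, b} \<in> E" "a \<noteq> b" by (metis degree_ge_2_edges)
    then show ?thesis by (rule cherry6[OF g n e ub])
  next
    case False
    then have lt: "\<forall>v\<in>V. card (nbrs E v) < 2" by auto
    show ?thesis
    proof (cases "E = {}")
      case True
      then show ?thesis using order_no_edges g by (auto simp: fgraph_def)
    next
      case False
      then obtain a b where ab: "{a, b} \<in> E" using nonempty_edge[OF g] by auto
      show ?thesis by (rule matching6[OF g n e ub ab degree_le_1[OF g lt]])
    qed
  qed
qed

text \<open>A leaf is deleted only if all degrees are at most 2 and there is no triangle, which
  makes the graph on six vertices admissible. If there is an edge but neither leaf nor triangle,
  every edge extends to a path with three edges.\<close>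

lemma order7:
  assumes g: "fgraph V E" and n: "card V = 7" and ad: "admissible V E"
  shows "\<exists>ws. spread_order V E ws"
proof -
  have e: "card E \<le> 5" and ub: "unblocked V E" "\<not> diamond_in E"
    using ad n by (auto simp: admissible_def)
  consider (none) "E = {}" | (star) v where "3 \<le> card (nbrs E v)" | (triangle) "triangle_in E"
    | (leaf) x where "x \<in> V" "card (nbrs E x) = 1" "\<not> triangle_in E" "\<And>v. card (nbrs E v) \<le> 2"
    | (path) "E \<noteq> {}" "\<not> triangle_in E" "\<forall>x\<in>V. card (nbrs E x) \<noteq> 1"
    by (metis not_less_eq_eq numeral_2_eq_2 numeral_3_eq_3)
  then show ?thesis
  proof cases
    case none
    then show ?thesis using order_no_edges g by (auto simp: fgraph_def)
  next
    case star
    then obtain a b c where ed: "{v, a} \<in> E" "{v, b} \<in> E" "{v, c} \<in> E" and "distinct [a, b, c]"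
      by (rule degree_ge_3_edges)
    then have "distinct [v, a, b, c]" using fgraph_edge(3)[OF g] by auto
    with ed show ?thesis by (rule star7[OF g n e ub])
  next
    case triangle
    then obtain a b c where ed: "{a, b} \<in> E" "{a, c} \<in> E" "{b, c} \<in> E"
      unfolding triangle_in_def by blast
    then have "distinct [a, b, c]" using fgraph_edge(3)[OF g] by auto
    with ed show ?thesis by (rule triangle7[OF g n e ub])
  next
    case leaf
    let ?V = "V - {x}" and ?E = "del_vertex x E"
    obtain z where z: "nbrs E x = {z}" using leaf(2) by (auto simp: card_1_singleton_iff)
    have g': "fgraph ?V ?E" using g by (rule fgraph_del_vertex)
    have cV: "card ?V = 6" using leaf(1) n by (simp add: card_Diff_singleton)
    have cE: "card ?E \<le> 4" using card_del_vertex[OF g, of x] leaf(2) e by simp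
    have "card (nbrs ?E c) + 3 < card ?V" for c
    proof -
      have "card (nbrs ?E c) \<le> card (nbrs E c)"
        using finite_nbrs[OF g] by (intro card_mono) (auto simp: nbrs_del_vertex)
      then show ?thesis using leaf(4)[of c] cV by linarith
    qed
    then have "unblocked ?V ?E" using cV cE by (intro unblocked_if[OF g']) auto
    moreover have "?E \<subseteq> E" by (auto simp: del_vertex_def)
    then have "\<not> triangle_in ?E" using leaf(3) unfolding triangle_in_def by blast
    ultimately have "admissible ?V ?E" using cV cE by (simp add: admissible_def)
    then obtain ws where "spread_order ?V ?E ws" using order6[OF g' cV] by blast
    then show ?thesis using order_leaf[OF _ leaf(1) z] n by simp
  next
    case path
    have ext: "\<exists>w. {v, w} \<in> E \<and> w \<noteq> u" if "{u, v} \<in> E" for u v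
    proof -
      have "u \<in> nbrs E v" "v \<in> V" using that fgraph_edge(2)[OF g that] by (auto simp: nbrs_def insert_commute)
      then have "card (nbrs E v) \<noteq> 0" "card (nbrs E v) \<noteq> 1" using finite_nbrs[OF g] path(3) by auto
      then have "2 \<le> card (nbrs E v)" by linarith
      then obtain a b where "{v, a} \<in> E" "{v, b} \<in> E" "a \<noteq> b" by (rule degree_ge_2_edges)
      then show ?thesis by blast
    qed
    obtain a b where ab: "{a, b} \<in> E" using nonempty_edge[OF g path(1)] by auto
    obtain c where bc: "{b, c} \<in> E" "c \<noteq> a" using ext[OF ab] by blast
    obtain d where cd: "{c, d} \<in> E" "d \<noteq> b" using ext[OF bc(1)] by blast
    have "d \<noteq> a"
    proof
      assume "d = a"
      then have "{a, c} \<in> E" using cd(1) by (simp add: insert_commute)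
      then show False using path(2) ab bc(1) unfolding triangle_in_def by blast
    qed
    then have "distinct [a, b, c, d]" using fgraph_edge(3)[OF g] ab bc cd by auto
    with ab bc(1) cd(1) show ?thesis by (rule path7[OF g n e ub])
  qed
qed

section \<open>The reduction steps\<close>

text \<open>After the deletion a blocked vertex has degree at least \<open>card V - 4\<close> in the
  original graph. Other failures need an exceptional size: a diamond comes from eight vertices, a K4
  from ten (nine is excluded by admissibility itself) and a K5 from thirteen.\<close>

lemma order_leafy:
  fixes V :: "'a set"
  assumes g: "fgraph V E" and ad: "admissible V E" and n: "8 \<le> card V"
    and x: "x \<in> V" "card (nbrs E x) = 1"
    and IH: "\<And>V' (E' :: 'a set set). fgraph V' E' \<Longrightarrow> 6 \<le> card V' \<Longrightarrow> card V' < card V \<Longrightarrow>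
      admissible V' E' \<Longrightarrow> \<exists>ws. spread_order V' E' ws"
  shows "\<exists>ws. spread_order V E ws"
proof -
  let ?V = "V - {x}" and ?E = "del_vertex x E"
  obtain z where z: "nbrs E x = {z}" using x(2) by (auto simp: card_1_singleton_iff)
  have g': "fgraph ?V ?E" using g by (rule fgraph_del_vertex)
  have sub: "?E \<subseteq> E" by (auto simp: del_vertex_def)
  have e: "card E + 2 \<le> card V" and ub: "unblocked V E" using ad by (auto simp: admissible_def)
  have cV: "card ?V + 1 = card V" using x n by (simp add: card_Diff_singleton)
  have cE: "card ?E + 1 = card E" using card_del_vertex[OF g, of x] x by simp
  consider (big) c where "c \<in> V" "card V \<le> card (nbrs E c) + 4"
    | (diamond) "card V = 8" "diamond_in ?E"
    | (K4) "card V = 9 \<or> card V = 10" "K4_in ?E"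
    | (K5) "card V = 13" "clique_in 5 ?E"
    | (good) "admissible ?V ?E"
  proof (cases "unblocked ?V ?E")
    case False
    then obtain c where c: "c \<in> ?V" "card ?V \<le> card (nbrs ?E c) + 3"
      using unblocked_if[OF g'] cV cE e by (metis add_le_cancel_right add.assoc add.commute not_less)
    have "card (nbrs ?E c) \<le> card (nbrs E c)"
      using finite_nbrs[OF g] by (intro card_mono) (auto simp: nbrs_del_vertex)
    then show ?thesis using big[of c] c cV by simp
  next
    case True
    then show ?thesis using that cV cE e n unfolding admissible_def by fastforce
  qed
  then show ?thesis
  proof cases
    case big
    then show ?thesis using order_big_degree[OF g e n ub] by blast
  next
    case diamond
    then have "diamond_in E" using sub unfolding diamond_in_def by blast
    then show ?thesis using diamond8[OF g] diamond ad e by (simp add: admissible_def)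
  next
    case K4
    then have "K4_in E" using sub unfolding K4_in_def by blast
    moreover from this have "card V = 10" using K4 ad by (auto simp: admissible_def)
    ultimately show ?thesis using order_K4[OF g _ _ _ IH] e by simp
  next
    case K5
    then have "clique_in 5 E" using sub unfolding clique_in_def by blast
    then show ?thesis using order_clique5[OF g K5(1) _ _ IH] K5 e by simp
  next
    case good
    then obtain ws where "spread_order ?V ?E ws" using IH[OF g'] cV n by auto
    then show ?thesis using order_leaf[OF _ x(1) z] n by simp
  qed
qed

lemma order_leafless_big:
  fixes V :: "'a set"
  assumes g: "fgraph V E" and ad: "admissible V E" and n: "10 \<le> card V"
    and nl: "\<forall>v\<in>V. card (nbrs E v) \<noteq> 1" and big: "v \<in> V" "3 \<le> card (nbrs E v)"
    and IH: "\<And>V' (E' :: 'a set set). fgraph V' E' \<Longrightarrow> 6 \<le> card V' \<Longrightarrow> card V' < card V \<Longrightarrow>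
      admissible V' E' \<Longrightarrow> \<exists>ws. spread_order V' E' ws"
  shows "\<exists>ws. spread_order V E ws"
proof -
  have e: "card E + 2 \<le> card V" using ad by (simp add: admissible_def)
  have finV: "finite V" using g by (simp add: fgraph_def)
  obtain y where y: "y \<in> V" "\<forall>v\<in>V. card (nbrs E v) \<le> card (nbrs E y)"
  proof -
    have "Max ((\<lambda>v. card (nbrs E v)) ` V) \<in> (\<lambda>v. card (nbrs E v)) ` V"
      using big finV by (intro Max_in) auto
    then obtain y where "y \<in> V" "card (nbrs E y) = Max ((\<lambda>v. card (nbrs E v)) ` V)" by auto
    then show ?thesis using that finV by auto
  qed
  have y3: "3 \<le> card (nbrs E y)" using y big by (meson order_trans)
  obtain x x' where x: "x \<in> V" "x' \<in> V" "x \<noteq> x'" "nbrs E x = {}" "nbrs E x' = {}"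
    using two_isolated[OF g e nl] by blast
  have yx: "y \<noteq> x" "y \<noteq> x'" using y3 x by auto
  let ?V = "V - {y, x, x'}" and ?E = "del_vertex y E"
  have g': "fgraph ?V ?E" using fgraph_remove_isolated[OF g x(4,5)] .
  have cV: "card ?V + 3 = card V" using x y yx n by (simp add: card_Diff_subset)
  have cE: "card ?E + card (nbrs E y) = card E" using card_del_vertex[OF g, of y] by simp
  have "admissible ?V ?E"
    unfolding admissible_def
  proof (intro conjI impI)
    show e': "card ?E + 2 \<le> card ?V" using cV cE e y3 by linarith
    show "unblocked ?V ?E"
    proof (rule unblocked_if[OF g' e'])
      fix c assume c: "c \<in> ?V" "card ?E + 2 = card ?V"
      have "card (nbrs ?E c) \<le> card (nbrs E c)"
        using finite_nbrs[OF g] by (intro card_mono) (auto simp: nbrs_del_vertex)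
      also have "\<dots> \<le> card (nbrs E y)" using y c by blast
      \<comment> \<open>Tightness means that exactly three edges were removed, so the maximum degree
        is 3, while at least seven vertices remain.\<close>
      finally show "card (nbrs ?E c) + 3 < card ?V" using c cV cE e n by linarith
    qed
    show "\<not> diamond_in ?E" if "card ?V = 7"
      using leafless_diamond[OF g nl _ y(2) y3] cV that e by auto
    show "\<not> K4_in ?E" if "card ?V \<in> {8, 9}"
    proof
      assume K4: "K4_in ?E"
      \<comment> \<open>The K4 extends to a K5, whose ten edges force twelve vertices, and there
        admissibility excludes it.\<close>
      have "card E \<le> 10" using that cV e by auto
      then have K5: "clique_in 5 E" using leafless_K4[OF g nl _ y(2) y3 K4] by simp
      then obtain K where K: "finite K" "card K = 5" "\<forall>u\<in>K. \<forall>v\<in>K. u \<noteq> v \<longrightarrow> {u, v} \<in> E"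
        unfolding clique_in_def by blast
      have "10 \<le> card E" using clique_edges[OF finite_edges[OF g] K(1,3)] K(2) by (simp add: choose_two)
      then have "card V = 12" using that cV e by auto
      then show False using K5 ad by (simp add: admissible_def)
    qed
    show "\<not> clique_in 5 ?E" if "card ?V = 12"
    proof
      assume "clique_in 5 ?E"
      then obtain K where K: "finite K" "card K = 5" "\<forall>u\<in>K. \<forall>v\<in>K. u \<noteq> v \<longrightarrow> {u, v} \<in> ?E"
        unfolding clique_in_def by blast
      then obtain w where w: "w \<in> K" by fastforce
      have KE: "\<forall>u\<in>K. \<forall>v\<in>K. u \<noteq> v \<longrightarrow> {u, v} \<in> E" using K(3) by (auto simp: del_vertex_def)
      \<comment> \<open>Fifteen vertices allow thirteen edges, but the K5 has ten edges away from
        \<open>y\<close>, and \<open>y\<close>, of maximum degree, has at least four more.\<close>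
      have ten: "10 \<le> card ?E"
        using clique_edges[OF finite_edges[OF g'] K(1,3)] K(2) by (simp add: choose_two)
      have four: "4 \<le> card (nbrs E w)" using clique_degree[OF g K(1) KE w] K(2) by simp
      then have "nbrs E w \<noteq> {}" by auto
      then have "w \<in> V" using fgraph_edge(1)[OF g] by (auto simp: nbrs_def)
      then have "4 \<le> card (nbrs E y)" using y(2) four by (meson order_trans)
      then show False using ten cE e cV that by linarith
    qed
  qed (use cV n in auto)
  then obtain ws where "spread_order ?V ?E ws" using IH[OF g'] cV n by auto
  from order_front_isolated2[OF g this y(1) x(1,2) yx x(3,4,5)] show ?thesis by (rule exI)
qed

text \<open>Degrees at most 2 rule out diamonds, K4 and K5. A triangle would still be possible, but
  it is forbidden only at size 6, and at least seven vertices remain.\<close>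

lemma order_leafless_degree2:
  fixes V :: "'a set"
  assumes g: "fgraph V E" and ad: "admissible V E" and n: "9 \<le> card V"
    and nl: "\<forall>v\<in>V. card (nbrs E v) \<noteq> 1" and small: "\<forall>v\<in>V. card (nbrs E v) \<le> 2" and ne: "E \<noteq> {}"
    and IH: "\<And>V' (E' :: 'a set set). fgraph V' E' \<Longrightarrow> 6 \<le> card V' \<Longrightarrow> card V' < card V \<Longrightarrow>
      admissible V' E' \<Longrightarrow> \<exists>ws. spread_order V' E' ws"
  shows "\<exists>ws. spread_order V E ws"
proof -
  have e: "card E + 2 \<le> card V" using ad by (simp add: admissible_def)
  obtain y u where yu: "{y, u} \<in> E" using nonempty_edge[OF g ne] by auto
  then have y: "y \<in> V" "u \<in> nbrs E y" using fgraph_edge(1)[OF g] by (auto simp: nbrs_def)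
  then have "card (nbrs E y) \<noteq> 0" using finite_nbrs[OF g] by auto
  then have y2: "card (nbrs E y) = 2" using nl small y(1) by force
  obtain x where x: "x \<in> V" "nbrs E x = {}" by (rule two_isolated[OF g e nl]) blast
  have yx: "y \<noteq> x" using x y by auto
  let ?V = "V - {y, x}" and ?E = "del_vertex y E"
  have g': "fgraph ?V ?E" using fgraph_remove_isolated[OF g x(2) x(2), of y] by simp
  have cV: "card ?V + 2 = card V" using x y yx n by (simp add: card_Diff_subset)
  have cE: "card ?E + 2 = card E" using card_del_vertex[OF g, of y] y2 by simp
  have deg: "card (nbrs ?E c) \<le> 2" if "c \<in> ?V" for c
  proof -
    have "card (nbrs ?E c) \<le> card (nbrs E c)"
      using finite_nbrs[OF g] by (intro card_mono) (auto simp: nbrs_del_vertex)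
    then show ?thesis using small that by (meson DiffD1 order_trans)
  qed
  then have nd: "\<not> diamond_in ?E" using diamond_degree[OF g'] by fastforce
  moreover have "\<not> K4_in ?E" using K4_diamond[OF g'] nd by blast
  moreover have "\<not> clique_in 5 ?E"
  proof
    assume "clique_in 5 ?E"
    then obtain K where K: "finite K" "card K = 5" "\<forall>u\<in>K. \<forall>v\<in>K. u \<noteq> v \<longrightarrow> {u, v} \<in> ?E"
      unfolding clique_in_def by blast
    then obtain w where w: "w \<in> K" by fastforce
    have d: "4 \<le> card (nbrs ?E w)" using clique_degree[OF g' K(1,3) w] K(2) by simp
    then have "nbrs ?E w \<noteq> {}" by auto
    then have "w \<in> ?V" using fgraph_edge(1)[OF g'] by (auto simp: nbrs_def)
    then show False using deg d by fastforce
  qed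
  moreover have "unblocked ?V ?E"
  proof (rule unblocked_if[OF g'])
    show "card ?E + 2 \<le> card ?V" using cV cE e by linarith
    show "card (nbrs ?E c) + 3 < card ?V" if "c \<in> ?V" for c using deg[OF that] cV n by linarith
  qed
  ultimately have "admissible ?V ?E"
    unfolding admissible_def using cV cE e n by auto
  then obtain ws where "spread_order ?V ?E ws" using IH[OF g'] cV n by auto
  then show ?thesis using order_degree2[OF g _ y(1) x(1) yx x(2)] y2 n by simp
qed

text \<open>Leafless graphs on eight vertices, and those on nine with a vertex of degree at least 3,
  are left to the search: the reductions would go below six vertices or end at size 6, where
  triangles are forbidden.\<close>

theorem admissible_imp_order:
  fixes V :: "'a set"
  assumes "fgraph V E" "6 \<le> card V" "admissible V E"
  shows "\<exists>ws. spread_order V E ws"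
  using assms
proof (induction "card V" arbitrary: V E rule: less_induct)
  case less
  have IH: "\<exists>ws. spread_order V' E' ws"
    if "fgraph V' E'" "6 \<le> card V'" "card V' < card V" "admissible V' E'" for V' :: "'a set" and E'
    using less.hyps that by blast
  note g = less.prems(1) and ad = less.prems(3)
  have e: "card E + 2 \<le> card V" using ad by (simp add: admissible_def)
  have finV: "finite V" using g by (simp add: fgraph_def)
  consider (six) "card V = 6" | (seven) "card V = 7" | (none) "E = {}"
    | (leaf) x where "8 \<le> card V" "x \<in> V" "card (nbrs E x) = 1"
    | (leafless) "8 \<le> card V" "E \<noteq> {}" "\<forall>v\<in>V. card (nbrs E v) \<noteq> 1"
    using less.prems(2) by fastforce
  then show ?case
  proof cases
    case six
    then show ?thesis by (rule order6[OF g _ ad])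
  next
    case seven
    then show ?thesis by (rule order7[OF g _ ad])
  next
    case none
    then show ?thesis using order_no_edges[OF finV] by simp
  next
    case leaf
    show ?thesis by (rule order_leafy[OF g ad leaf IH])
  next
    case leafless
    obtain x x' where x: "x \<in> V" "x' \<in> V" "x \<noteq> x'" "nbrs E x = {}" "nbrs E x' = {}"
      using two_isolated[OF g e leafless(3)] by blast
    consider "card V = 8" | "9 \<le> card V" "\<forall>v\<in>V. card (nbrs E v) \<le> 2"
      | v where "card V = 9" "v \<in> V" "3 \<le> card (nbrs E v)"
      | v where "10 \<le> card V" "v \<in> V" "3 \<le> card (nbrs E v)"
      using leafless(1) by fastforce
    then show ?thesis
    proof cases
      case 1
      obtain y u where yu: "{y, u} \<in> E" using nonempty_edge[OF g leafless(2)] by auto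
      then have y: "y \<in> V" "u \<in> nbrs E y" using fgraph_edge(1)[OF g] by (auto simp: nbrs_def)
      then have "card (nbrs E y) \<noteq> 0" using finite_nbrs[OF g] by auto
      then have "2 \<le> card (nbrs E y)" using leafless(3) y(1) by force
      then obtain a b where "{y, a} \<in> E" "{y, b} \<in> E" "a \<noteq> b" by (rule degree_ge_2_edges)
      then show ?thesis using leafless8[OF g 1 _ leafless(3) _ _ _ _ x] e ad 1 by (simp add: admissible_def)
    next
      case 2
      show ?thesis by (rule order_leafless_degree2[OF g ad 2(1) leafless(3) 2(2) leafless(2) IH])
    next
      case 3
      obtain a b c where "{v, a} \<in> E" "{v, b} \<in> E" "{v, c} \<in> E" "distinct [a, b, c]"
        using 3(3) by (rule degree_ge_3_edges)
      then show ?thesis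
        using leafless9[OF g 3(1) _ leafless(3) _ _ _ _ _ x] e ad 3(1) by (simp add: admissible_def)
    next
      case 4
      show ?thesis by (rule order_leafless_big[OF g ad 4(1) leafless(3) 4(2,3) IH])
    qed
  qed
qed

subsection \<open>Packing with the square of a path\<close>

lemma simple_fgraph: "simple_graph G \<longleftrightarrow> fgraph (verts G) (edges G)"
  by (simp add: simple_graph_def fgraph_def)

definition embeds :: "('b \<Rightarrow> 'a) \<Rightarrow> 'b sgraph \<Rightarrow> 'a sgraph \<Rightarrow> bool" where
  "embeds f F H \<longleftrightarrow> inj_on f (verts F) \<and> f ` verts F \<subseteq> verts H \<and>
     (\<forall>u v. {u, v} \<in> edges F \<longrightarrow> {f u, f v} \<in> edges H)"

lemma embeds_copy:
  assumes F: "simple_graph F" and f: "embeds f F H"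
  shows "copy_in F \<lparr>verts = f ` verts F, edges = (`) f ` edges F\<rparr> H"
proof -
  have g: "fgraph (verts F) (edges F)" using F by (simp add: simple_fgraph)
  have inj: "inj_on f (verts F)" using f by (simp add: embeds_def)
  have e: "f ` e \<in> edges H \<and> f ` e \<subseteq> f ` verts F \<and> card (f ` e) = 2" if e: "e \<in> edges F" for e
  proof -
    obtain u v where uv: "e = {u, v}" "u \<noteq> v" "u \<in> verts F" "v \<in> verts F"
      by (rule fgraph_edge_cases[OF g e])
    then have "f u \<noteq> f v" using inj by (auto dest: inj_onD)
    then show ?thesis using uv e f by (auto simp: embeds_def)
  qed
  have "{u, v} \<in> edges F \<longleftrightarrow> {f u, f v} \<in> (`) f ` edges F" if "u \<in> verts F" "v \<in> verts F" for u v
  proof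
    assume "{u, v} \<in> edges F"
    then have "f ` {u, v} \<in> (`) f ` edges F" by (rule imageI)
    then show "{f u, f v} \<in> (`) f ` edges F" by simp
  next
    assume "{f u, f v} \<in> (`) f ` edges F"
    then obtain e where e: "e \<in> edges F" "f ` e = f ` {u, v}" by auto
    moreover have "e \<subseteq> verts F" using g e(1) by (auto simp: fgraph_def)
    ultimately have "e = {u, v}" using that inj_on_image_eq_iff[OF inj, of e "{u, v}"] by simp
    then show "{u, v} \<in> edges F" using e by simp
  qed
  moreover have "bij_betw f (verts F) (f ` verts F)" using inj by (rule inj_on_imp_bij_betw)
  moreover have "finite (verts F)" using g by (simp add: fgraph_def)
  ultimately show ?thesis
    using e f by (auto simp: copy_in_def subgraph_def simple_graph_def isomorphic_def embeds_def)
qed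

lemma contains_iff:
  assumes "simple_graph F"
  shows "contains H F \<longleftrightarrow> (\<exists>f. embeds f F H)"
proof
  assume "contains H F"
  then obtain F' where sub: "subgraph F' H" and iso: "isomorphic F F'"
    unfolding contains_def copy_in_def by blast
  then have F': "verts F' \<subseteq> verts H" "edges F' \<subseteq> edges H" by (auto simp: subgraph_def)
  obtain f where f: "bij_betw f (verts F) (verts F')"
      "\<forall>u\<in>verts F. \<forall>v\<in>verts F. {u, v} \<in> edges F \<longleftrightarrow> {f u, f v} \<in> edges F'"
    using iso unfolding isomorphic_def by blast
  have "{f u, f v} \<in> edges H" if "{u, v} \<in> edges F" for u v
  proof -
    have "u \<in> verts F" "v \<in> verts F"
      using fgraph_edge(1,2)[OF assms[unfolded simple_fgraph] that] .
    then show ?thesis using f(2) F'(2) that by blast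
  qed
  then have "embeds f F H"
    using f(1) F'(1) by (auto simp: embeds_def bij_betw_def)
  then show "\<exists>f. embeds f F H" by blast
next
  assume "\<exists>f. embeds f F H"
  then show "contains H F" using embeds_copy[OF assms] unfolding contains_def by blast
qed

section \<open>The square of the path in terms of positions\<close>

lemma all_nat_Suc: "(\<forall>i::nat. Q i) \<longleftrightarrow> Q 0 \<and> (\<forall>i. Q (Suc i))"
  by (metis not0_implies_Suc)

lemma spread_nth:
  "spread E xs \<longleftrightarrow> (\<forall>i j. i < j \<longrightarrow> j \<le> i + 2 \<longrightarrow> j < length xs \<longrightarrow> {xs ! i, xs ! j} \<notin> E)"
proof (induction xs)
  case (Cons x xs)
  let ?P = "\<lambda>xs i j. i < j \<longrightarrow> j \<le> i + 2 \<longrightarrow> j < length xs \<longrightarrow> {xs ! i, xs ! j} \<notin> E"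
  have first: "(\<forall>y\<in>set (take 2 xs). {x, y} \<notin> E) \<longleftrightarrow> (\<forall>j. ?P (x # xs) 0 j)"
  proof (intro iffI allI impI ballI)
    fix j assume *: "\<forall>y\<in>set (take 2 xs). {x, y} \<notin> E" "0 < j" "j \<le> 0 + 2" "j < length (x # xs)"
    then have "take 2 xs ! (j - 1) \<in> set (take 2 xs)" by (intro nth_mem) auto
    then show "{(x # xs) ! 0, (x # xs) ! j} \<notin> E" using * by (auto simp: nth_Cons')
  next
    fix y assume *: "\<forall>j. ?P (x # xs) 0 j" "y \<in> set (take 2 xs)"
    then obtain i where "i < length xs" "i < 2" "xs ! i = y" by (auto simp: in_set_conv_nth)
    then show "{x, y} \<notin> E" using *(1)[rule_format, of "Suc i"] by auto
  qed
  have rest: "(\<forall>i j. ?P xs i j) \<longleftrightarrow> (\<forall>i j. ?P (x # xs) (Suc i) j)"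
  proof (intro iffI allI)
    fix i j assume "\<forall>i j. ?P xs i j"
    then show "?P (x # xs) (Suc i) j" by (cases j) auto
  next
    fix i j assume "\<forall>i j. ?P (x # xs) (Suc i) j"
    from this[rule_format, of i "Suc j"] show "?P xs i j" by auto
  qed
  have "spread E (x # xs) \<longleftrightarrow> (\<forall>y\<in>set (take 2 xs). {x, y} \<notin> E) \<and> spread E xs" by simp
  also have "\<dots> \<longleftrightarrow> (\<forall>j. ?P (x # xs) 0 j) \<and> (\<forall>i j. ?P (x # xs) (Suc i) j)"
    by (rule arg_cong2[where f = "(\<and>)", OF first trans[OF Cons.IH rest]])
  also have "\<dots> \<longleftrightarrow> (\<forall>i j. ?P (x # xs) i j)" by (rule all_nat_Suc[symmetric])
  finally show ?case .
qed simp

lemma path_edge_iff: "{i, j} \<in> edges (path_graph n) \<longleftrightarrow> (j = Suc i \<or> i = Suc j) \<and> i < n \<and> j < n"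
  by (auto simp: path_graph_def doubleton_eq_iff)

lemma graph_dist_le_iff:
  "graph_dist G u v \<le> enat k \<longleftrightarrow> (\<exists>p. is_walk G u p v \<and> length p \<le> k + 1)"
proof
  assume le: "graph_dist G u v \<le> enat k"
  show "\<exists>p. is_walk G u p v \<and> length p \<le> k + 1"
  proof (rule ccontr)
    assume no: "\<not> ?thesis"
    \<comment> \<open>Walk lengths are integers, so exceeding \<open>k\<close> means being at least
      \<open>Suc k\<close>, and this bound passes to the infimum.\<close>
    have "enat (Suc k) \<le> graph_dist G u v"
      unfolding graph_dist_def
    proof (rule INF_greatest)
      fix p assume "p \<in> {p. is_walk G u p v}"
      then show "enat (Suc k) \<le> enat (length p - 1)" using no by fastforce
    qed
    then have "enat (Suc k) \<le> enat k" using le by (rule order_trans)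
    then show False by simp
  qed
next
  assume "\<exists>p. is_walk G u p v \<and> length p \<le> k + 1"
  then obtain p where "is_walk G u p v" "length p \<le> k + 1" by blast
  then show "graph_dist G u v \<le> enat k"
    unfolding graph_dist_def by (intro INF_lower2[of p]) auto
qed

lemma path_dist_le_2:
  assumes "i < n" "j < n"
  shows "graph_dist (path_graph n) i j \<le> enat 2 \<longleftrightarrow> i \<le> j + 2 \<and> j \<le> i + 2"
proof
  assume "graph_dist (path_graph n) i j \<le> enat 2"
  then obtain p where p: "is_walk (path_graph n) i p j" "length p \<le> 3"
    by (auto simp: graph_dist_le_iff)
  then have "p \<noteq> []" by (simp add: is_walk_def)
  with p(2) consider a where "p = [a]" | a b where "p = [a, b]" | a b c where "p = [a, b, c]"
    by (auto simp: numeral_3_eq_3 neq_Nil_conv le_Suc_eq length_Suc_conv)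
  then show "i \<le> j + 2 \<and> j \<le> i + 2"
    by cases (use p(1) in \<open>auto simp: is_walk_def path_edge_iff\<close>)
next
  assume ij: "i \<le> j + 2 \<and> j \<le> i + 2"
  have V: "verts (path_graph n) = {..<n}" by (simp add: path_graph_def)
  consider "j = i" | "j = Suc i" | "j = Suc (Suc i)" | "i = Suc j" | "i = Suc (Suc j)"
    using ij by linarith
  then have "\<exists>p. is_walk (path_graph n) i p j \<and> length p \<le> 3"
  proof cases
    case 1 then show ?thesis using assms by (intro exI[of _ "[i]"]) (auto simp: is_walk_def V)
  next
    case 2 then show ?thesis using assms by (intro exI[of _ "[i, j]"]) (auto simp: is_walk_def V path_edge_iff)
  next
    case 3 then show ?thesis using assms by (intro exI[of _ "[i, Suc i, j]"]) (auto simp: is_walk_def V path_edge_iff)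
  next
    case 4 then show ?thesis using assms by (intro exI[of _ "[i, j]"]) (auto simp: is_walk_def V path_edge_iff)
  next
    case 5 then show ?thesis using assms by (intro exI[of _ "[i, Suc j, j]"]) (auto simp: is_walk_def V path_edge_iff)
  qed
  then show "graph_dist (path_graph n) i j \<le> enat 2" by (auto simp: graph_dist_le_iff)
qed

abbreviation path_square :: "nat \<Rightarrow> nat sgraph" where
  "path_square n \<equiv> graph_power 2 (path_graph n)"

lemma path_square_verts: "verts (path_square n) = {..<n}"
  by (simp add: graph_power_def path_graph_def)

lemma path_square_edges: "edges (path_square n) = {{i, j} | i j. i < j \<and> j \<le> i + 2 \<and> j < n}"
proof -
  have V: "verts (path_graph n) = {..<n}" by (simp add: path_graph_def)
  have "edges (path_square n) = {{i, j} | i j. i < n \<and> j < n \<and> i \<noteq> j \<and> i \<le> j + 2 \<and> j \<le> i + 2}"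
    by (simp add: graph_power_def V path_dist_le_2 cong: conj_cong)
  also have "\<dots> = {{i, j} | i j. i < j \<and> j \<le> i + 2 \<and> j < n}"
  proof (intro equalityI subsetI)
    fix e assume "e \<in> {{i, j} | i j. i < n \<and> j < n \<and> i \<noteq> j \<and> i \<le> j + 2 \<and> j \<le> i + 2}"
    then obtain i j where "e = {i, j}" "i < n" "j < n" "i \<noteq> j" "i \<le> j + 2" "j \<le> i + 2" by blast
    then show "e \<in> {{i, j} | i j. i < j \<and> j \<le> i + 2 \<and> j < n}"
      by (cases "i < j") (auto simp: insert_commute)
  next
    fix e assume "e \<in> {{i, j} | i j. i < j \<and> j \<le> i + 2 \<and> j < n}"
    then obtain i j where "e = {i, j}" "i < j" "j \<le> i + 2" "j < n" by blast
    moreover from this have "i < n" "i \<noteq> j" "i \<le> j + 2" by linarith+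
    ultimately show "e \<in> {{i, j} | i j. i < n \<and> j < n \<and> i \<noteq> j \<and> i \<le> j + 2 \<and> j \<le> i + 2}" by blast
  qed
  finally show ?thesis .
qed

lemma simple_path_square: "simple_graph (path_square n)"
  by (auto simp: simple_graph_def path_square_verts path_square_edges)

lemma embeds_complete: "simple_graph F \<Longrightarrow> inj_on f (verts F) \<Longrightarrow> f ` verts F \<subseteq> {..<n} \<Longrightarrow>
  embeds f F (complete_graph n)"
proof -
  assume F: "simple_graph F" and inj: "inj_on f (verts F)" and sub: "f ` verts F \<subseteq> {..<n}"
  have "{f u, f v} \<in> edges (complete_graph n)" if "{u, v} \<in> edges F" for u v
  proof -
    have uv: "u \<in> verts F" "v \<in> verts F" "u \<noteq> v"
      using fgraph_edge[OF F[unfolded simple_fgraph] that] .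
    then have "f u \<noteq> f v" using inj by (auto dest: inj_onD)
    moreover have "f u < n" "f v < n" using uv sub by auto
    ultimately show ?thesis unfolding complete_graph_def by auto
  qed
  then show ?thesis using inj sub by (simp add: embeds_def complete_graph_def)
qed

text \<open>Both copies span the complete graph, so the numbering of the path can be pulled back to
  the vertices of \<open>H\<close>. Edge-disjointness then says that no edge of \<open>H\<close>
  joins positions at distance one or two.\<close>

lemma packs_path_square_iff:
  assumes H: "simple_graph H" and n: "card (verts H) = n"
  shows "packs n H (path_square n) \<longleftrightarrow> (\<exists>ws. spread_order (verts H) (edges H) ws)"
proof
  assume "packs n H (path_square n)"
  then obtain G P where GP: "subgraph G (complete_graph n)" "isomorphic H G"
      "subgraph P (complete_graph n)" "isomorphic (path_square n) P" and dis: "edges G \<inter> edges P = {}"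
    unfolding packs_def copy_in_def by blast
  obtain f where f: "bij_betw f (verts H) (verts G)"
      "\<forall>u\<in>verts H. \<forall>v\<in>verts H. {u, v} \<in> edges H \<longleftrightarrow> {f u, f v} \<in> edges G"
    using GP(2) unfolding isomorphic_def by blast
  obtain g where g: "bij_betw g {..<n} (verts P)"
      "\<forall>u\<in>{..<n}. \<forall>v\<in>{..<n}. {u, v} \<in> edges (path_square n) \<longleftrightarrow> {g u, g v} \<in> edges P"
    using GP(4) unfolding isomorphic_def path_square_verts by blast
  have sub: "verts G \<subseteq> {..<n}" "verts P \<subseteq> {..<n}"
    using GP(1,3) by (auto simp: subgraph_def complete_graph_def)
  note G = sub(1) f and P = sub(2) g
  have "card (verts G) = card {..<n}" "card (verts P) = card {..<n}"
    using G(2) P(2) n by (auto dest: bij_betw_same_card)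
  then have VG: "verts G = {..<n}" and VP: "verts P = {..<n}"
    using card_subset_eq[OF finite_lessThan G(1)] card_subset_eq[OF finite_lessThan P(1)] by simp_all
  define h where "h = inv_into (verts H) f"
  have h: "bij_betw h {..<n} (verts H)" "\<And>i. i < n \<Longrightarrow> f (h i) = i"
    using G(2) unfolding VG h_def
    by (auto simp: bij_betw_inv_into bij_betw_inv_into_right)
  \<comment> \<open>A position on the path goes to its place in the complete graph by
    \<open>g\<close> and from there back to a vertex of \<open>H\<close> by
    \<open>h\<close>.\<close>
  have hg: "bij_betw (h \<circ> g) {..<n} (verts H)" using P(2) h(1) unfolding VP by (rule bij_betw_trans)
  define ws where "ws = map (h \<circ> g) [0..<n]"
  have "distinct ws" "set ws = verts H"
    using hg by (auto simp: ws_def distinct_map bij_betw_def atLeast0LessThan)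
  moreover have "spread (edges H) ws"
    unfolding spread_nth
  proof (intro allI impI notI)
    fix i j assume ij: "i < j" "j \<le> i + 2" "j < length ws" "{ws ! i, ws ! j} \<in> edges H"
    then have jn: "j < n" "i < n" by (auto simp: ws_def)
    have gg: "g i < n" "g j < n" using P(2) jn unfolding VP by (auto simp: bij_betw_def)
    then have "h (g i) \<in> verts H" "h (g j) \<in> verts H" using h(1) by (auto simp: bij_betw_def)
    moreover have "{h (g i), h (g j)} \<in> edges H" using ij(4) jn by (simp add: ws_def)
    ultimately have "{f (h (g i)), f (h (g j))} \<in> edges G" using G(3) by blast
    then have "{g i, g j} \<in> edges G" using h(2) gg by simp
    moreover have "{i, j} \<in> edges (path_square n)"
      using jn ij unfolding path_square_edges by blast
    then have "{g i, g j} \<in> edges P" using P(3) jn by blast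
    ultimately show False using dis by blast
  qed
  ultimately show "\<exists>ws. spread_order (verts H) (edges H) ws" unfolding spread_order_def by blast
next
  assume "\<exists>ws. spread_order (verts H) (edges H) ws"
  then obtain ws where ws: "distinct ws" "set ws = verts H" "spread (edges H) ws"
    unfolding spread_order_def by blast
  have len: "length ws = n" using ws n distinct_card by metis
  have bij: "bij_betw ((!) ws) {..<n} (verts H)" using bij_betw_nth[OF ws(1)] len ws(2) by simp
  \<comment> \<open>\<open>f u\<close> is the position of \<open>u\<close> in \<open>ws\<close>; the
    path square itself is embedded by the identity.\<close>
  define f where "f = inv_into {..<n} ((!) ws)"
  have f: "bij_betw f (verts H) {..<n}" "\<And>u. u \<in> verts H \<Longrightarrow> ws ! f u = u"
    using bij unfolding f_def by (auto simp: bij_betw_inv_into bij_betw_inv_into_right)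
  let ?G = "\<lparr>verts = f ` verts H, edges = (`) f ` edges H\<rparr>"
  let ?P = "\<lparr>verts = id ` verts (path_square n), edges = (`) id ` edges (path_square n)\<rparr>"
  have "copy_in H ?G (complete_graph n)"
    using f by (intro embeds_copy embeds_complete H) (auto simp: bij_betw_def)
  moreover have "copy_in (path_square n) ?P (complete_graph n)"
    by (intro embeds_copy embeds_complete simple_path_square) (auto simp: path_square_verts)
  moreover have "edges ?G \<inter> edges ?P = {}"
  proof (rule ccontr)
    assume "edges ?G \<inter> edges ?P \<noteq> {}"
    then obtain e where e: "e \<in> edges H" "f ` e \<in> edges (path_square n)" by auto
    then obtain i j where ij: "f ` e = {i, j}" "i < j" "j \<le> i + 2" "j < n"
      by (auto simp: path_square_edges)
    have "e \<subseteq> verts H" using H e(1) by (auto simp: simple_graph_def)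
    then have "(!) ws ` f ` e = e" using f(2) by (force simp: image_image)
    then have "{ws ! i, ws ! j} = e" using ij(1) by simp
    then show False using ws(3) ij e(1) len by (auto simp: spread_nth)
  qed
  ultimately show "packs n H (path_square n)" unfolding packs_def by blast
qed

subsection \<open>The forbidden subgraphs\<close>

lemma simple_complete: "simple_graph (complete_graph k)"
  by (auto simp: simple_graph_def complete_graph_def)

lemma simple_star: "simple_graph (star_graph k)"
  by (auto simp: simple_graph_def star_graph_def)

lemma simple_K4_minus: "simple_graph K4_minus"
  by (auto simp: simple_graph_def complete_graph_def K4_minus_def)

lemma simple_disjoint_union:
  assumes "simple_graph G" "simple_graph H"
  shows "simple_graph (disjoint_union G H)"
proof -
  have inj: "inj_on (\<lambda>v. sum_encode (Inl v)) A" "inj_on (\<lambda>v. sum_encode (Inr v)) A" for A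
    by (auto simp: inj_on_def sum_encode_eq)
  have "e \<subseteq> verts (disjoint_union G H) \<and> card e = 2" if e: "e \<in> edges (disjoint_union G H)" for e
  proof -
    consider (l) d where "d \<in> edges G" "e = (\<lambda>v. sum_encode (Inl v)) ` d"
      | (r) d where "d \<in> edges H" "e = (\<lambda>v. sum_encode (Inr v)) ` d"
      using e unfolding disjoint_union_def by auto
    then show ?thesis
    proof cases
      case l
      then have "d \<subseteq> verts G" "card d = 2" using assms(1) by (auto simp: simple_graph_def)
      then show ?thesis using l(2) card_image[OF inj(1)] by (simp add: disjoint_union_def image_mono le_supI1)
    next
      case r
      then have "d \<subseteq> verts H" "card d = 2" using assms(2) by (auto simp: simple_graph_def)
      then show ?thesis using r(2) card_image[OF inj(2)] by (simp add: disjoint_union_def image_mono le_supI2)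
    qed
  qed
  moreover have "finite (verts (disjoint_union G H))"
    using assms by (simp add: simple_graph_def disjoint_union_def)
  ultimately show ?thesis by (simp add: simple_graph_def)
qed

lemma embeds_complete_iff:
  "embeds f (complete_graph k) H \<longleftrightarrow> inj_on f {..<k} \<and> f ` {..<k} \<subseteq> verts H \<and>
     (\<forall>i<k. \<forall>j<k. i \<noteq> j \<longrightarrow> {f i, f j} \<in> edges H)"
proof -
  have "(\<forall>u v. {u, v} \<in> edges (complete_graph k) \<longrightarrow> {f u, f v} \<in> edges H) \<longleftrightarrow>
     (\<forall>i<k. \<forall>j<k. i \<noteq> j \<longrightarrow> {f i, f j} \<in> edges H)"
    by (auto simp: complete_graph_def doubleton_eq_iff)
  then show ?thesis by (simp add: embeds_def complete_graph_def)
qed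

lemma embeds_star_iff:
  "embeds f (star_graph k) H \<longleftrightarrow> inj_on f {..<k} \<and> f ` {..<k} \<subseteq> verts H \<and>
     (\<forall>i. 0 < i \<longrightarrow> i < k \<longrightarrow> {f 0, f i} \<in> edges H)"
proof -
  have "(\<forall>u v. {u, v} \<in> edges (star_graph k) \<longrightarrow> {f u, f v} \<in> edges H) \<longleftrightarrow>
     (\<forall>i. 0 < i \<longrightarrow> i < k \<longrightarrow> {f 0, f i} \<in> edges H)"
    by (auto simp: star_graph_def doubleton_eq_iff insert_commute)
  then show ?thesis by (simp add: embeds_def star_graph_def)
qed

lemma embeds_disjoint_unionI:
  assumes "embeds f F H" "embeds g G H" "f ` verts F \<inter> g ` verts G = {}"
  shows "\<exists>h. embeds h (disjoint_union F G) H"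
proof -
  let ?h = "\<lambda>x. case sum_decode x of Inl v \<Rightarrow> f v | Inr v \<Rightarrow> g v"
  let ?A = "(\<lambda>v. sum_encode (Inl v)) ` verts F" and ?B = "(\<lambda>v. sum_encode (Inr v)) ` verts G"
  have V: "verts (disjoint_union F G) = ?A \<union> ?B" by (simp add: disjoint_union_def)
  have im: "?h ` ?A = f ` verts F" "?h ` ?B = g ` verts G" by (simp_all add: image_image)
  have "inj_on ?h ?A"
    by (rule inj_on_imageI) (use assms(1) in \<open>simp add: embeds_def comp_def\<close>)
  moreover have "inj_on ?h ?B"
    by (rule inj_on_imageI) (use assms(2) in \<open>simp add: embeds_def comp_def\<close>)
  moreover have "?h ` (?A - ?B) \<inter> ?h ` (?B - ?A) \<subseteq> ?h ` ?A \<inter> ?h ` ?B" by blast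
  then have "?h ` (?A - ?B) \<inter> ?h ` (?B - ?A) = {}" unfolding im assms(3) by simp
  ultimately have inj: "inj_on ?h (verts (disjoint_union F G))" unfolding V inj_on_Un by simp
  have "{?h u, ?h v} \<in> edges H" if uv: "{u, v} \<in> edges (disjoint_union F G)" for u v
  proof -
    consider (l) e where "e \<in> edges F" "{u, v} = (\<lambda>v. sum_encode (Inl v)) ` e"
      | (r) e where "e \<in> edges G" "{u, v} = (\<lambda>v. sum_encode (Inr v)) ` e"
      using uv unfolding disjoint_union_def by auto
    then show ?thesis
    proof cases
      case l
      obtain a where a: "a \<in> e" "u = sum_encode (Inl a)" using l(2) by blast
      obtain b where b: "b \<in> e" "v = sum_encode (Inl b)" using l(2) by blast
      have "c \<in> {a, b}" if "c \<in> e" for c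
      proof -
        have "sum_encode (Inl c) \<in> {u, v}" using l(2) that by blast
        then show ?thesis using a b by (auto simp: sum_encode_eq)
      qed
      then have "e = {a, b}" using a b by blast
      then show ?thesis using l(1) assms(1) a b by (simp add: embeds_def)
    next
      case r
      obtain a where a: "a \<in> e" "u = sum_encode (Inr a)" using r(2) by blast
      obtain b where b: "b \<in> e" "v = sum_encode (Inr b)" using r(2) by blast
      have "c \<in> {a, b}" if "c \<in> e" for c
      proof -
        have "sum_encode (Inr c) \<in> {u, v}" using r(2) that by blast
        then show ?thesis using a b by (auto simp: sum_encode_eq)
      qed
      then have "e = {a, b}" using a b by blast
      then show ?thesis using r(1) assms(2) a b by (simp add: embeds_def)
    qed
  qed
  moreover have "?h ` verts (disjoint_union F G) \<subseteq> verts H"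
    using assms(1,2) unfolding V image_Un im embeds_def by simp
  ultimately show ?thesis using inj unfolding embeds_def by blast
qed

lemma embeds_disjoint_unionD:
  assumes "embeds h (disjoint_union F G) H"
  obtains f g where "embeds f F H" "embeds g G H" "f ` verts F \<inter> g ` verts G = {}"
proof -
  let ?f = "\<lambda>v. h (sum_encode (Inl v))" and ?g = "\<lambda>v. h (sum_encode (Inr v))"
  have V: "verts (disjoint_union F G) =
      (\<lambda>v. sum_encode (Inl v)) ` verts F \<union> (\<lambda>v. sum_encode (Inr v)) ` verts G"
    by (simp add: disjoint_union_def)
  have inj: "inj_on h (verts (disjoint_union F G))" and sub: "h ` verts (disjoint_union F G) \<subseteq> verts H"
    and ed: "\<And>u v. {u, v} \<in> edges (disjoint_union F G) \<Longrightarrow> {h u, h v} \<in> edges H"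
    using assms by (auto simp: embeds_def)
  have fi: "inj_on ?f (verts F)"
  proof (rule inj_onI)
    fix a b assume "a \<in> verts F" "b \<in> verts F" "?f a = ?f b"
    then have "sum_encode (Inl a) = sum_encode (Inl b)" using inj_onD[OF inj] unfolding V by blast
    then show "a = b" by (simp add: sum_encode_eq)
  qed
  have gi: "inj_on ?g (verts G)"
  proof (rule inj_onI)
    fix a b assume "a \<in> verts G" "b \<in> verts G" "?g a = ?g b"
    then have "sum_encode (Inr a) = sum_encode (Inr b)" using inj_onD[OF inj] unfolding V by blast
    then show "a = b" by (simp add: sum_encode_eq)
  qed
  have subs: "?f ` verts F \<subseteq> verts H" "?g ` verts G \<subseteq> verts H" using sub unfolding V by auto
  have fe: "{?f u, ?f v} \<in> edges H" if "{u, v} \<in> edges F" for u v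
  proof -
    have "(\<lambda>v. sum_encode (Inl v)) ` {u, v} \<in> edges (disjoint_union F G)"
      using imageI[OF that, of "(`) (\<lambda>v. sum_encode (Inl v))"] by (simp add: disjoint_union_def)
    then show ?thesis using ed by simp
  qed
  have ge: "{?g u, ?g v} \<in> edges H" if "{u, v} \<in> edges G" for u v
  proof -
    have "(\<lambda>v. sum_encode (Inr v)) ` {u, v} \<in> edges (disjoint_union F G)"
      using imageI[OF that, of "(`) (\<lambda>v. sum_encode (Inr v))"] by (simp add: disjoint_union_def)
    then show ?thesis using ed by simp
  qed
  have "?f a \<noteq> ?g b" if ab: "a \<in> verts F" "b \<in> verts G" for a b
  proof
    assume "?f a = ?g b"
    then have "sum_encode (Inl a) = sum_encode (Inr b)"
      using inj_onD[OF inj] ab unfolding V by blast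
    then show False by (simp add: sum_encode_eq)
  qed
  then have dis: "?f ` verts F \<inter> ?g ` verts G = {}" by blast
  have "embeds ?f F H" "embeds ?g G H"
    unfolding embeds_def using fi gi subs fe ge by simp_all
  then show ?thesis using that[of ?f ?g] dis by simp
qed

section \<open>Forbidden graphs do not occur in ordered graphs\<close>

lemma spread_order_positions:
  assumes "spread_order V E ws" "f ` A \<subseteq> V" "inj_on f A"
  obtains p where "\<And>a. a \<in> A \<Longrightarrow> p a < length ws" "inj_on p A"
    "\<And>a b. a \<in> A \<Longrightarrow> b \<in> A \<Longrightarrow> a \<noteq> b \<Longrightarrow> {f a, f b} \<in> E \<Longrightarrow> p a + 3 \<le> p b \<or> p b + 3 \<le> p a"
proof -
  have ws: "distinct ws" "set ws = V" "spread E ws" using assms(1) by (auto simp: spread_order_def)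
  have "\<forall>a\<in>A. \<exists>i<length ws. ws ! i = f a"
    using ws(2) assms(2) by (metis image_subset_iff in_set_conv_nth)
  then obtain p where p: "\<And>a. a \<in> A \<Longrightarrow> p a < length ws" "\<And>a. a \<in> A \<Longrightarrow> ws ! p a = f a" by metis
  have inj: "inj_on p A"
    using p(2) assms(3) by (metis inj_on_def)
  have "p a + 3 \<le> p b \<or> p b + 3 \<le> p a" if ab: "a \<in> A" "b \<in> A" "a \<noteq> b" "{f a, f b} \<in> E" for a b
  proof -
    have "p a \<noteq> p b" using inj ab by (auto dest: inj_onD)
    moreover have "\<not> (p a < p b \<and> p b \<le> p a + 2)"
      using ws(3) p ab unfolding spread_nth by metis
    moreover have "{ws ! p b, ws ! p a} \<in> E" using p ab by (simp add: insert_commute)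
    then have "\<not> (p b < p a \<and> p a \<le> p b + 2)"
      using ws(3) p ab unfolding spread_nth by metis
    ultimately show ?thesis by linarith
  qed
  then show ?thesis using that p(1) inj by blast
qed

text \<open>Cut the positions into blocks of three. Positions of clique vertices are at least 3
  apart, so each block holds at most one of them, and there are
  \<open>(card (verts H) + 2) div 3\<close> blocks.\<close>

lemma order_no_large_clique:
  assumes ws: "spread_order (verts H) (edges H) ws" and c: "contains H (complete_graph r)"
  shows "3 * r \<le> card (verts H) + 2"
proof -
  obtain f where f: "inj_on f {..<r}" "f ` {..<r} \<subseteq> verts H"
      "\<forall>i<r. \<forall>j<r. i \<noteq> j \<longrightarrow> {f i, f j} \<in> edges H"
    using c by (auto simp: contains_iff[OF simple_complete] embeds_complete_iff)
  have len: "length ws = card (verts H)" using ws by (metis spread_order_def distinct_card)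
  obtain p where p: "\<And>i. i \<in> {..<r} \<Longrightarrow> p i < length ws" "inj_on p {..<r}"
      "\<And>i j. i \<in> {..<r} \<Longrightarrow> j \<in> {..<r} \<Longrightarrow> i \<noteq> j \<Longrightarrow> {f i, f j} \<in> edges H \<Longrightarrow> p i + 3 \<le> p j \<or> p j + 3 \<le> p i"
    by (rule spread_order_positions[OF ws f(2,1)], rule that; assumption)
  have "inj_on (\<lambda>i. p i div 3) {..<r}"
  proof (rule inj_onI, rule ccontr)
    fix i j assume ij: "i \<in> {..<r}" "j \<in> {..<r}" "p i div 3 = p j div 3" "i \<noteq> j"
    then have "p i + 3 \<le> p j \<or> p j + 3 \<le> p i" using p(3) f(3) by simp
    then show False using ij(3) by linarith
  qed
  moreover have "(\<lambda>i. p i div 3) ` {..<r} \<subseteq> {..<(card (verts H) + 2) div 3}"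
  proof
    fix x assume "x \<in> (\<lambda>i. p i div 3) ` {..<r}"
    then obtain i where "i \<in> {..<r}" "x = p i div 3" by blast
    moreover have "p i < card (verts H)" using p(1) calculation(1) len by simp
    ultimately show "x \<in> {..<(card (verts H) + 2) div 3}" by simp
  qed
  ultimately have "card {..<r} \<le> card {..<(card (verts H) + 2) div 3}" by (intro card_inj_on_le) auto
  then show ?thesis by simp
qed

lemma K4_minus_edges: "edges K4_minus = {{0, 2}, {0, 3}, {1, 2}, {1, 3}, {2, 3}}"
proof -
  have "{..<4::nat} = {0, 1, 2, 3}" by auto
  then have "edges (complete_graph 4) = {{0, 1}, {0, 2}, {0, 3}, {1, 2}, {1, 3}, {2, 3}}"
    unfolding complete_graph_def by (auto simp: numeral_eq_Suc less_Suc_eq)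
  then show ?thesis unfolding K4_minus_def by (auto simp: doubleton_eq_iff)
qed

text \<open>Among seven positions only 0, 3, 6 are pairwise at least 3 apart. The images of 2 and 3
  take two of these, and both 0 and 1 would need the third.\<close>

lemma order_no_K4_minus:
  assumes ws: "spread_order (verts H) (edges H) ws" and n: "card (verts H) = 7"
  shows "\<not> contains H K4_minus"
proof
  assume "contains H K4_minus"
  then obtain f where f: "embeds f K4_minus H" using contains_iff[OF simple_K4_minus] by blast
  have V: "verts K4_minus = {..<4}" by (simp add: K4_minus_def complete_graph_def)
  have inj: "inj_on f {..<4}" "f ` {..<4} \<subseteq> verts H"
    and e: "\<And>u v. {u, v} \<in> edges K4_minus \<Longrightarrow> {f u, f v} \<in> edges H"
    using f by (simp_all add: embeds_def V)
  have ed: "{f 0, f 2} \<in> edges H" "{f 0, f 3} \<in> edges H" "{f 1, f 2} \<in> edges H"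
      "{f 1, f 3} \<in> edges H" "{f 2, f 3} \<in> edges H"
    by (intro e; simp add: K4_minus_edges)+
  have len: "length ws = 7" using ws n by (metis spread_order_def distinct_card)
  obtain p where p: "\<And>i. i \<in> {..<4} \<Longrightarrow> p i < length ws" "inj_on p {..<4}"
      "\<And>i j. i \<in> {..<4} \<Longrightarrow> j \<in> {..<4} \<Longrightarrow> i \<noteq> j \<Longrightarrow> {f i, f j} \<in> edges H \<Longrightarrow> p i + 3 \<le> p j \<or> p j + 3 \<le> p i"
    by (rule spread_order_positions[OF ws inj(2,1)], rule that; assumption)
  have "p 0 < 7" "p 1 < 7" "p 2 < 7" "p 3 < 7" using p(1) len by simp_all
  moreover have "p 0 + 3 \<le> p 2 \<or> p 2 + 3 \<le> p 0" using p(3)[of 0 2] ed by simp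
  moreover have "p 0 + 3 \<le> p 3 \<or> p 3 + 3 \<le> p 0" using p(3)[of 0 3] ed by simp
  moreover have "p 1 + 3 \<le> p 2 \<or> p 2 + 3 \<le> p 1" using p(3)[of 1 2] ed by simp
  moreover have "p 1 + 3 \<le> p 3 \<or> p 3 + 3 \<le> p 1" using p(3)[of 1 3] ed by simp
  moreover have "p 2 + 3 \<le> p 3 \<or> p 3 + 3 \<le> p 2" using p(3)[of 2 3] ed by simp
  ultimately have "p 0 = p 1" by linarith
  then show False using p(2) by (auto dest: inj_onD)
qed

lemma order_unblocked:
  assumes ws: "spread_order V E ws" and g: "fgraph V E" and n: "3 \<le> card V"
  shows "unblocked V E"
  unfolding unblocked_def
proof
  fix c assume "c \<in> V"
  have d: "distinct ws" "set ws = V" "spread E ws" using ws by (auto simp: spread_order_def)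
  then have len: "length ws = card V" by (metis distinct_card)
  obtain k where k: "k < length ws" "ws ! k = c" using \<open>c \<in> V\<close> d(2) by (metis in_set_conv_nth)
  \<comment> \<open>The first of three consecutive positions around \<open>k\<close>; the minimum
    keeps them inside the list when \<open>c\<close> is one of the last two.\<close>
  define i where "i = min k (length ws - 3)"
  have i: "i + 2 < length ws" "i \<le> k" "k \<le> i + 2" using k len n by (auto simp: i_def)
  have free: "{ws ! a, ws ! b} \<notin> E" if "a \<in> {i, i + 1, i + 2}" "b \<in> {i, i + 1, i + 2}" for a b
  proof (rule ccontr)
    assume e: "\<not> ?thesis"
    then have "a \<noteq> b" using fgraph_edge(3)[OF g] by auto
    moreover have "{ws ! b, ws ! a} \<in> E" using e by (simp add: insert_commute)
    ultimately show False
      using d(3) e i that unfolding spread_nth by (cases "a < b") auto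
  qed
  have mem: "ws ! a \<in> V" if "a \<in> {i, i + 1, i + 2}" for a using that i d(2) by auto
  have neq: "ws ! a \<noteq> ws ! b" if "a \<in> {i, i + 1, i + 2}" "b \<in> {i, i + 1, i + 2}" "a \<noteq> b" for a b
    using that i d(1) by (auto simp: nth_eq_iff_index_eq)
  have "\<exists>a b. a \<in> {i, i + 1, i + 2} \<and> b \<in> {i, i + 1, i + 2} \<and> a \<noteq> k \<and> b \<noteq> k \<and> a \<noteq> b"
    using i by (intro exI[of _ "if k = i then i + 1 else i"] exI[of _ "if k = i + 2 then i + 1 else i + 2"]) auto
  then obtain a b where ab: "a \<in> {i, i + 1, i + 2}" "b \<in> {i, i + 1, i + 2}" "a \<noteq> k" "b \<noteq> k" "a \<noteq> b" by blast
  have k': "k \<in> {i, i + 1, i + 2}" using i by auto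
  show "\<exists>a\<in>V. \<exists>b\<in>V. a \<noteq> c \<and> b \<noteq> c \<and> a \<noteq> b \<and> {a, c} \<notin> E \<and> {b, c} \<notin> E \<and> {a, b} \<notin> E"
    using mem[OF ab(1)] mem[OF ab(2)] neq[OF ab(1) k' ab(3)] neq[OF ab(2) k' ab(4)] neq[OF ab(1,2,5)]
      free[OF ab(1) k'] free[OF ab(2) k'] free[OF ab(1,2)] k(2) by blast
qed

text \<open>All vertices of the star are the centre or adjacent to it, so the two non-neighbours of
  the centre lie outside and there would be n + 1 vertices.\<close>

lemma unblocked_no_star:
  assumes H: "simple_graph H" and ub: "unblocked (verts H) (edges H)" and n: "3 \<le> card (verts H)"
  shows "\<not> contains H (star_graph (card (verts H) - 1))"
proof
  let ?n = "card (verts H)"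
  assume "contains H (star_graph (?n - 1))"
  then obtain f where f: "inj_on f {..<?n - 1}" "f ` {..<?n - 1} \<subseteq> verts H"
      "\<forall>i. 0 < i \<longrightarrow> i < ?n - 1 \<longrightarrow> {f 0, f i} \<in> edges H"
    by (auto simp: contains_iff[OF simple_star] embeds_star_iff)
  have "f 0 \<in> verts H" using f(2) n by (auto simp: image_subset_iff)
  then obtain a b where ab: "a \<in> verts H" "b \<in> verts H" "a \<noteq> f 0" "b \<noteq> f 0" "a \<noteq> b"
      "{a, f 0} \<notin> edges H" "{b, f 0} \<notin> edges H"
    using ub unfolding unblocked_def by blast
  have out: "x \<notin> f ` {..<?n - 1}" if "x \<noteq> f 0" "{x, f 0} \<notin> edges H" for x
  proof
    assume "x \<in> f ` {..<?n - 1}"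
    then obtain i where "i < ?n - 1" "x = f i" by auto
    moreover from this have "0 < i" using that by (cases i) auto
    ultimately have "{f 0, x} \<in> edges H" using f(3) by simp
    then show False using that by (simp add: insert_commute)
  qed
  have fin: "finite (verts H)" using H by (simp add: simple_graph_def)
  have "card (insert a (insert b (f ` {..<?n - 1}))) \<le> ?n"
    using ab f(2) fin by (intro card_mono) auto
  moreover have "card (insert a (insert b (f ` {..<?n - 1}))) = ?n - 1 + 2"
    using out[OF ab(3,6)] out[OF ab(4,7)] ab(5) card_image[OF f(1)] by simp
  ultimately show False using n by linarith
qed

text \<open>The copy covers all vertices. Two non-neighbours of the centre must therefore be the
  ends of the K2, which are adjacent.\<close>

lemma unblocked_no_star_K2:
  assumes H: "simple_graph H" and ub: "unblocked (verts H) (edges H)" and n: "3 \<le> card (verts H)"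
  shows "\<not> contains H (star_K2 (card (verts H) - 2))"
proof
  let ?n = "card (verts H)"
  assume "contains H (star_K2 (?n - 2))"
  then obtain h where "embeds h (star_K2 (?n - 2)) H"
    using contains_iff[OF simple_disjoint_union[OF simple_star simple_complete]] by blast
  then obtain f g where fg: "embeds f (star_graph (?n - 2)) H" "embeds g (complete_graph 2) H"
      "f ` verts (star_graph (?n - 2)) \<inter> g ` verts (complete_graph 2) = {}"
    by (rule embeds_disjoint_unionD)
  have f: "inj_on f {..<?n - 2}" "f ` {..<?n - 2} \<subseteq> verts H"
      "\<forall>i. 0 < i \<longrightarrow> i < ?n - 2 \<longrightarrow> {f 0, f i} \<in> edges H"
    using fg(1) by (auto simp: embeds_star_iff)
  have g: "inj_on g {..<2}" "g ` {..<2} \<subseteq> verts H" "{g 0, g 1} \<in> edges H"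
    using fg(2) by (auto simp: embeds_complete_iff)
  have dis: "f ` {..<?n - 2} \<inter> g ` {..<2} = {}"
    using fg(3) by (simp add: star_graph_def complete_graph_def)
  have fin: "finite (verts H)" using H by (simp add: simple_graph_def)
  have "card (f ` {..<?n - 2} \<union> g ` {..<2}) = ?n"
    using card_Un_disjoint[OF _ _ dis] card_image[OF f(1)] card_image[OF g(1)] n by simp
  then have cover: "f ` {..<?n - 2} \<union> g ` {..<2} = verts H"
    using f(2) g(2) fin by (intro card_subset_eq) auto
  have "f 0 \<in> verts H" using f(2) n by (auto simp: image_subset_iff)
  then obtain a b where ab: "a \<in> verts H" "b \<in> verts H" "a \<noteq> f 0" "b \<noteq> f 0" "a \<noteq> b"
      "{a, f 0} \<notin> edges H" "{b, f 0} \<notin> edges H" "{a, b} \<notin> edges H"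
    using ub unfolding unblocked_def by blast
  have out: "x \<in> {g 0, g 1}" if "x \<in> verts H" "x \<noteq> f 0" "{x, f 0} \<notin> edges H" for x
  proof -
    have "x \<notin> f ` {..<?n - 2}"
    proof
      assume "x \<in> f ` {..<?n - 2}"
      then obtain i where "i < ?n - 2" "x = f i" by auto
      moreover from this have "0 < i" using that by (cases i) auto
      ultimately have "{f 0, x} \<in> edges H" using f(3) by simp
    then show False using that by (simp add: insert_commute)
    qed
    then have "x \<in> g ` {..<2}" using that(1) cover by blast
    then show ?thesis by (auto simp: numeral_2_eq_2 less_Suc_eq)
  qed
  have "{a, b} = {g 0, g 1}" using out[OF ab(1,3,6)] out[OF ab(2,4,7)] ab(5) by auto
  then show False using ab(8) g(3) by simp
qed

section \<open>Copies of forbidden graphs from violated conditions\<close>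

text \<open>The image is recorded because a disjoint K2 must later avoid it.\<close>

lemma embeds_star_nbrs:
  assumes H: "simple_graph H" and c: "c \<in> verts H" and k: "card (nbrs (edges H) c) + 1 = k"
  obtains f where "embeds f (star_graph k) H" "f ` {..<k} = insert c (nbrs (edges H) c)"
proof -
  let ?N = "nbrs (edges H) c"
  have g: "fgraph (verts H) (edges H)" using H by (simp add: simple_fgraph)
  have N: "finite ?N" "?N \<subseteq> verts H - {c}" using finite_nbrs[OF g] nbrs_subset[OF g] by auto
  have "card {1..<k} = card ?N" using k by simp
  then obtain h where h: "bij_betw h {1..<k} ?N" using N(1) by (metis finite_atLeastLessThan finite_same_card_bij)
  let ?f = "\<lambda>i. if i = 0 then c else h i"
  have dom: "{..<k} = insert 0 {1..<k}" using k by auto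
  have tail: "?f ` {1..<k} = h ` {1..<k}" by (rule image_cong) auto
  have "h ` {1..<k} = ?N" using h by (simp only: bij_betw_def)
  then have im: "?f ` {..<k} = insert c ?N" unfolding dom image_insert tail by simp
  have hN: "h l \<in> ?N" if "0 < l" "l < k" for l using bij_betwE[OF h] that by simp
  have fi: "inj_on ?f {..<k}"
  proof (rule inj_onI)
    fix i j assume ij: "i \<in> {..<k}" "j \<in> {..<k}" "?f i = ?f j"
    have hc: "h l \<noteq> c" if "0 < l" "l < k" for l using hN[OF that] N(2) by blast
    show "i = j"
    proof (cases "i = 0 \<or> j = 0")
      case True
      then show ?thesis
        using ij hc[of i] hc[of j] by (cases "i = 0"; cases "j = 0"; simp)
    next
      case False
      then have "i \<in> {1..<k}" "j \<in> {1..<k}" "h i = h j" using ij by auto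
      then show ?thesis using inj_onD[OF bij_betw_imp_inj_on[OF h]] by blast
    qed
  qed
  have fe: "{?f 0, ?f i} \<in> edges H" if "0 < i" "i < k" for i
    using hN[OF that] that by (simp add: nbrs_def)
  have "?f ` {..<k} \<subseteq> verts H" using im N(2) c by auto
  then have "inj_on ?f {..<k} \<and> ?f ` {..<k} \<subseteq> verts H \<and>
      (\<forall>i. 0 < i \<longrightarrow> i < k \<longrightarrow> {?f 0, ?f i} \<in> edges H)" using fi fe by blast
  then have "embeds ?f (star_graph k) H" by (rule embeds_star_iff[THEN iffD2])
  then show ?thesis using that[of ?f] im by blast
qed

text \<open>The alternatives of \<open>blocked_vertex\<close> are the two stars: a single
  non-neighbour of \<open>c\<close> is left out, or two adjacent ones form the K2.\<close>

lemma blocked_contains_star: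
  assumes H: "simple_graph H" and e: "card (edges H) + 2 \<le> card (verts H)"
    and b: "\<not> unblocked (verts H) (edges H)"
  shows "contains H (star_graph (card (verts H) - 1)) \<or> contains H (star_K2 (card (verts H) - 2))"
proof -
  let ?V = "verts H" and ?E = "edges H"
  have g: "fgraph ?V ?E" using H by (simp add: simple_fgraph)
  obtain c where c: "c \<in> ?V" "\<And>a b. a \<in> ?V \<Longrightarrow> b \<in> ?V \<Longrightarrow> a \<noteq> c \<Longrightarrow> b \<noteq> c \<Longrightarrow> a \<noteq> b \<Longrightarrow>
      {a, c} \<in> ?E \<or> {b, c} \<in> ?E \<or> {a, b} \<in> ?E"
    using b unfolding unblocked_def by auto
  from blocked_vertex(2)[OF g e c] show ?thesis
  proof
    assume d: "card (nbrs ?E c) + 2 = card ?V"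
    then have "card (nbrs ?E c) + 1 = card ?V - 1" by simp
    then obtain f where "embeds f (star_graph (card ?V - 1)) H" using embeds_star_nbrs[OF H c(1)] by metis
    then show ?thesis using contains_iff[OF simple_star] by blast
  next
    assume "card (nbrs ?E c) + 3 = card ?V \<and>
      (\<exists>a b. a \<noteq> b \<and> ?V - {c} - nbrs ?E c = {a, b} \<and> {a, b} \<in> ?E)"
    then obtain a b where d: "card (nbrs ?E c) + 1 = card ?V - 2"
      and ab: "a \<noteq> b" "?V - {c} - nbrs ?E c = {a, b}" "{a, b} \<in> ?E" by auto
    obtain f where f: "embeds f (star_graph (card ?V - 2)) H"
        "f ` {..<card ?V - 2} = insert c (nbrs ?E c)"
      using embeds_star_nbrs[OF H c(1) d] by metis
    let ?g = "\<lambda>i::nat. if i = 0 then a else b"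
    have abV: "a \<in> ?V" "b \<in> ?V" using fgraph_edge[OF g ab(3)] by auto
    have ba: "{b, a} \<in> ?E" using ab(3) by (simp add: insert_commute)
    have "{?g i, ?g j} \<in> ?E" if "i < 2" "j < 2" "i \<noteq> j" for i j
      using ab(3) ba that by (cases "i = 0"; cases "j = 0") simp_all
    moreover have "inj_on ?g {..<2}" using ab(1) by (auto simp: inj_on_def)
    ultimately have "embeds ?g (complete_graph 2) H"
      unfolding embeds_complete_iff using abV by auto
    moreover have "f ` verts (star_graph (card ?V - 2)) \<inter> ?g ` verts (complete_graph 2) = {}"
      using f(2) ab(2) by (auto simp: star_graph_def complete_graph_def)
    ultimately have "\<exists>h. embeds h (star_K2 (card ?V - 2)) H" using embeds_disjoint_unionI[OF f(1)] by blast
    then show ?thesis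
      using contains_iff[OF simple_disjoint_union[OF simple_star simple_complete]] by blast
  qed
qed

text \<open>From two elements on, each element of \<open>K\<close> is the end of an edge and hence a
  vertex of \<open>H\<close>, which the adjacency condition on \<open>K\<close> alone does not
  state.\<close>

lemma clique_contains_complete:
  assumes H: "simple_graph H" and K: "finite K" "card K = k" "2 \<le> k" "\<forall>u\<in>K. \<forall>v\<in>K. u \<noteq> v \<longrightarrow> {u, v} \<in> edges H"
  shows "contains H (complete_graph k)"
proof -
  have g: "fgraph (verts H) (edges H)" using H by (simp add: simple_fgraph)
  have sub: "K \<subseteq> verts H"
  proof
    fix u assume u: "u \<in> K"
    have "K - {u} \<noteq> {}" using K u by (metis card_Suc_Diff1 card.empty not_less_eq_eq numeral_2_eq_2 order_refl)
    then obtain v where "v \<in> K" "v \<noteq> u" by blast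
    then show "u \<in> verts H" using K(4) u fgraph_edge(1)[OF g] by metis
  qed
  have "card {..<k} = card K" using K by simp
  then obtain f where f: "bij_betw f {..<k} K" using K(1) by (metis finite_lessThan finite_same_card_bij)
  then have "inj_on f {..<k}" "f ` {..<k} = K" by (auto simp: bij_betw_def)
  then have "embeds f (complete_graph k) H"
    unfolding embeds_complete_iff using K(4) sub by (metis imageI inj_on_eq_iff lessThan_iff)
  then show ?thesis using contains_iff[OF simple_complete] by blast
qed

lemma triangle_contains:
  assumes H: "simple_graph H" and "triangle_in (edges H)"
  shows "contains H (complete_graph 3)"
proof -
  obtain a b c where e: "{a, b} \<in> edges H" "{a, c} \<in> edges H" "{b, c} \<in> edges H"
    using assms(2) unfolding triangle_in_def by blast
  then have "a \<noteq> b" "a \<noteq> c" "b \<noteq> c" using fgraph_edge(3)[OF H[unfolded simple_fgraph]] by auto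
  moreover have "{b, a} \<in> edges H" "{c, a} \<in> edges H" "{c, b} \<in> edges H"
    using e by (simp_all add: insert_commute)
  ultimately show ?thesis
    using e by (intro clique_contains_complete[OF H, of "{a, b, c}"]) auto
qed

lemma K4_contains:
  assumes H: "simple_graph H" and "K4_in (edges H)"
  shows "contains H (complete_graph 4)"
proof -
  obtain a b c d where e: "{a, b} \<in> edges H" "{a, c} \<in> edges H" "{b, c} \<in> edges H"
      "{a, d} \<in> edges H" "{b, d} \<in> edges H" "{c, d} \<in> edges H"
    using assms(2) unfolding K4_in_def by blast
  then have "distinct [a, b, c, d]" using fgraph_edge(3)[OF H[unfolded simple_fgraph]] by auto
  moreover have "{b, a} \<in> edges H" "{c, a} \<in> edges H" "{c, b} \<in> edges H"
      "{d, a} \<in> edges H" "{d, b} \<in> edges H" "{d, c} \<in> edges H"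
    using e by (simp_all add: insert_commute)
  ultimately show ?thesis
    using e by (intro clique_contains_complete[OF H, of "{a, b, c, d}"]) auto
qed

lemma diamond_contains:
  assumes H: "simple_graph H" and "diamond_in (edges H)"
  shows "contains H K4_minus"
proof -
  have g: "fgraph (verts H) (edges H)" using H by (simp add: simple_fgraph)
  obtain a b c d where e: "c \<noteq> d" "{a, b} \<in> edges H" "{a, c} \<in> edges H" "{b, c} \<in> edges H"
      "{a, d} \<in> edges H" "{b, d} \<in> edges H"
    using assms(2) unfolding diamond_in_def by blast
  then have dis: "distinct [a, b, c, d]" using fgraph_edge(3)[OF g] by auto
  \<comment> \<open>\<open>K4_minus\<close> lacks the edge between 0 and 1, so these go to the
    possibly nonadjacent \<open>c\<close> and \<open>d\<close>.\<close>
  let ?f = "\<lambda>i::nat. if i = 0 then c else if i = 1 then d else if i = 2 then a else b"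
  have V: "verts K4_minus = {0, 1, 2, 3}" by (auto simp: K4_minus_def complete_graph_def)
  have "inj_on ?f {0, 1, 2, 3}" using dis by (auto simp: inj_on_def)
  moreover have "?f ` {0, 1, 2, 3} \<subseteq> verts H" using e fgraph_edge(1,2)[OF g] by auto
  moreover have "{b, a} \<in> edges H" "{c, a} \<in> edges H" "{c, b} \<in> edges H"
      "{d, a} \<in> edges H" "{d, b} \<in> edges H"
    using e by (simp_all add: insert_commute)
  then have "{?f u, ?f v} \<in> edges H" if "{u, v} \<in> edges K4_minus" for u v
    using that e unfolding K4_minus_edges by (auto simp: doubleton_eq_iff)
  ultimately have "embeds ?f K4_minus H" unfolding embeds_def V by blast
  then show ?thesis using contains_iff[OF simple_K4_minus] by blast
qed

section \<open>The forbidden families\<close>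

text \<open>The additions at 6 and 9 make both stars members for every n \<ge> 6, so one condition,
  \<open>unblocked\<close>, serves all sizes.\<close>

lemma family_members:
  assumes "6 \<le> n"
  shows "star_K2 (n - 2) \<in> family_H_star n" "star_graph (n - 1) \<in> family_H_star n"
    "n = 6 \<Longrightarrow> complete_graph 3 \<in> family_H_star n" "n = 7 \<Longrightarrow> K4_minus \<in> family_H_star n"
    "n \<in> {8, 9} \<Longrightarrow> complete_graph 4 \<in> family_H_star n" "n = 12 \<Longrightarrow> complete_graph 5 \<in> family_H_star n"
  using assms by (auto simp: family_H_star_def family_H_def)

lemma family_cases:
  assumes "6 \<le> n" "F \<in> family_H_star n"
  obtains "F = star_K2 (n - 2)" | "F = star_graph (n - 1)" | "n = 6" "F = complete_graph 3"
    | "n = 7" "F = K4_minus" | "n \<in> {8, 9}" "F = complete_graph 4" | "n = 12" "F = complete_graph 5"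
proof -
  consider "n = 6" | "n = 7" | "n = 8" | "n = 9" | "n = 10" | "n = 11" | "n = 12" | "n = 13" | "14 \<le> n"
    using assms(1) by linarith
  then have "F = star_K2 (n - 2) \<or> F = star_graph (n - 1) \<or> n = 6 \<and> F = complete_graph 3 \<or>
      n = 7 \<and> F = K4_minus \<or> n \<in> {8, 9} \<and> F = complete_graph 4 \<or> n = 12 \<and> F = complete_graph 5"
    by cases (use assms(2) in \<open>simp_all add: family_H_star_def family_H_def\<close>, argo+)
  then show ?thesis using that by blast
qed

theorem theorem1p2:
  fixes n :: nat and H :: "'a sgraph"
  assumes "n \<ge> 6"
    and "simple_graph H"
    and "card (verts H) = n"
    and "card (edges H) \<le> n - 2"
  shows "packs n H (graph_power 2 (path_graph n)) \<longleftrightarrow> free_of (family_H_star n) H"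
proof -
  note n = assms(1) and H = assms(2) and cV = assms(3)
  have g: "fgraph (verts H) (edges H)" using H by (simp add: simple_fgraph)
  have e: "card (edges H) + 2 \<le> card (verts H)" using assms by simp
  have "(\<exists>ws. spread_order (verts H) (edges H) ws) \<longleftrightarrow> free_of (family_H_star n) H"
  proof
    assume "\<exists>ws. spread_order (verts H) (edges H) ws"
    then obtain ws where ws: "spread_order (verts H) (edges H) ws" by blast
    have three: "3 \<le> card (verts H)" using n cV by simp
    have ub: "unblocked (verts H) (edges H)" by (rule order_unblocked[OF ws g three])
    show "free_of (family_H_star n) H"
      unfolding free_of_def
    proof
      fix F assume "F \<in> family_H_star n"
      with n show "\<not> contains H F"
      proof (cases rule: family_cases)
        case 1
        then show ?thesis using unblocked_no_star_K2[OF H ub three] cV by simp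
      next
        case 2
        then show ?thesis using unblocked_no_star[OF H ub three] cV by simp
      next
        case 3
        then show ?thesis using order_no_large_clique[OF ws, of 3] cV by auto
      next
        case 4
        then show ?thesis using order_no_K4_minus[OF ws] cV by simp
      next
        case 5
        then show ?thesis using order_no_large_clique[OF ws, of 4] cV by auto
      next
        case 6
        then show ?thesis using order_no_large_clique[OF ws, of 5] cV by auto
      qed
    qed
  next
    assume free: "free_of (family_H_star n) H"
    have "admissible (verts H) (edges H)"
      unfolding admissible_def
    proof (intro conjI impI)
      show "unblocked (verts H) (edges H)"
        using blocked_contains_star[OF H e] free family_members(1,2)[OF n] cV by (auto simp: free_of_def)
      show "\<not> triangle_in (edges H)" if "card (verts H) = 6"
        using triangle_contains[OF H] free family_members(3)[OF n] that cV by (auto simp: free_of_def)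
      show "\<not> diamond_in (edges H)" if "card (verts H) = 7"
        using diamond_contains[OF H] free family_members(4)[OF n] that cV by (auto simp: free_of_def)
      show "\<not> K4_in (edges H)" if "card (verts H) \<in> {8, 9}"
        using K4_contains[OF H] free family_members(5)[OF n] that cV by (auto simp: free_of_def)
      show "\<not> clique_in 5 (edges H)" if "card (verts H) = 12"
      proof
        assume "clique_in 5 (edges H)"
        then have "contains H (complete_graph 5)"
          unfolding clique_in_def using clique_contains_complete[OF H, of _ 5] by auto
        then show False using free family_members(6)[OF n] that cV by (simp add: free_of_def)
      qed
    qed (rule e)
    then show "\<exists>ws. spread_order (verts H) (edges H) ws"
      using admissible_imp_order[OF g] n cV by simp
  qed
  then show ?thesis using packs_path_square_iff[OF H cV] by simp
qed

end
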